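(* For any given data as in the context, there exists a solution to the innovation MFG system. Furthermore, if $\|PA\|_1$ is fixed, there is a constant $\underline{C}>0$, depending only on $\sigma,\rho,w,\alpha,\gamma,B,\bar z$ and on the value of $\|PA\|_1$ (and not otherwise on $P$ or $A$), such that this solution is unique provided $A_\ell P_\ell<\frac{1}{\underline{C}}$ for every $\ell=1,\dots,L$.
   Context: Data: an integer $L\ge 1$; $\Omega=(0,\bar z)$ with $\bar z>0$; constants $\sigma>0$, $\rho>0$, $w>0$, $B>0$, $\alpha\in(0,1)$, $\gamma\in(0,1)$; weights $A_\ell\in(0,1)$ with $\sum_{\ell=1}^L A_\ell=1$; and nonnegative real numbers $p(\ell,\ell')$, $\ell,\ell'=1,\dots,L$. $P$ is the $L\times L$ matrix with entries $P_{\ell,\ell'}=p(\ell,\ell')$, $A=(A_1,\dots,A_L)^T$, $P_\ell=\sum_{\ell'=1}^Lp(\ell',\ell)$, and $\|x\|_1=\sum_{\ell=1}^L|x_\ell|$ for $x\in\mathbb{R}^L$. For $\ell=1,\dots,L$, $z\in\Omega$, $m=(m_1,\dots,m_L)\in (H^1(\Omega))^L$, $\lambda\in\mathbb{R}$ define the Hamiltonian $$H_\ell(z,m,\lambda)=(1-\gamma)\left(\tfrac{\gamma}{w}\right)^{\frac{\gamma}{1-\gamma}}\max(0,\lambda)^{\frac{1}{1-\gamma}}+\lambda\sum_{\ell'=1}^L A_{\ell'}p(\ell,\ell')\int_\Omega z' m_{\ell'}(z')\,dz'+\frac{z^\alpha}{B^{\alpha-1}},$$ so that $\partial_\lambda H_\ell(z,m,\lambda)=\left(\tfrac{\gamma}{w}\max(0,\lambda)\right)^{\frac{\gamma}{1-\gamma}}+\sum_{\ell'=1}^L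 A_{\ell'}p(\ell,\ell')\int_\Omega z' m_{\ell'}(z')\,dz'$. The innovation MFG system is: for every $\ell=1,\dots,L$, $V_\ell\in H^1(\Omega)$, $m_\ell\in H^1(\Omega)$ and $$-\tfrac{\sigma^2}{2}V_\ell''+\rho V_\ell-H_\ell(z,m,V_\ell')=0 \ \text{ in }\Omega,\qquad V_\ell'|_{z=0,\bar z}=0,$$ $$-\tfrac{\sigma^2}{2}m_\ell''+\left(\partial_\lambda H_\ell(z,m,V_\ell')\,m_\ell\right)'=0\ \text{ in }\Omega,\qquad \left.-\tfrac{\sigma^2}{2}m_\ell'+\partial_\lambda H_\ell(z,m,0)\,m_\ell\right|_{z=0,\bar z}=0,\qquad \int_\Omega m_\ell(z)\,dz=1.$$ A solution is a tuple $(m_1,\dots,m_L,V_1,\dots,V_L)$ with $m_\ell:\Omega\to(0,\infty)$ and $V_\ell:\Omega\to\mathbb{R}$ satisfying this system in the weak sense for each $\ell$, i.e. the nonlinear terms $H_\ell(\cdot,m,V_\ell')$ and $\partial_\lambda H_\ell(\cdot,m,V_\ell')m_\ell$ are integrable and, for all smooth test functions $\varphi$ on $\bar\Omega$, $\int_\Omega \frac{\sigma^2}{2}V_\ell'\varphi'+\rho V_\ell\varphi-H_\ell(z,m,V_\ell')\varphi\,dz=0$ and $\int_\Omega\left(\frac{\sigma^2}{2}m_\ell'-\partial_\lambda H_\ell(z,m,V_\ell')m_\ell\right)\varphi'\,dz=0$, together with $\int_\Omega m_\ell=1$. *)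

theory Defs
  imports "HOL-Analysis.Analysis"
begin

text \<open>
  The space of smooth functions on a closed interval is rendered, as usual, by restrictions of smooth
  functions on the whole real line.
\<close>

definition smooth :: "(real \<Rightarrow> real) \<Rightarrow> bool" where
  "smooth \<phi> \<longleftrightarrow> (\<forall>n x. ((deriv ^^ n) \<phi>) differentiable (at x))"

definition test_function :: "real set \<Rightarrow> (real \<Rightarrow> real) \<Rightarrow> bool" where
  "test_function S \<phi> \<longleftrightarrow>
     smooth \<phi> \<and> compact (closure {x. \<phi> x \<noteq> 0}) \<and> closure {x. \<phi> x \<noteq> 0} \<subseteq> S"

definition L2_on :: "real set \<Rightarrow> (real \<Rightarrow> real) set" where
  "L2_on S = {f. set_borel_measurable lebesgue S f \<and> set_integrable lebesgue S (\<lambda>x. (f x)\<^sup>2)}"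

definition has_weak_deriv :: "real set \<Rightarrow> (real \<Rightarrow> real) \<Rightarrow> (real \<Rightarrow> real) \<Rightarrow> bool" where
  "has_weak_deriv S f g \<longleftrightarrow>
     (\<forall>K. compact K \<and> K \<subseteq> S \<longrightarrow> set_integrable lebesgue K f \<and> set_integrable lebesgue K g) \<and>
     (\<forall>\<phi>. test_function S \<phi> \<longrightarrow>
        (LINT x:S|lebesgue. f x * deriv \<phi> x) = - (LINT x:S|lebesgue. g x * \<phi> x))"

definition H1_on :: "real set \<Rightarrow> (real \<Rightarrow> real) set" where
  "H1_on S = {f \<in> L2_on S. \<exists>g \<in> L2_on S. has_weak_deriv S f g}"

text \<open>
  For \<open>f\<close> in \<open>H1_on S\<close> with \<open>S\<close> open, the weak derivative is determined up to a null set; the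
  definition picks one square-integrable representative. It is only ever used under integrals.
\<close>

definition weak_deriv :: "real set \<Rightarrow> (real \<Rightarrow> real) \<Rightarrow> real \<Rightarrow> real" where
  "weak_deriv S f = (SOME g. g \<in> L2_on S \<and> has_weak_deriv S f g)"

text \<open>
  Vectors indexed by \<open>1, \<dots>, L\<close> are functions on \<open>nat\<close> of which only the values on \<open>{1..L}\<close> matter.
\<close>

definition mat_vec :: "nat \<Rightarrow> (nat \<Rightarrow> nat \<Rightarrow> real) \<Rightarrow> (nat \<Rightarrow> real) \<Rightarrow> nat \<Rightarrow> real" where
  "mat_vec L p A l = (\<Sum>l'=1..L. p l l' * A l')"

definition norm1 :: "nat \<Rightarrow> (nat \<Rightarrow> real) \<Rightarrow> real" where
  "norm1 L x = (\<Sum>l=1..L. \<bar>x l\<bar>)"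

definition col_sum :: "nat \<Rightarrow> (nat \<Rightarrow> nat \<Rightarrow> real) \<Rightarrow> nat \<Rightarrow> real" where
  "col_sum L p l = (\<Sum>l'=1..L. p l' l)"

definition network_data :: "nat \<Rightarrow> (nat \<Rightarrow> real) \<Rightarrow> (nat \<Rightarrow> nat \<Rightarrow> real) \<Rightarrow> bool" where
  "network_data L A p \<longleftrightarrow> 1 \<le> L \<and>
     (\<forall>l\<in>{1..L}. 0 < A l \<and> A l < 1) \<and> (\<Sum>l=1..L. A l) = 1 \<and>
     (\<forall>l\<in>{1..L}. \<forall>l'\<in>{1..L}. 0 \<le> p l l')"

definition spillover ::
  "real \<Rightarrow> nat \<Rightarrow> (nat \<Rightarrow> real) \<Rightarrow> (nat \<Rightarrow> nat \<Rightarrow> real) \<Rightarrow> nat \<Rightarrow> (nat \<Rightarrow> real \<Rightarrow> real) \<Rightarrow> real"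
where
  "spillover zb L A p l m =
     (\<Sum>l'=1..L. A l' * p l l' * (LINT z:{0<..<zb}|lebesgue. z * m l' z))"

definition hamiltonian ::
  "real \<Rightarrow> real \<Rightarrow> real \<Rightarrow> real \<Rightarrow> real \<Rightarrow> nat \<Rightarrow> (nat \<Rightarrow> real) \<Rightarrow> (nat \<Rightarrow> nat \<Rightarrow> real) \<Rightarrow>
   nat \<Rightarrow> real \<Rightarrow> (nat \<Rightarrow> real \<Rightarrow> real) \<Rightarrow> real \<Rightarrow> real"
where
  "hamiltonian w \<alpha> \<gamma> B zb L A p l z m \<mu> =
     (1 - \<gamma>) * (\<gamma> / w) powr (\<gamma> / (1 - \<gamma>)) * max 0 \<mu> powr (1 / (1 - \<gamma>))
     + \<mu> * spillover zb L A p l m + z powr \<alpha> / B powr (\<alpha> - 1)"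

definition hamiltonian_deriv ::
  "real \<Rightarrow> real \<Rightarrow> real \<Rightarrow> nat \<Rightarrow> (nat \<Rightarrow> real) \<Rightarrow> (nat \<Rightarrow> nat \<Rightarrow> real) \<Rightarrow>
   nat \<Rightarrow> (nat \<Rightarrow> real \<Rightarrow> real) \<Rightarrow> real \<Rightarrow> real"
where
  "hamiltonian_deriv w \<gamma> zb L A p l m \<mu> =
     (\<gamma> / w * max 0 \<mu>) powr (\<gamma> / (1 - \<gamma>)) + spillover zb L A p l m"

lemma hamiltonian_has_deriv:
  assumes "0 < w" "0 < \<gamma>" "\<gamma> < 1"
  shows "((\<lambda>\<mu>. hamiltonian w \<alpha> \<gamma> B zb L A p l z m \<mu>) has_real_derivative
           hamiltonian_deriv w \<gamma> zb L A p l m \<mu>) (at \<mu>)"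
proof -
  define q where "q = 1 / (1 - \<gamma>)"
  have q1: "q > 1" and qe: "q - 1 = \<gamma> / (1 - \<gamma>)" and qg: "(1 - \<gamma>) * q = 1"
    using assms by (auto simp: q_def field_simps)
  have D: "((\<lambda>x. max 0 x powr q) has_real_derivative q * max 0 \<mu> powr (q - 1)) (at \<mu>)"
  proof -
    consider "\<mu> > 0" | "\<mu> < 0" | "\<mu> = 0" by linarith
    then show ?thesis
    proof cases
      case 1
      have "((\<lambda>x. x powr q) has_real_derivative q * \<mu> powr (q - 1)) (at \<mu>)"
        using 1 by (rule has_real_derivative_powr)
      moreover have "eventually (\<lambda>x. x powr q = max 0 x powr q) (nhds \<mu>)"
        using eventually_nhds_in_open[of "{0<..}" \<mu>] 1
        by (auto elim!: eventually_mono simp: max_def)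
      ultimately show ?thesis
        using 1 by (subst DERIV_cong_ev[OF refl _ refl, of _ "\<lambda>x. x powr q"])
                   (auto elim: eventually_mono)
    next
      case 2
      have "eventually (\<lambda>x. max 0 x powr q = 0) (nhds \<mu>)"
        using eventually_nhds_in_open[of "{..<0}" \<mu>] 2
        by (auto elim!: eventually_mono simp: max_def)
      then show ?thesis
        using 2 by (subst DERIV_cong_ev[OF refl _ refl, of _ "\<lambda>x. 0"]) auto
    next
      case 3
      have "((\<lambda>h. \<bar>h\<bar> powr (q - 1)) \<longlongrightarrow> \<bar>0\<bar> powr (q - 1)) (at (0::real))"
        using q1 by (intro tendsto_powr2 tendsto_intros) auto
      then have "((\<lambda>h. \<bar>h\<bar> powr (q - 1)) \<longlongrightarrow> 0) (at (0::real))" by simp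
      then have "((\<lambda>h. max 0 h powr q / h) \<longlongrightarrow> 0) (at (0::real))"
      proof (rule Lim_null_comparison[rotated])
        show "\<forall>\<^sub>F h in at (0::real). norm (max 0 h powr q / h) \<le> \<bar>h\<bar> powr (q - 1)"
          using q1 by (intro always_eventually allI) (auto simp: max_def powr_diff intro!: divide_nonneg_neg)
      qed
      then show ?thesis using 3 q1 by (simp add: DERIV_def)
    qed
  qed
  have "((\<lambda>\<mu>. (1 - \<gamma>) * (\<gamma> / w) powr (\<gamma> / (1 - \<gamma>)) * max 0 \<mu> powr q
          + \<mu> * spillover zb L A p l m + z powr \<alpha> / B powr (\<alpha> - 1)) has_real_derivative
        (1 - \<gamma>) * (\<gamma> / w) powr (\<gamma> / (1 - \<gamma>)) * (q * max 0 \<mu> powr (q - 1))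
          + spillover zb L A p l m) (at \<mu>)"
    using DERIV_add[OF DERIV_add[OF DERIV_cmult[OF D] DERIV_cmult_right[OF DERIV_ident]] DERIV_const]
    by simp
  moreover have "(1 - \<gamma>) * (\<gamma> / w) powr (\<gamma> / (1 - \<gamma>)) * (q * max 0 \<mu> powr (q - 1))
      = (\<gamma> / w * max 0 \<mu>) powr (\<gamma> / (1 - \<gamma>))"
  proof -
    have "(1 - \<gamma>) * (\<gamma> / w) powr (\<gamma> / (1 - \<gamma>)) * (q * max 0 \<mu> powr (q - 1))
        = ((1 - \<gamma>) * q) * ((\<gamma> / w) powr (\<gamma> / (1 - \<gamma>)) * max 0 \<mu> powr (\<gamma> / (1 - \<gamma>)))"
      by (simp add: qe)
    then show ?thesis using assms by (simp only: qg powr_mult)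
  qed
  ultimately show ?thesis
    by (simp add: hamiltonian_def hamiltonian_deriv_def q_def)
qed

text \<open>
  Elements of the Sobolev space on an interval are represented by their continuous representative,
  so that positivity and equality of solutions are meant pointwise. The boundary conditions are
  encoded in the weak formulation by test functions that need not vanish at the end points.
\<close>

definition mfg_solution ::
  "real \<Rightarrow> real \<Rightarrow> real \<Rightarrow> real \<Rightarrow> real \<Rightarrow> real \<Rightarrow> real \<Rightarrow>
   nat \<Rightarrow> (nat \<Rightarrow> real) \<Rightarrow> (nat \<Rightarrow> nat \<Rightarrow> real) \<Rightarrow>
   (nat \<Rightarrow> real \<Rightarrow> real) \<Rightarrow> (nat \<Rightarrow> real \<Rightarrow> real) \<Rightarrow> bool"
where
  "mfg_solution \<sigma> \<rho> w \<alpha> \<gamma> B zb L A p m V \<longleftrightarrow>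
     (let \<Omega> = {0<..<zb} in \<forall>l\<in>{1..L}.
        let dV = weak_deriv \<Omega> (V l);
            dm = weak_deriv \<Omega> (m l);
            H = (\<lambda>z. hamiltonian w \<alpha> \<gamma> B zb L A p l z m (dV z));
            H' = (\<lambda>z. hamiltonian_deriv w \<gamma> zb L A p l m (dV z))
        in V l \<in> H1_on \<Omega> \<and> continuous_on \<Omega> (V l) \<and>
           m l \<in> H1_on \<Omega> \<and> continuous_on \<Omega> (m l) \<and> (\<forall>z\<in>\<Omega>. 0 < m l z) \<and>
           set_integrable lebesgue \<Omega> H \<and>
           set_integrable lebesgue \<Omega> (\<lambda>z. H' z * m l z) \<and>
           (\<forall>\<phi>. smooth \<phi> \<longrightarrow>
              (LINT z:\<Omega>|lebesgue.
                 \<sigma>\<^sup>2 / 2 * dV z * deriv \<phi> z + \<rho> * V l z * \<phi> z - H z * \<phi> z) = 0) \<and>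
           (\<forall>\<phi>. smooth \<phi> \<longrightarrow>
              (LINT z:\<Omega>|lebesgue. (\<sigma>\<^sup>2 / 2 * dm z - H' z * m l z) * deriv \<phi> z) = 0) \<and>
           (LINT z:\<Omega>|lebesgue. m l z) = 1)"

end

theory Submission
  imports Defs
begin

text \<open>
  The coupling between the equations is only through the numbers
  \<open>c\<^sub>l = (\<Sum>l'. A\<^sub>l' p(l,l') \<integral> z m\<^sub>l')\<close>. For a fixed number \<open>c \<ge> 0\<close> the value function solves a
  scalar Neumann problem, which has exactly one solution (shooting and the maximum principle), and
  since the flux of the density vanishes at the boundary, the density is the Gibbs density
  proportional to \<open>exp (\<integral> b)\<close>, where \<open>b\<close> is the drift divided by the diffusion. Hence solutions
  correspond to fixed points of \<open>c\<^sub>l = (\<Sum>l'. A\<^sub>l' p(l,l') E(c\<^sub>l'))\<close>, where \<open>E(c)\<close> is the mean of that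
  density. Existence follows from Brouwer's theorem. As \<open>E\<close> is Lipschitz with a constant \<open>K\<close> on the
  range of \<open>c\<close> allowed by the norm of \<open>PA\<close>, summing over \<open>l\<close> shows
  \<open>(\<Sum>l. |c\<^sub>l - c'\<^sub>l|) \<le> K max (A\<^sub>l P\<^sub>l) (\<Sum>l. |c\<^sub>l - c'\<^sub>l|)\<close> for two solutions, hence uniqueness.

  The Lipschitz estimate is delicate because the optimal innovation rate is only Hoelder continuous
  at slope \<open>0\<close> when \<open>\<gamma> < 1 / 2\<close>, and the slope \<open>V'\<close> does vanish at both end points. It is
  nevertheless bounded below by a multiple of the distance to the boundary, and the difference of
  two slopes is bounded above by such a multiple times \<open>|c - c'|\<close>; together these compensate the
  singularity.
\<close>

subsection \<open>Brouwer's fixed point theorem on boxes of varying dimension\<close>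

text \<open>The Hamiltonian grows faster than linearly in the slope, so the theory of Lipschitz
  initial value problems does not apply to it directly. It is cut off at a slope R; the a priori
  bound on V' does not depend on R, so the cut can be removed again. The lower bound on V' comes
  from the strict growth of the revenue, the bound on the difference of two slopes from the fact
  that all slopes vanish at both ends. With \<beta> = \<gamma> / (1 - \<gamma>) < 1 and d the
  distance to the boundary, a change of size k d in a slope that is at least \<eta> d alters its
  power \<beta> by at most a multiple of k d (\<eta> d)^(\<beta> - 1), which is k \<eta>^(\<beta> -
  1) d^\<beta> and hence bounded. Since a mean over \<Omega> is at most zb, every admissible c lies
  between 0 and zb times the norm of PA; this is the only way in which the network enters K.
  Interchanging the sums over l and l' turns rows of P into columns, which is where the products of
  A and the column sums arise.\<close>

text \<open>Brouwer's theorem with coordinates indexed by an initial segment of the naturals, so that the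
  dimension can be quantified over.\<close>

lemma brouwer_approx_unit_box:
  fixes F :: "(nat \<Rightarrow> real) \<Rightarrow> nat \<Rightarrow> real" and n :: nat
  assumes Q: "Q = {x. \<forall>i<n. 0 \<le> x i \<and> x i \<le> 1}"
    and maps: "\<And>x i. x \<in> Q \<Longrightarrow> i < n \<Longrightarrow> 0 \<le> F x i \<and> F x i \<le> 1"
    and K: "0 \<le> K" "\<And>x y i d. x \<in> Q \<Longrightarrow> y \<in> Q \<Longrightarrow> i < n \<Longrightarrow> (\<And>j. j < n \<Longrightarrow> \<bar>x j - y j\<bar> \<le> d) \<Longrightarrow>
          \<bar>F x i - F y i\<bar> \<le> K * d"
    and e: "0 < e"
  shows "\<exists>z\<in>Q. \<forall>i<n. \<bar>F z i - z i\<bar> \<le> e"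
proof -
  have "\<forall>x. x \<in> Q \<longrightarrow> F x \<in> Q" "\<forall>x. x \<in> Q \<longrightarrow> (\<forall>i. i < n \<longrightarrow> 0 \<le> x i \<and> x i \<le> 1)"
    using maps by (auto simp: Q)
  \<comment> \<open>Label 0 in coordinate i is given only where \<open>F\<close> does not decrease
    \<open>x i\<close>, label 1 only where it does not increase it. On the faces of the box the
    label is prescribed, as Kuhn's combinatorial lemma demands.\<close>
  from kuhn_labelling_lemma'[OF this]
  obtain l where "\<forall>x i. l x i \<le> (1::nat)" "\<forall>x i. x \<in> Q \<and> i < n \<and> x i = 0 \<longrightarrow> l x i = 0"
    "\<forall>x i. x \<in> Q \<and> i < n \<and> x i = 1 \<longrightarrow> l x i = 1" "\<forall>x i. x \<in> Q \<and> i < n \<and> l x i = 0 \<longrightarrow> x i \<le> F x i"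
    "\<forall>x i. x \<in> Q \<and> i < n \<and> l x i = 1 \<longrightarrow> F x i \<le> x i" by (elim exE conjE)
  note l = this(2-5)[rule_format, OF conjI[OF _ conjI]] and l1 = this(1)[rule_format]
  have l01: "l x i = 0 \<or> l x i = 1" for x i using l1[of x i] by linarith
  \<comment> \<open>The mesh of the grid is 1 / p. Passing from a vertex of a cell to its corner
    \<open>q\<close> costs 1 / p in the point and K / p in the value, so 3 (K + 1) / p is a generous
    bound for the total loss.\<close>
  obtain p0 :: nat where p0: "(3 + 3 * K) / e < real p0" using reals_Archimedean2 by blast
  define p where "p = Suc p0"
  have p: "p > 0" "(3 + 3 * K) / real p \<le> e"
    using p0 e K by (auto simp: p_def field_simps) 
  define pt where "pt = (\<lambda>x :: nat \<Rightarrow> nat. \<lambda>i. real (x i) / real p)"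
  have ptQ: "pt x \<in> Q" if "\<forall>i<n. x i \<le> p" for x
    using that p by (auto simp: Q pt_def)
  obtain q where q: "\<forall>i<n. q i < p"
    and rs: "\<forall>i<n. \<exists>r s. (\<forall>j<n. q j \<le> r j \<and> r j \<le> q j + 1) \<and>
      (\<forall>j<n. q j \<le> s j \<and> s j \<le> q j + 1) \<and> (l \<circ> pt) r i \<noteq> (l \<circ> pt) s i"
  proof (rule kuhn_lemma[of p n "l \<circ> pt"])
    show "\<forall>x. (\<forall>i<n. x i \<le> p) \<longrightarrow> (\<forall>i<n. x i = p \<longrightarrow> (l \<circ> pt) x i = 1)"
      using ptQ p by (intro allI impI) (simp add: l(2) pt_def)
    show "\<forall>x. (\<forall>i<n. x i \<le> p) \<longrightarrow> (\<forall>i<n. x i = 0 \<longrightarrow> (l \<circ> pt) x i = 0)"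
      using ptQ by (intro allI impI) (simp add: l(1) pt_def)
    show "\<forall>x. (\<forall>i<n. x i \<le> p) \<longrightarrow> (\<forall>i<n. (l \<circ> pt) x i = 0 \<or> (l \<circ> pt) x i = 1)"
      using l01 by simp
    show "0 < p" by (rule p)
  qed
  have near: "pt x \<in> Q \<and> (\<forall>j<n. \<bar>pt x j - pt q j\<bar> \<le> 1 / real p)"
    if "\<forall>j<n. q j \<le> x j \<and> x j \<le> q j + 1" for x
  proof -
    have "x i \<le> p" if "i < n" for i
      using that q \<open>\<forall>j<n. q j \<le> x j \<and> x j \<le> q j + 1\<close> by (metis Suc_eq_plus1 Suc_leI order_trans)
    moreover have "\<bar>pt x j - pt q j\<bar> \<le> 1 / real p" if "j < n" for j
    proof -
      have "q j \<le> x j" "x j \<le> q j + 1"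
        using that \<open>\<forall>j<n. q j \<le> x j \<and> x j \<le> q j + 1\<close> by auto
      then have "\<bar>real (x j) - real (q j)\<bar> \<le> 1" by linarith
      moreover have "pt x j - pt q j = (real (x j) - real (q j)) / real p"
        by (simp add: pt_def diff_divide_distrib)
      ultimately show ?thesis by (simp add: abs_divide divide_right_mono)
    qed
    ultimately show ?thesis by (auto intro: ptQ)
  qed
  show ?thesis
  proof (intro bexI[of _ "pt q"] allI impI)
    show zQ: "pt q \<in> Q" using q by (auto intro!: ptQ simp: less_imp_le)
    fix i assume i: "i < n"
    obtain r s where r: "\<forall>j<n. q j \<le> r j \<and> r j \<le> q j + 1" and s: "\<forall>j<n. q j \<le> s j \<and> s j \<le> q j + 1"
      and ne: "l (pt r) i \<noteq> l (pt s) i"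
      using rs i by auto
    note r' = near[OF r] and s' = near[OF s]
    have F: "\<bar>F (pt r) i - F (pt q) i\<bar> \<le> K * (1 / real p)" "\<bar>F (pt s) i - F (pt q) i\<bar> \<le> K * (1 / real p)"
      using r' s' zQ i by (intro K(2); blast)+
    have d: "\<bar>pt r i - pt q i\<bar> \<le> 1 / real p" "\<bar>pt s i - pt q i\<bar> \<le> 1 / real p"
      using r' s' i by auto
    \<comment> \<open>Different labels mean that \<open>F\<close> does not decrease coordinate i at
      one of the two vertices and does not increase it at the other; at the nearby corner
      \<open>q\<close> it is therefore almost fixed.\<close>
    have "(pt r i \<le> F (pt r) i \<and> F (pt s) i \<le> pt s i) \<or> (F (pt r) i \<le> pt r i \<and> pt s i \<le> F (pt s) i)"
      using ne l01[of "pt r" i] l01[of "pt s" i] l(3,4)[of "pt r" i] l(3,4)[of "pt s" i] r' s' i by auto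
    then have "\<bar>F (pt q) i - pt q i\<bar> \<le> 3 * (K * (1 / real p)) + 3 * (1 / real p)"
      using F d by linarith
    also have "\<dots> \<le> e" using p by (simp add: field_simps)
    finally show "\<bar>F (pt q) i - pt q i\<bar> \<le> e" .
  qed
qed

text \<open>This is Tychonoff's theorem. Padding with zeros puts a box of any finite dimension into
  this one cube, whose topology is metrizable, so that convergent subsequences can be
  extracted.\<close>

lemma compact_unit_cube_nat: "compact {x :: nat \<Rightarrow> real. \<forall>i. 0 \<le> x i \<and> x i \<le> 1}"
proof -
  have "compactin (product_topology (\<lambda>_::nat. euclidean :: real topology) UNIV) (PiE UNIV (\<lambda>_. {0..1}))"
    by (simp add: compactin_PiE)
  moreover have "(PiE UNIV (\<lambda>_. {0..1})) = {x :: nat \<Rightarrow> real. \<forall>i. 0 \<le> x i \<and> x i \<le> 1}"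
    by (auto simp: PiE_def)
  ultimately show ?thesis by (simp add: euclidean_product_topology)
qed

text \<open>A subsequence of approximate fixed points with errors tending to 0 converges, and the
  Lipschitz bound carries the approximate equation to the limit.\<close>

lemma brouwer_unit_box:
  fixes F :: "(nat \<Rightarrow> real) \<Rightarrow> nat \<Rightarrow> real" and n :: nat
  assumes Q: "Q = {x. \<forall>i<n. 0 \<le> x i \<and> x i \<le> 1}"
    and maps: "\<And>x i. x \<in> Q \<Longrightarrow> i < n \<Longrightarrow> 0 \<le> F x i \<and> F x i \<le> 1"
    and K: "0 \<le> K" "\<And>x y i d. x \<in> Q \<Longrightarrow> y \<in> Q \<Longrightarrow> i < n \<Longrightarrow> (\<And>j. j < n \<Longrightarrow> \<bar>x j - y j\<bar> \<le> d) \<Longrightarrow>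
          \<bar>F x i - F y i\<bar> \<le> K * d"
  obtains z where "z \<in> Q" "\<And>i. i < n \<Longrightarrow> F z i = z i"
proof -
  have "\<exists>z\<in>Q. \<forall>i<n. \<bar>F z i - z i\<bar> \<le> 1 / real (Suc k)" for k
    by (rule brouwer_approx_unit_box[OF Q maps K]) auto
  then have "\<exists>z. \<forall>k. z k \<in> Q \<and> (\<forall>i<n. \<bar>F (z k) i - z k i\<bar> \<le> 1 / real (Suc k))"
    by (intro choice) blast
  then obtain z where z: "z k \<in> Q" "\<And>i. i < n \<Longrightarrow> \<bar>F (z k) i - z k i\<bar> \<le> 1 / real (Suc k)" for k
    by blast
  \<comment> \<open>Membership in \<open>Q\<close> says nothing about coordinates from n on; they
    are reset to 0 before compactness is used.\<close>
  define y where "y = (\<lambda>k i. if i < n then z k i else 0)"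
  define U where "U = {x :: nat \<Rightarrow> real. \<forall>i. 0 \<le> x i \<and> x i \<le> 1}"
  have "y k \<in> U" for k using z(1)[of k] by (auto simp: y_def U_def Q)
  moreover have "seq_compact U"
    using compact_unit_cube_nat[folded U_def] by (simp add: compact_eq_seq_compact_metric)
  ultimately obtain x r where x: "x \<in> U" and r: "strict_mono (r :: nat \<Rightarrow> nat)" and lim: "(y \<circ> r) \<longlonglongrightarrow> x"
    unfolding seq_compact_def by meson
  have xQ: "x \<in> Q" using x by (auto simp: U_def Q)
  have lim_i: "(\<lambda>k. z (r k) i) \<longlonglongrightarrow> x i" if "i < n" for i
  proof -
    have "(\<lambda>k. (y \<circ> r) k i) \<longlonglongrightarrow> x i" using continuous_on_tendsto_compose[OF continuous_on_product_coordinates[of i] lim] by simp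
    then show ?thesis using that by (simp add: y_def)
  qed
  define D where "D = (\<lambda>k. \<Sum>i<n. \<bar>z (r k) i - x i\<bar>)"
  have D: "D \<longlonglongrightarrow> 0"
    unfolding D_def by (intro tendsto_null_sum tendsto_rabs_zero) (auto intro: lim_i LIM_zero)
  have DI: "\<bar>z (r k) j - x j\<bar> \<le> D k" if "j < n" for j k
    unfolding D_def using that by (intro member_le_sum) auto
  show ?thesis
  proof (rule that[OF xQ])
    fix i assume i: "i < n"
    have "\<bar>F x i - x i\<bar> \<le> K * D k + D k + 1 / real (Suc k)" for k
    proof -
      have "\<bar>F (z (r k)) i - F x i\<bar> \<le> K * D k" using z xQ i DI by (intro K(2)) auto
      moreover have "\<bar>F (z (r k)) i - z (r k) i\<bar> \<le> 1 / real (Suc (r k))" using z i by auto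
      moreover have "1 / real (Suc (r k)) \<le> 1 / real (Suc k)"
        using seq_suble[OF r, of k] by (intro divide_left_mono) auto
      ultimately show ?thesis using DI[OF i, of k] by linarith
    qed
    moreover have "(\<lambda>k. K * D k + D k + 1 / real (Suc k)) \<longlonglongrightarrow> K * 0 + 0 + 0"
      by (intro tendsto_intros D LIMSEQ_Suc[OF lim_1_over_n])
    ultimately have "\<bar>F x i - x i\<bar> \<le> 0"
      by (intro LIMSEQ_le_const[where a = "\<bar>F x i - x i\<bar>"]) auto
    then show "F x i = x i" by simp
  qed
qed

subsection \<open>Initial value problems with Lipschitz right-hand side\<close>

text \<open>Derivatives relative to S suffice. This matters because solutions on {0..T} have only
  one-sided derivatives at the end points.\<close>

lemma mean_value_within:
  fixes f :: "real \<Rightarrow> real"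
  assumes "a \<le> b" "{a..b} \<subseteq> S" "\<And>x. x \<in> {a..b} \<Longrightarrow> (f has_real_derivative f' x) (at x within S)"
  obtains x where "x \<in> {a..b}" "f b - f a = f' x * (b - a)"
proof -
  have "\<exists>x\<in>{a..b}. f b - f a = f' x * (b - a)"
    using assms by (intro mvt_very_simple[of a b f "\<lambda>x. (*) (f' x)"])
      (auto simp: has_field_derivative_def intro: has_derivative_subset)
  then show ?thesis using that by blast
qed

lemma has_integral_exp_linear:
  fixes K t :: real assumes "K \<noteq> 0" "0 \<le> t"
  shows "((\<lambda>s. exp (K * s)) has_integral (exp (K * t) - 1) / K) {0..t}"
proof -
  have "((\<lambda>s. exp (K * s)) has_integral exp (K * t) / K - exp (K * 0) / K) {0..t}"
    using assms by (intro fundamental_theorem_of_calculus)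
      (auto intro!: derivative_eq_intros simp: has_real_derivative_iff_has_vector_derivative[symmetric])
  then show ?thesis by (simp add: diff_divide_distrib)
qed

lemma continuous_on_compose_pair:
  assumes "continuous_on (S \<times> UNIV) (\<lambda>(t, x). F t x)" "continuous_on S g"
  shows "continuous_on S (\<lambda>t. F t (g t))"
proof -
  have "continuous_on S ((\<lambda>(t, x). F t x) \<circ> (\<lambda>t. (t, g t)))"
    using assms by (intro continuous_on_compose continuous_intros)
      (auto intro: continuous_on_subset)
  then show ?thesis by (simp add: o_def)
qed

text \<open>The weight \<open>exp (- K t)\<close> (Bielecki's norm) makes the Picard operator a contraction on the
  whole interval at once.\<close>

lemma lipschitz_ivp_exists:
  fixes F :: "real \<Rightarrow> 'a::euclidean_space \<Rightarrow> 'a"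
  assumes T: "0 \<le> T" and cont: "continuous_on ({0..T} \<times> UNIV) (\<lambda>(t, x). F t x)"
    and L: "0 \<le> \<Lambda>" "\<And>t x y. t \<in> {0..T} \<Longrightarrow> norm (F t x - F t y) \<le> \<Lambda> * norm (x - y)"
  shows "\<exists>X. X 0 = x0 \<and> (\<forall>t\<in>{0..T}. (X has_vector_derivative F t (X t)) (at t within {0..T}))"
proof -
  \<comment> \<open>The summand 1 makes the contraction factor \<Lambda> / K smaller than 1, and K
    positive even if \<Lambda> = 0.\<close>
  define K where "K = \<Lambda> + 1"
  have K: "K > 0" using L by (simp add: K_def)
  \<comment> \<open>Picard iteration written for y t = exp (- K t) X t: the plain supremum distance
    of the functions y is then the weighted distance of the functions X.\<close>
  define op where "op = (\<lambda>y t. exp (- K * t) *\<^sub>R (x0 + integral {0..t} (\<lambda>s. F s (exp (K * s) *\<^sub>R y s))))"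
  have cF: "continuous_on {0..T} (\<lambda>s. F s (exp (K * s) *\<^sub>R y s))" if "continuous_on {0..T} y" for y
    using that by (intro continuous_on_compose_pair[OF cont] continuous_intros)
  have op_cont: "continuous_on (cbox 0 T) (op y)" if "continuous_on {0..T} y" for y
    unfolding op_def box_real using integrable_continuous_real[OF cF[OF that]]
    by (intro continuous_intros indefinite_integral_continuous_1)
  \<comment> \<open>Extending constantly beyond {0..T} by \<open>clamp\<close> gives bounded
    continuous functions on the whole line. These form a complete type, to which Banach's theorem
    applies.\<close>
  have "\<exists>z. \<forall>t. apply_bcontfun z t = op (apply_bcontfun y) (clamp 0 T t)" for y :: "real \<Rightarrow>\<^sub>C 'a"
    using continuous_on_cbox_bcontfunE[OF op_cont[OF continuous_on_apply_bcontfun[of _ y]]] by metis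
  then obtain \<Phi> where \<Phi>: "apply_bcontfun (\<Phi> y) t = op (apply_bcontfun y) (clamp 0 T t)"
    for y :: "real \<Rightarrow>\<^sub>C 'a" and t by metis
  have "dist (\<Phi> y) (\<Phi> z) \<le> \<Lambda> / K * dist y z" for y z :: "real \<Rightarrow>\<^sub>C 'a"
  proof (rule dist_bound)
    fix t0 :: real
    define t where "t = clamp 0 T t0"
    have t: "t \<in> {0..T}" using clamp_in_interval[of 0 T t0] T by (simp add: t_def)
    let ?f = "\<lambda>y s. F s (exp (K * s) *\<^sub>R apply_bcontfun y s)"
    have int: "?f y integrable_on {0..t}" for y
      by (rule integrable_continuous_real, rule continuous_on_subset[OF cF]) (use t in auto)
    have "norm (integral {0..t} (?f y) - integral {0..t} (?f z))
        = norm (integral {0..t} (\<lambda>s. ?f y s - ?f z s))"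
      using int by (simp add: Henstock_Kurzweil_Integration.integral_diff)
    also have "\<dots> \<le> integral {0..t} (\<lambda>s. \<Lambda> * dist y z * exp (K * s))"
    proof (rule integral_norm_bound_integral)
      show "(\<lambda>s. ?f y s - ?f z s) integrable_on {0..t}" using int by (intro integrable_diff)
      show "(\<lambda>s. \<Lambda> * dist y z * exp (K * s)) integrable_on {0..t}"
        by (intro integrable_continuous_real continuous_intros)
      fix s assume s: "s \<in> {0..t}"
      have "norm (?f y s - ?f z s) \<le> \<Lambda> * norm (exp (K * s) *\<^sub>R y s - exp (K * s) *\<^sub>R z s)"
        using s t by (intro L) auto
      also have "exp (K * s) *\<^sub>R y s - exp (K * s) *\<^sub>R z s = exp (K * s) *\<^sub>R (y s - z s)"
        by (simp add: scaleR_diff_right)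
      also have "norm (exp (K * s) *\<^sub>R (y s - z s)) = exp (K * s) * dist (y s) (z s)"
        by (simp add: dist_norm)
      also have "\<Lambda> * (exp (K * s) * dist (y s) (z s)) \<le> \<Lambda> * (exp (K * s) * dist y z)"
        using L by (intro mult_left_mono dist_bounded) auto
      finally show "norm (?f y s - ?f z s) \<le> \<Lambda> * dist y z * exp (K * s)" by (simp add: ac_simps)
    qed
    also have "\<dots> = \<Lambda> * dist y z * ((exp (K * t) - 1) / K)"
      using has_integral_exp_linear[of K t] K t
      by (intro integral_unique has_integral_mult_right) auto
    also have "\<dots> \<le> \<Lambda> * dist y z * (exp (K * t) / K)"
      using K L by (intro mult_left_mono divide_right_mono) auto
    finally have *: "norm (integral {0..t} (?f y) - integral {0..t} (?f z)) \<le> \<Lambda> * dist y z * (exp (K * t) / K)" .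
    have "dist (\<Phi> y t0) (\<Phi> z t0) = exp (- K * t) * norm (integral {0..t} (?f y) - integral {0..t} (?f z))"
      by (simp add: \<Phi> op_def t_def[symmetric] dist_norm flip: scaleR_diff_right)
    also have "\<dots> \<le> exp (- K * t) * (\<Lambda> * dist y z * (exp (K * t) / K))"
      by (rule mult_left_mono[OF *]) simp
    also have "\<dots> = \<Lambda> / K * dist y z" by (simp add: exp_minus field_simps)
    finally show "dist (\<Phi> y t0) (\<Phi> z t0) \<le> \<Lambda> / K * dist y z" .
  qed
  then have "\<exists>!y. \<Phi> y = y"
    using L K by (intro banach_fix_type[of "\<Lambda> / K"]) (auto simp: K_def)
  then obtain y where y: "\<Phi> y = y" by auto
  define X where "X = (\<lambda>t. exp (K * t) *\<^sub>R y t)"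
  have yt: "y t = op y t" if "t \<in> {0..T}" for t
    using \<Phi>[of y t] that by (simp add: y)
  have X: "X t = x0 + integral {0..t} (\<lambda>s. F s (X s))" if "t \<in> {0..T}" for t
  proof -
    have "X t = exp (K * t) *\<^sub>R op y t" using yt[OF that] by (simp add: X_def)
    also have "\<dots> = x0 + integral {0..t} (\<lambda>s. F s (X s))"
      by (simp add: op_def X_def exp_minus)
    finally show ?thesis .
  qed
  have cX: "continuous_on {0..T} (\<lambda>s. F s (X s))"
    unfolding X_def by (rule cF) simp
  have "X 0 = x0" using X[of 0] T by simp
  moreover have "(X has_vector_derivative F t (X t)) (at t within {0..T})" if t: "t \<in> {0..T}" for t
  proof -
    have "((\<lambda>t. x0 + integral {0..t} (\<lambda>s. F s (X s))) has_vector_derivative F t (X t)) (at t within {0..T})"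
      using integral_has_vector_derivative[OF cX t] by (auto intro!: derivative_eq_intros)
    then show ?thesis
      by (rule has_vector_derivative_transform[OF t, rotated]) (simp add: X)
  qed
  ultimately show ?thesis by blast
qed

text \<open>Gronwall's inequality: exp (- 2 \<Lambda> s) times the squared norm of the difference is
  nonincreasing. Squaring avoids differentiating the norm at 0.\<close>

lemma lipschitz_ivp_dependence:
  fixes F :: "real \<Rightarrow> 'a::euclidean_space \<Rightarrow> 'a"
  assumes L: "0 \<le> \<Lambda>" "\<And>t x y. t \<in> {0..T} \<Longrightarrow> norm (F t x - F t y) \<le> \<Lambda> * norm (x - y)"
    and X: "\<And>t. t \<in> {0..T} \<Longrightarrow> (X has_vector_derivative F t (X t)) (at t within {0..T})"
    and Y: "\<And>t. t \<in> {0..T} \<Longrightarrow> (Y has_vector_derivative F t (Y t)) (at t within {0..T})"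
    and t: "t \<in> {0..T}"
  shows "norm (X t - Y t) \<le> exp (\<Lambda> * t) * norm (X 0 - Y 0)"
proof -
  define D where "D = (\<lambda>s. X s - Y s)"
  define \<phi> where "\<phi> = (\<lambda>s. exp (- 2 * \<Lambda> * s) * (D s \<bullet> D s))"
  define \<phi>' where "\<phi>' = (\<lambda>s. exp (- 2 * \<Lambda> * s) * (2 * (D s \<bullet> (F s (X s) - F s (Y s)))) - 2 * \<Lambda> * exp (- 2 * \<Lambda> * s) * (D s \<bullet> D s))"
  have D: "(D has_vector_derivative (F s (X s) - F s (Y s))) (at s within {0..t})" if "s \<in> {0..t}" for s
    unfolding D_def using that t
    by (intro derivative_intros has_vector_derivative_within_subset[OF X] has_vector_derivative_within_subset[OF Y]) auto
  have der: "(\<phi> has_real_derivative \<phi>' s) (at s within {0..t})" if s: "s \<in> {0..t}" for s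
  proof -
    have "((\<lambda>s. D s \<bullet> D s) has_derivative (\<lambda>h. D s \<bullet> (h *\<^sub>R (F s (X s) - F s (Y s))) + (h *\<^sub>R (F s (X s) - F s (Y s))) \<bullet> D s)) (at s within {0..t})"
      using D[OF s] unfolding has_vector_derivative_def by (intro has_derivative_inner)
    then have "((\<lambda>s. D s \<bullet> D s) has_real_derivative 2 * (D s \<bullet> (F s (X s) - F s (Y s)))) (at s within {0..t})"
      unfolding has_field_derivative_def by (rule has_derivative_eq_rhs) (auto simp: inner_commute algebra_simps)
    then show ?thesis unfolding \<phi>_def \<phi>'_def
      by (auto intro!: derivative_eq_intros simp: algebra_simps)
  qed
  have le0: "\<phi>' s \<le> 0" if s: "s \<in> {0..t}" for s
  proof -
    have "D s \<bullet> (F s (X s) - F s (Y s)) \<le> norm (D s) * norm (F s (X s) - F s (Y s))"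
      by (rule norm_cauchy_schwarz)
    also have "\<dots> \<le> norm (D s) * (\<Lambda> * norm (D s))"
      using s t unfolding D_def by (intro mult_left_mono L) auto
    also have "\<dots> = \<Lambda> * (D s \<bullet> D s)" by (simp add: power2_norm_eq_inner[symmetric] power2_eq_square)
    finally have "exp (- 2 * \<Lambda> * s) * (2 * (D s \<bullet> (F s (X s) - F s (Y s)))) \<le> exp (- 2 * \<Lambda> * s) * (2 * (\<Lambda> * (D s \<bullet> D s)))"
      by (intro mult_left_mono) auto
    then show ?thesis by (simp add: \<phi>'_def algebra_simps)
  qed
  have "\<phi> t \<le> \<phi> 0"
  proof -
    obtain s where "s \<in> {0..t}" "\<phi> t - \<phi> 0 = \<phi>' s * (t - 0)"
      using t der by (auto intro: mean_value_within[of 0 t "{0..t}" \<phi> \<phi>'])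
    then show ?thesis using le0[of s] t by (smt (verit) atLeastAtMost_iff mult_nonpos_nonneg)
  qed
  then have "exp (- 2 * \<Lambda> * t) * (norm (D t))\<^sup>2 \<le> (norm (D 0))\<^sup>2"
    by (simp add: \<phi>_def power2_norm_eq_inner)
  then have "(norm (D t))\<^sup>2 \<le> (exp (\<Lambda> * t) * norm (D 0))\<^sup>2"
    by (simp add: exp_minus field_simps power2_eq_square exp_double exp_add[symmetric] flip: mult_2)
  then show ?thesis by (auto dest: power2_le_imp_le simp: D_def)
qed

subsection \<open>Smooth functions and weak derivatives on an interval\<close>

text \<open>Since \<open>smooth\<close> speaks of iterated derivatives, it is enough to exhibit a
  family of functions that is closed under differentiation; no formula for the n-th derivative is
  needed.\<close>

lemma smooth_coinduct:
  assumes f: "f \<in> S" and S: "\<And>g. g \<in> S \<Longrightarrow> \<exists>g'\<in>S. \<forall>x. (g has_real_derivative g' x) (at x)"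
  shows "smooth f"
proof -
  have S': "deriv g \<in> S \<and> (\<forall>x. g differentiable (at x))" if "g \<in> S" for g
  proof -
    obtain g' where g': "g' \<in> S" "\<And>x. (g has_real_derivative g' x) (at x)" using S[OF \<open>g \<in> S\<close>] by blast
    then have "deriv g = g'" using DERIV_imp_deriv by blast
    then show ?thesis using g' real_differentiable_def by blast
  qed
  have "(deriv ^^ n) f \<in> S" for n using f S' by (induction n) auto
  then show ?thesis using S' by (auto simp: smooth_def)
qed

lemma smooth_imp_differentiable: "smooth f \<Longrightarrow> f differentiable (at x)"
  unfolding smooth_def by (metis funpow_0)

lemma smooth_deriv: "smooth f \<Longrightarrow> smooth (deriv f)"
  unfolding smooth_def by (metis funpow_swap1 funpow.simps(2) o_apply)

lemma smooth_imp_DERIV: "smooth f \<Longrightarrow> (f has_real_derivative deriv f x) (at x)"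
  using smooth_imp_differentiable DERIV_deriv_iff_real_differentiable by blast

lemma smooth_imp_continuous_on: "smooth f \<Longrightarrow> continuous_on A f"
  by (meson DERIV_isCont continuous_at_imp_continuous_on smooth_imp_DERIV)

lemma smooth_antideriv:
  assumes "\<And>x. (f has_real_derivative f' x) (at x)" "smooth f'"
  shows "smooth f"
proof (rule smooth_coinduct[of f "insert f {g. smooth g}"])
  show "\<exists>g'\<in>insert f {g. smooth g}. \<forall>x. (g has_real_derivative g' x) (at x)"
    if "g \<in> insert f {g. smooth g}" for g
  proof (cases "g = f")
    case False
    then show ?thesis using that by (intro bexI[of _ "deriv g"]) (auto simp: smooth_deriv smooth_imp_DERIV)
  qed (use assms in blast)
qed simp

lemma smooth_const: "smooth (\<lambda>_. c)"
  by (rule smooth_coinduct[of _ "range (\<lambda>c _. c)"]) (auto intro: exI[of _ 0])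

text \<open>Leibniz' rule leaves the set of products but not the set of finite sums of products,
  which makes the latter a family suitable for \<open>smooth_coinduct\<close>.\<close>

inductive_set product_sums :: "(real \<Rightarrow> real) set" where
  "smooth f \<Longrightarrow> smooth g \<Longrightarrow> (\<lambda>x. f x * g x) \<in> product_sums"
| "f \<in> product_sums \<Longrightarrow> g \<in> product_sums \<Longrightarrow> (\<lambda>x. f x + g x) \<in> product_sums"

lemma product_sums_deriv:
  "h \<in> product_sums \<Longrightarrow> \<exists>h'\<in>product_sums. \<forall>x. (h has_real_derivative h' x) (at x)"
proof (induction rule: product_sums.induct)
  case (1 f g)
  have "((\<lambda>x. f x * g x) has_real_derivative f x * deriv g x + deriv f x * g x) (at x)" for x
    using DERIV_mult'[OF smooth_imp_DERIV smooth_imp_DERIV] 1 by blast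
  moreover have "(\<lambda>x. f x * deriv g x + deriv f x * g x) \<in> product_sums"
    using 1 smooth_deriv by (intro product_sums.intros)
  ultimately show ?case by (intro bexI[of _ "\<lambda>x. f x * deriv g x + deriv f x * g x"]) auto
next
  case (2 f g)
  then obtain f' g' where "f' \<in> product_sums" "g' \<in> product_sums"
    "\<And>x. (f has_real_derivative f' x) (at x)" "\<And>x. (g has_real_derivative g' x) (at x)"
    by blast
  then show ?case
    by (intro bexI[of _ "\<lambda>x. f' x + g' x"] allI DERIV_add product_sums.intros(2))
qed

lemma smooth_mult: "smooth f \<Longrightarrow> smooth g \<Longrightarrow> smooth (\<lambda>x. f x * g x)"
  using smooth_coinduct product_sums_deriv product_sums.intros(1) by blast

lemma smooth_diff:
  assumes "smooth f" "smooth g" shows "smooth (\<lambda>x. f x - g x)"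
proof -
  have "(\<lambda>x. f x * 1 + g x * - 1) \<in> product_sums" using assms smooth_const by (intro product_sums.intros)
  from smooth_coinduct[OF this product_sums_deriv] show ?thesis by simp
qed

text \<open>The family carries a constant factor k because each differentiation produces another
  factor \<open>a\<close>.\<close>

lemma smooth_affine:
  assumes "smooth f" shows "smooth (\<lambda>x. f (a * x + c))"
proof (rule smooth_coinduct[of _ "{\<lambda>x. k * f (a * x + c) | k f. smooth f}"])
  fix h assume "h \<in> {\<lambda>x. k * f (a * x + c) | k f. smooth f}"
  then obtain k f where h: "h = (\<lambda>x. k * f (a * x + c))" "smooth f" by blast
  have "(h has_real_derivative (k * a) * deriv f (a * x + c)) (at x)" for x
  proof -
    have "((\<lambda>x. f (a * x + c)) has_real_derivative deriv f (a * x + c) * a) (at x)"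
      by (rule DERIV_chain'[where f = "\<lambda>x. a * x + c"])
        (auto intro!: derivative_eq_intros smooth_imp_DERIV h)
    from DERIV_cmult[OF this, of k] show ?thesis by (simp add: h ac_simps)
  qed
  then show "\<exists>h'\<in>{\<lambda>x. k * f (a * x + c) | k f. smooth f}. \<forall>x. (h has_real_derivative h' x) (at x)"
    by (intro bexI[of _ "\<lambda>x. (k * a) * deriv f (a * x + c)"]) (use smooth_deriv[OF h(2)] in blast)+
next
  show "(\<lambda>x. f (a * x + c)) \<in> {\<lambda>x. k * f (a * x + c) | k f. smooth f}"
    using assms by (auto intro!: exI[of _ 1] exI[of _ f])
qed

section \<open>Flat functions and bump functions\<close>

text \<open>The classical function exp (- 1 / x), flat at 0, with a polynomial in 1 / x as a factor;
  these factors close the family under differentiation.\<close>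

definition flat_poly :: "real poly \<Rightarrow> real \<Rightarrow> real" where
  "flat_poly p x = (if x > 0 then poly p (1 / x) * exp (- (1 / x)) else 0)"

lemma tendsto_poly_times_exp_minus: "((\<lambda>y::real. poly p y * exp (- y)) \<longlongrightarrow> 0) at_top"
proof -
  have "((\<lambda>y::real. \<Sum>i\<le>degree p. coeff p i * (y ^ i / exp y)) \<longlongrightarrow> 0) at_top"
    by (intro tendsto_null_sum tendsto_mult_right_zero tendsto_power_div_exp_0)
  moreover have "(\<lambda>y::real. \<Sum>i\<le>degree p. coeff p i * (y ^ i / exp y)) = (\<lambda>y. poly p y * exp (- y))"
    by (simp add: poly_altdef exp_minus divide_inverse sum_distrib_right mult.assoc)
  ultimately show ?thesis by simp
qed

text \<open>With y = 1 / x and dy/dx = - y^2, the derivative of p(y) exp (- y) is y^2 (p(y) - p'(y))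
  exp (- y). At 0 the right difference quotient is y p(y) exp (- y), which tends to 0 as y tends to
  infinity.\<close>

lemma flat_poly_DERIV:
  "(flat_poly p has_real_derivative flat_poly ([:0, 0, 1:] * (p - pderiv p)) x) (at x)"
proof -
  consider "x > 0" | "x < 0" | "x = 0" by linarith
  then show ?thesis
  proof cases
    case 1
    have "((\<lambda>x. poly p (1 / x) * exp (- (1 / x))) has_real_derivative
        poly (pderiv p) (1 / x) * (- (1 / x\<^sup>2)) * exp (- (1 / x)) + poly p (1 / x) * (exp (- (1 / x)) * (1 / x\<^sup>2))) (at x)"
      using 1 by (auto intro!: derivative_eq_intros DERIV_chain'[OF _ poly_DERIV] simp: power2_eq_square)
    also have "poly (pderiv p) (1 / x) * (- (1 / x\<^sup>2)) * exp (- (1 / x)) + poly p (1 / x) * (exp (- (1 / x)) * (1 / x\<^sup>2))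
        = flat_poly ([:0, 0, 1:] * (p - pderiv p)) x"
      using 1 by (simp add: flat_poly_def power2_eq_square field_simps)
    finally show ?thesis
      by (rule has_field_derivative_transform_within_open[where S = "{0<..}"])
        (use 1 in \<open>auto simp: flat_poly_def\<close>)
  next
    case 2
    have "((\<lambda>_. 0) has_real_derivative 0) (at x)" by simp
    then have "(flat_poly p has_real_derivative 0) (at x)"
      by (rule has_field_derivative_transform_within_open[where S = "{..<0}"])
        (use 2 in \<open>auto simp: flat_poly_def\<close>)
    then show ?thesis using 2 by (simp add: flat_poly_def)
  next
    case 3
    have "((\<lambda>h. poly ([:0, 1:] * p) (inverse h) * exp (- inverse h)) \<longlongrightarrow> 0) (at_right 0)"
      by (rule filterlim_compose[OF tendsto_poly_times_exp_minus filterlim_inverse_at_top_right])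
    moreover have "\<forall>\<^sub>F h in at_right 0. poly ([:0, 1:] * p) (inverse h) * exp (- inverse h) = flat_poly p h / h"
      by (auto simp: eventually_at_right_field flat_poly_def field_simps intro!: exI[of _ 1])
    ultimately have "((\<lambda>h. flat_poly p h / h) \<longlongrightarrow> 0) (at_right 0)"
      by (rule Lim_transform_eventually)
    moreover have "((\<lambda>h. flat_poly p h / h) \<longlongrightarrow> 0) (at_left 0)"
      by (rule Lim_transform_eventually[OF tendsto_const[of 0]])
        (auto simp: eventually_at_left_field flat_poly_def intro!: exI[of _ "-1"])
    ultimately have "((\<lambda>h. flat_poly p h / h) \<longlongrightarrow> 0) (at 0)"
      by (rule filterlim_split_at[rotated])
    then show ?thesis using 3 by (simp add: DERIV_def flat_poly_def)
  qed
qed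

lemma smooth_flat_poly: "smooth (flat_poly p)"
  using flat_poly_DERIV by (intro smooth_coinduct[of _ "range flat_poly"]) blast+

text \<open>The index n stretches the argument of both factors, so the functions tend to 1 inside
  the interval while their supports do not grow. Indicators of intervals are thus approximated by
  test functions from within.\<close>

definition bump :: "real \<Rightarrow> real \<Rightarrow> nat \<Rightarrow> real \<Rightarrow> real" where
  "bump p q n x = flat_poly 1 (real (Suc n) * (x - p)) * flat_poly 1 (real (Suc n) * (q - x))"

lemma smooth_bump: "smooth (bump p q n)"
proof -
  have "smooth (\<lambda>x. flat_poly 1 (real (Suc n) * x + (- real (Suc n) * p)) * flat_poly 1 ((- real (Suc n)) * x + real (Suc n) * q))"
    by (intro smooth_mult smooth_affine smooth_flat_poly)
  moreover have "(\<lambda>x. flat_poly 1 (real (Suc n) * x + (- real (Suc n) * p)) * flat_poly 1 ((- real (Suc n)) * x + real (Suc n) * q)) = bump p q n"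
    by (rule ext) (simp add: bump_def algebra_simps)
  ultimately show ?thesis by simp
qed

lemma bump_outside: "x \<notin> {p<..<q} \<Longrightarrow> bump p q n x = 0"
  by (auto simp: bump_def flat_poly_def zero_less_mult_iff)

lemma bump_pos: "x \<in> {p<..<q} \<Longrightarrow> bump p q n x > 0"
  by (auto simp: bump_def flat_poly_def)

lemma flat_poly_1_bounds: "0 \<le> flat_poly 1 x" "flat_poly 1 x \<le> 1"
  by (auto simp: flat_poly_def)

lemma bump_bounds: "0 \<le> bump p q n x" "bump p q n x \<le> 1"
  using flat_poly_1_bounds by (auto simp: bump_def intro!: mult_le_one)

lemma bump_tendsto: "(\<lambda>n. bump p q n x) \<longlonglongrightarrow> indicator {p<..<q} x"
proof (cases "x \<in> {p<..<q}")
  case True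
  have 1: "(\<lambda>n. flat_poly 1 (real (Suc n) * y)) \<longlonglongrightarrow> 1" if "y > 0" for y
  proof -
    have "(\<lambda>n. exp (- ((1 / y) * (1 / real (Suc n))))) \<longlonglongrightarrow> exp (- ((1 / y) * 0))"
      by (intro tendsto_intros LIMSEQ_Suc[OF lim_1_over_n])
    moreover have "flat_poly 1 (real (Suc n) * y) = exp (- ((1 / y) * (1 / real (Suc n))))" for n
      using that by (simp add: flat_poly_def zero_less_mult_iff)
    ultimately show ?thesis by simp
  qed
  have "(\<lambda>n. bump p q n x) \<longlonglongrightarrow> 1 * 1"
    unfolding bump_def using True by (intro tendsto_mult 1) auto
  then show ?thesis using True by simp
qed (simp add: bump_outside)

lemma test_functionI:
  assumes "smooth \<phi>" "\<And>x. x \<notin> {p..q} \<Longrightarrow> \<phi> x = 0" "{p..q} \<subseteq> S"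
  shows "test_function S \<phi>"
proof -
  have "closure {x. \<phi> x \<noteq> 0} \<subseteq> {p..q}"
    using assms(2) by (intro closure_minimal) fastforce+
  moreover from this have "compact (closure {x. \<phi> x \<noteq> 0})"
    by (metis closed_closure compact_Icc compact_Int_closed inf.absorb_iff2)
  ultimately show ?thesis using assms by (auto simp: test_function_def)
qed

lemma test_function_bump: "{p..q} \<subseteq> S \<Longrightarrow> test_function S (bump p q n)"
  by (intro test_functionI[of _ p q] smooth_bump bump_outside) auto

lemma test_function_support:
  assumes "test_function {0<..<T} \<phi>" "0 < T"
  obtains p q where "0 < p" "p \<le> q" "q < T" "\<And>x. x \<notin> {p..q} \<Longrightarrow> \<phi> x = 0"
proof (cases "closure {x. \<phi> x \<noteq> 0} = {}")
  case True
  then have "\<phi> x = 0" for x by (metis (mono_tags, lifting) closure_subset empty_iff mem_Collect_eq subsetD)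
  then show ?thesis using that[of "T/2" "T/2"] assms by auto
next
  case False
  define K where "K = closure {x. \<phi> x \<noteq> 0}"
  have K: "compact K" "K \<subseteq> {0<..<T}" using assms by (auto simp: test_function_def K_def)
  have out: "\<phi> x = 0" if "x \<notin> K" for x
    using that closure_subset[of "{x. \<phi> x \<noteq> 0}"] unfolding K_def by blast
  have ne: "K \<noteq> {}" using False by (simp add: K_def)
  obtain p where p: "p \<in> K" "\<forall>t\<in>K. p \<le> t" using compact_attains_inf[OF K(1) ne] by blast
  obtain q where q: "q \<in> K" "\<forall>t\<in>K. t \<le> q" using compact_attains_sup[OF K(1) ne] by blast
  show ?thesis
  proof (rule that[of p q])
    show "0 < p" "q < T" using subsetD[OF K(2) p(1)] subsetD[OF K(2) q(1)] by simp_all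
    show "p \<le> q" using p q by blast
    show "\<phi> x = 0" if "x \<notin> {p..q}" for x
      using that p q by (intro out) auto
  qed
qed

section \<open>Null functions and the fundamental lemma of the calculus of variations\<close>

text \<open>Fubini's theorem and induction over a generator of the Borel sets are at home in
  \<open>lborel\<close>, whereas the weak formulation uses its completion \<open>lebesgue\<close>.
  Changing the function on a null set moves between the two without altering any pairing with a
  Borel function.\<close>

lemma set_integrable_borel_representative:
  fixes r :: "real \<Rightarrow> real"
  assumes r: "set_integrable lebesgue S r"
  obtains h where "integrable lborel h" "AE x in lebesgue. indicator S x *\<^sub>R r x = h x"
    "\<And>\<phi>. \<phi> \<in> borel_measurable borel \<Longrightarrow> (LINT x|lborel. h x * \<phi> x) = (LINT x:S|lebesgue. r x * \<phi> x)"
proof -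
  have int: "integrable lebesgue (\<lambda>x. indicator S x *\<^sub>R r x)" using r by (simp add: set_integrable_def)
  obtain h where h: "h \<in> borel_measurable lborel" and gh: "AE x in lborel. indicator S x *\<^sub>R r x = h x"
    using completion_ex_borel_measurable_real[OF borel_measurable_integrable[OF int]] by blast
  have gh': "AE x in lebesgue. indicator S x *\<^sub>R r x = h x" by (rule AE_completion[OF gh])
  have hl: "h \<in> borel_measurable lebesgue" using h by (rule measurable_completion)
  have inth: "integrable lborel h"
    using int integrable_cong_AE[OF borel_measurable_integrable[OF int] hl gh'] integrable_completion[OF h] by simp
  show ?thesis
  proof (rule that[OF inth gh'])
    fix \<phi> :: "real \<Rightarrow> real" assume \<phi>: "\<phi> \<in> borel_measurable borel"
    then have \<phi>l: "\<phi> \<in> borel_measurable lebesgue" by (intro measurable_completion) simp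
    have "(LINT x|lborel. h x * \<phi> x) = (LINT x|lebesgue. h x * \<phi> x)"
      using h \<phi> by (intro integral_completion[symmetric] borel_measurable_times) auto
    also have "\<dots> = (LINT x|lebesgue. (indicator S x *\<^sub>R r x) * \<phi> x)"
    proof (rule integral_cong_AE)
      show "AE x in lebesgue. h x * \<phi> x = (indicator S x *\<^sub>R r x) * \<phi> x"
        using gh' by eventually_elim simp
    qed (intro borel_measurable_times hl \<phi>l borel_measurable_integrable[OF int])+
    finally show "(LINT x|lborel. h x * \<phi> x) = (LINT x:S|lebesgue. r x * \<phi> x)"
      by (simp add: set_lebesgue_integral_def mult.assoc)
  qed
qed

text \<open>The Borel sets over which the integral vanishes form a Dynkin system: the vanishing
  total integral handles complements, countable additivity handles disjoint unions. Open intervals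
  are a generator stable under intersection.\<close>

lemma AE_zero_of_interval_integrals:
  fixes g :: "real \<Rightarrow> real"
  assumes g: "integrable lebesgue g"
    and 0: "\<And>a b. (LINT x:{a<..<b}|lebesgue. g x) = 0" and tot: "(LINT x|lebesgue. g x) = 0"
  shows "AE x in lebesgue. g x = 0"
proof -
  have "set_integrable lebesgue UNIV g" using g by (simp add: set_integrable_def)
  then obtain h where inth: "integrable lborel h" and gh: "AE x in lebesgue. indicator UNIV x *\<^sub>R g x = h x"
    and hg: "\<And>\<phi>. \<phi> \<in> borel_measurable borel \<Longrightarrow> (LINT x|lborel. h x * \<phi> x) = (LINT x:UNIV|lebesgue. g x * \<phi> x)"
    by (rule set_integrable_borel_representative) blast
  have eq: "(LINT x:A|lborel. h x) = (LINT x:A|lebesgue. g x)" if "A \<in> sets borel" for A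
    using hg[OF borel_measurable_indicator[OF that]] by (simp add: set_lebesgue_integral_def mult.commute)
  have bGL: "borel = sigma UNIV (range (\<lambda>(a, b). {a<..<b::real}))"
    using borel_eq_box[where 'a = real] by (simp add: box_real)
  have UNIV0: "(LINT x:UNIV|lborel. h x) = 0"
    using eq[of UNIV] tot by (simp add: set_lebesgue_integral_def)
  have hA: "set_integrable lborel A h" if "A \<in> sets borel" for A
    unfolding set_integrable_def using inth that by (intro integrable_mult_indicator) auto
  have "(LINT x:A|lborel. h x) = 0" if "A \<in> sets lborel" for A
  proof -
    let ?G = "range (\<lambda>(a, b). {a<..<b::real})"
    have "Int_stable ?G"
    proof (rule Int_stableI)
      fix A B assume "A \<in> ?G" "B \<in> ?G"
      then obtain a b c d where "A = {a<..<b}" "B = {c<..<d}" by auto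
      then have "A \<inter> B = {max a c<..<min b d}" by auto
      then show "A \<inter> B \<in> ?G" by auto
    qed
    moreover have "?G \<subseteq> Pow UNIV" by simp
    moreover have "A \<in> sigma_sets UNIV ?G"
      using that unfolding sets_lborel bGL by simp
    ultimately show ?thesis
    proof (induction rule: sigma_sets_induct_disjoint)
      case (basic A)
      then show ?case using eq 0 by auto
    next
      case empty
      then show ?case by (simp add: set_lebesgue_integral_def)
    next
      case (compl A)
      have A: "A \<in> sets borel" using compl(1) unfolding bGL by simp
      have "(LINT x:A \<union> (UNIV - A)|lborel. h x) = (LINT x:A|lborel. h x) + (LINT x:(UNIV - A)|lborel. h x)"
        using A by (intro set_integral_Un hA) auto
      then show ?case using compl UNIV0 by simp
    next
      case (union A)
      have A: "A i \<in> sets borel" for i using union(2) unfolding bGL by auto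
      have "(LINT x:(\<Union>i. A i)|lborel. h x) = (\<Sum>i. (LINT x:A i|lborel. h x))"
        using union A by (intro lebesgue_integral_countable_add hA) (auto simp: disjoint_family_on_def)
      then show ?case using union by simp
    qed
  qed
  then have "AE x in lborel. h x = 0" by (rule sigma_finite_measure.density_zero[OF sigma_finite_lborel inth])
  then have "AE x in lebesgue. h x = 0" by (rule AE_completion)
  with gh show ?thesis by auto
qed

lemma AE_interval_of_subintervals:
  assumes "\<And>p q. 0 < p \<Longrightarrow> q < T \<Longrightarrow> AE x in lebesgue. x \<in> {p<..<q} \<longrightarrow> P x"
  shows "AE x in lebesgue. x \<in> {0<..<T} \<longrightarrow> P (x::real)"
proof -
  have "AE x in lebesgue. \<forall>n. x \<in> {1 / real (Suc n)<..<T - 1 / real (Suc n)} \<longrightarrow> P x"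
    unfolding AE_all_countable using assms by auto
  then show ?thesis
  proof (rule AE_mp, intro AE_I2 impI)
    fix x assume *: "\<forall>n. x \<in> {1 / real (Suc n)<..<T - 1 / real (Suc n)} \<longrightarrow> P x" and x: "x \<in> {0<..<T}"
    have "min x (T - x) > 0" using x by auto
    then obtain n where "1 / real (Suc n) < min x (T - x)"
      using reals_Archimedean[of "min x (T - x)"] by (auto simp: inverse_eq_divide)
    then show "P x" using *[rule_format, of n] by auto
  qed
qed

text \<open>Bumps converge to the indicator of a subinterval and are bounded by 1. Inside a compact
  subinterval, where g is integrable, dominated convergence turns the hypothesis on test functions
  into vanishing interval integrals.\<close>

lemma fundamental_lemma_variations:
  assumes loc: "\<And>K. compact K \<Longrightarrow> K \<subseteq> {0<..<T} \<Longrightarrow> set_integrable lebesgue K g"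
    and test: "\<And>\<phi>. test_function {0<..<T} \<phi> \<Longrightarrow> (LINT x:{0<..<T}|lebesgue. g x * \<phi> x) = 0"
  shows "AE x in lebesgue. x \<in> {0<..<T} \<longrightarrow> g x = 0"
proof (rule AE_interval_of_subintervals)
  fix p q :: real assume pq: "0 < p" "q < T"
  have pqT: "{p..q} \<subseteq> {0<..<T}" using pq by auto
  have int: "integrable lebesgue (\<lambda>x. indicator {p<..<q} x *\<^sub>R g x)"
    using set_integrable_subset[OF loc[OF _ pqT], of "{p<..<q}"] by (force simp: set_integrable_def)
  have I: "(LINT x|lebesgue. indicator {a<..<b} x *\<^sub>R g x) = 0" if ab: "p \<le> a" "b \<le> q" for a b
  proof (rule LIMSEQ_unique)
    let ?s = "\<lambda>n x. indicator {p<..<q} x *\<^sub>R g x * bump a b n x"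
    have [measurable]: "bump a b n \<in> borel_measurable lebesgue" for n
      by (rule measurable_completion)
        (simp add: borel_measurable_continuous_onI smooth_imp_continuous_on smooth_bump)
    note [measurable] = borel_measurable_integrable[OF int]
    show "(\<lambda>n. LINT x|lebesgue. ?s n x) \<longlonglongrightarrow> (LINT x|lebesgue. indicator {a<..<b} x *\<^sub>R g x)"
    proof (rule integral_dominated_convergence)
      show "integrable lebesgue (\<lambda>x. norm (indicator {p<..<q} x *\<^sub>R g x))" using int by (rule integrable_norm)
      have "(\<lambda>x. indicat_real {a<..<b} x *\<^sub>R (indicat_real {p<..<q} x *\<^sub>R g x)) = (\<lambda>x. indicat_real {a<..<b} x *\<^sub>R g x)"
        using ab by (auto simp: indicator_def)
      moreover have "(\<lambda>x. indicat_real {a<..<b} x *\<^sub>R (indicat_real {p<..<q} x *\<^sub>R g x)) \<in> borel_measurable lebesgue"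
        by (rule borel_measurable_scaleR[OF borel_measurable_indicator borel_measurable_integrable[OF int]]) simp
      ultimately show "(\<lambda>x. indicat_real {a<..<b} x *\<^sub>R g x) \<in> borel_measurable lebesgue" by simp
      show "?s n \<in> borel_measurable lebesgue" for n by measurable
      show "AE x in lebesgue. (\<lambda>n. ?s n x) \<longlonglongrightarrow> indicator {a<..<b} x *\<^sub>R g x"
      proof (rule AE_I2)
        fix x
        have "(\<lambda>n. ?s n x) \<longlonglongrightarrow> indicator {p<..<q} x *\<^sub>R g x * indicator {a<..<b} x"
          by (intro tendsto_intros bump_tendsto)
        then show "(\<lambda>n. ?s n x) \<longlonglongrightarrow> indicator {a<..<b} x *\<^sub>R g x"
          using ab by (auto simp: indicator_def split: if_splits)
      qed
      show "AE x in lebesgue. norm (?s n x) \<le> norm (indicator {p<..<q} x *\<^sub>R g x)" for n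
        using bump_bounds[of a b n] by (intro AE_I2) (simp add: abs_mult mult_left_le)
    qed
    have "(LINT x|lebesgue. ?s n x) = (LINT x:{0<..<T}|lebesgue. g x * bump a b n x)" for n
      unfolding set_lebesgue_integral_def
    proof (intro Bochner_Integration.integral_cong refl)
      fix x
      have "x \<notin> {p<..<q} \<Longrightarrow> bump a b n x = 0" using ab by (intro bump_outside) auto
      moreover have "x \<in> {p<..<q} \<Longrightarrow> x \<in> {0<..<T}" using pq by auto
      ultimately show "?s n x = indicat_real {0<..<T} x *\<^sub>R (g x * bump a b n x)"
        by (auto simp: indicator_def)
    qed
    moreover have "test_function {0<..<T} (bump a b n)" for n
      using ab pqT by (intro test_function_bump) auto
    ultimately show "(\<lambda>n. LINT x|lebesgue. ?s n x) \<longlonglongrightarrow> 0" using test by simp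
  qed
  have "AE x in lebesgue. indicator {p<..<q} x *\<^sub>R g x = 0"
  proof (rule AE_zero_of_interval_integrals[OF int])
    have eq: "indicat_real {a<..<b} x *\<^sub>R (indicat_real {p<..<q} x *\<^sub>R g x) = indicator {max a p<..<min b q} x *\<^sub>R g x" for a b x
      by (auto simp: indicator_def)
    show "(LINT x:{a<..<b}|lebesgue. indicator {p<..<q} x *\<^sub>R g x) = 0" for a b
      unfolding set_lebesgue_integral_def eq by (rule I) auto
    show "(LINT x|lebesgue. indicator {p<..<q} x *\<^sub>R g x) = 0" by (rule I) auto
  qed
  then show "AE x in lebesgue. x \<in> {p<..<q} \<longrightarrow> g x = 0"
    by eventually_elim (auto simp: indicator_def)
qed

lemma set_integral_spike:
  fixes f g :: "real \<Rightarrow> real"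
  assumes f: "set_integrable lebesgue S f" and ae: "AE x in lebesgue. x \<in> S \<longrightarrow> g x = f x"
  shows "set_integrable lebesgue S g" "(LINT x:S|lebesgue. g x) = (LINT x:S|lebesgue. f x)"
proof -
  obtain N where N: "negligible N" "{x. \<not> (x \<in> S \<longrightarrow> g x = f x)} \<subseteq> N"
    using ae unfolding eventually_ae_filter_negligible by blast
  then have eq: "g x = f x" if "x \<in> S - N" for x using that by blast
  show g: "set_integrable lebesgue S g"
    by (rule absolutely_integrable_spike[OF f N(1) eq])
  have "integral S g = integral S f" by (rule integral_spike[OF N(1)]) (use eq in auto)
  then show "(LINT x:S|lebesgue. g x) = (LINT x:S|lebesgue. f x)"
    by (simp add: set_lebesgue_integral_eq_integral(2) f g)
qed

lemma set_integrable_mult_continuous: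
  fixes g h :: "real \<Rightarrow> real"
  assumes "set_integrable lebesgue S g" "S \<subseteq> {a..b}" "S \<in> sets lebesgue" "continuous_on {a..b} h"
  shows "set_integrable lebesgue S (\<lambda>x. g x * h x)"
proof -
  have "(\<lambda>x. h x * g x) absolutely_integrable_on S"
  proof (rule absolutely_integrable_bounded_measurable_product_real)
    show "h \<in> borel_measurable (lebesgue_on S)"
      using assms continuous_imp_measurable_on_sets_lebesgue continuous_on_subset by blast
    have "bounded (h ` {a..b})"
      using assms(4) by (intro compact_imp_bounded compact_continuous_image) auto
    then show "bounded (h ` S)" by (rule bounded_subset) (use assms(2) in auto)
  qed (use assms in auto)
  then show ?thesis by (simp add: mult.commute)
qed

lemma continuous_set_integrable_interior:
  fixes f :: "real \<Rightarrow> real"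
  assumes "continuous_on {a..b} f"
  shows "set_integrable lebesgue {a<..<b} f" "(LINT x:{a<..<b}|lebesgue. f x) = integral {a..b} f"
proof -
  show "set_integrable lebesgue {a<..<b} f"
    by (rule set_integrable_subset[OF absolutely_integrable_continuous_real[OF assms]]) auto
  then show "(LINT x:{a<..<b}|lebesgue. f x) = integral {a..b} f"
    by (simp add: set_lebesgue_integral_eq_integral(2) integral_open_interval_real)
qed

lemma integral_cong_AE_continuous:
  fixes f g :: "real \<Rightarrow> real"
  assumes ae: "AE x in lebesgue. x \<in> {0<..<T} \<longrightarrow> f x = g x" and g: "continuous_on {0..T} g" and z: "z \<in> {0..T}"
  shows "integral {0..z} f = integral {0..z} g"
proof -
  have i: "set_integrable lebesgue {0<..<z} g"
    using z by (intro continuous_set_integrable_interior(1) continuous_on_subset[OF g]) auto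
  have "AE x in lebesgue. x \<in> {0<..<z} \<longrightarrow> f x = g x" using ae z by auto
  from set_integral_spike[OF i this] show ?thesis
    unfolding integral_open_interval_real by (simp add: set_lebesgue_integral_eq_integral(2) i)
qed

lemma set_integrable_mult_test:
  assumes loc: "\<And>K. compact K \<Longrightarrow> K \<subseteq> {0<..<T} \<Longrightarrow> set_integrable lebesgue K g"
    and "test_function {0<..<T} \<phi>" "0 < T"
  shows "set_integrable lebesgue {0<..<T} (\<lambda>x. g x * \<phi> x)"
proof -
  obtain p q where pq: "0 < p" "p \<le> q" "q < T" "\<And>x. x \<notin> {p..q} \<Longrightarrow> \<phi> x = 0"
    using test_function_support assms by blast
  have "set_integrable lebesgue {p..q} g" using pq by (intro loc) auto
  then have "set_integrable lebesgue {p..q} (\<lambda>x. g x * \<phi> x)"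
    by (rule set_integrable_mult_continuous[of _ _ p q])
      (use assms in \<open>auto simp: test_function_def intro: smooth_imp_continuous_on\<close>)
  moreover have "indicator {p..q} x *\<^sub>R (g x * \<phi> x) = indicator {0<..<T} x *\<^sub>R (g x * \<phi> x)" for x
  proof (cases "x \<in> {p..q}")
    case True then show ?thesis using pq by simp
  next
    case False then show ?thesis using pq(4) by simp
  qed
  ultimately show ?thesis by (simp only: set_integrable_def)
qed

lemma set_integral_diff_mult:
  fixes f g \<phi> :: "real \<Rightarrow> real"
  assumes "set_integrable M S (\<lambda>x. f x * \<phi> x)" "set_integrable M S (\<lambda>x. g x * \<phi> x)"
  shows "(LINT x:S|M. (f x - g x) * \<phi> x) = (LINT x:S|M. f x * \<phi> x) - (LINT x:S|M. g x * \<phi> x)"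
  using set_integral_diff(2)[OF assms] by (simp add: left_diff_distrib)

section \<open>Primitives and the lemma of du Bois-Reymond\<close>

lemma smooth_primitive:
  assumes "smooth \<psi>" obtains \<phi> where "smooth \<phi>" "deriv \<phi> = \<psi>"
proof -
  have "\<exists>F. \<forall>x. - \<infinity> < ereal x \<longrightarrow> ereal x < \<infinity> \<longrightarrow> (F has_vector_derivative \<psi> x) (at x)"
    using smooth_imp_DERIV[OF assms] DERIV_isCont by (intro einterval_antiderivative) auto
  then obtain F where F: "\<And>x. (F has_real_derivative \<psi> x) (at x)"
    by (auto simp: has_real_derivative_iff_has_vector_derivative)
  show ?thesis
    by (rule that[of F]) (use F assms smooth_antideriv DERIV_imp_deriv in blast)+
qed

text \<open>A test function is the derivative of a test function as soon as its integral vanishes.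
  Any \<psi> is brought into this form by subtracting a multiple of one fixed bump
  \<open>\<chi>0\<close>; what is left is the pairing of f - k with \<psi>.\<close>

lemma du_bois_reymond:
  assumes T: "0 < T"
    and loc: "\<And>K. compact K \<Longrightarrow> K \<subseteq> {0<..<T} \<Longrightarrow> set_integrable lebesgue K f"
    and test: "\<And>\<phi>. test_function {0<..<T} \<phi> \<Longrightarrow> (LINT x:{0<..<T}|lebesgue. f x * deriv \<phi> x) = 0"
  obtains k where "AE x in lebesgue. x \<in> {0<..<T} \<longrightarrow> f x = k"
proof -
  let ?LT = "\<lambda>g. LINT x:{0<..<T}|lebesgue. g x"
  define \<chi>0 where "\<chi>0 = bump (T / 4) (3 * T / 4) 0"
  have t0: "test_function {0<..<T} \<chi>0" unfolding \<chi>0_def using T by (intro test_function_bump) auto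
  have c\<chi>0: "continuous_on A \<chi>0" for A
    unfolding \<chi>0_def by (intro smooth_imp_continuous_on smooth_bump)
  have pos: "integral {0..T} \<chi>0 > 0"
  proof -
    have "integral {0..T} \<chi>0 \<noteq> 0"
    proof
      assume "integral {0..T} \<chi>0 = 0"
      then have "(\<chi>0 has_integral 0) {0..T}"
        using integrable_integral[OF integrable_continuous_real[OF c\<chi>0]] by metis
      then have "\<chi>0 (T / 2) = 0"
        by (intro has_integral_0_cbox_imp_0[of 0 T \<chi>0])
          (use T c\<chi>0 bump_bounds in \<open>auto simp: \<chi>0_def\<close>)
      moreover have "\<chi>0 (T / 2) > 0" unfolding \<chi>0_def using T by (intro bump_pos) auto
      ultimately show False by simp
    qed
    moreover have "integral {0..T} \<chi>0 \<ge> 0"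
      by (intro integral_nonneg integrable_continuous_real c\<chi>0) (auto simp: \<chi>0_def bump_bounds)
    ultimately show ?thesis by simp
  qed
  define c0 where "c0 = integral {0..T} \<chi>0"
  \<comment> \<open>The only possible value: if f is the constant k, then its pairing with
    \<open>\<chi>0\<close> is k times \<open>c0\<close>.\<close>
  define k where "k = ?LT (\<lambda>x. f x * \<chi>0 x) / c0"
  have "AE x in lebesgue. x \<in> {0<..<T} \<longrightarrow> f x - k = 0"
  proof (rule fundamental_lemma_variations)
    show "set_integrable lebesgue K (\<lambda>x. f x - k)" if "compact K" "K \<subseteq> {0<..<T}" for K
      using that loc by (intro set_integral_diff(1)) (auto simp: absolutely_integrable_on_const lmeasurable_compact)
    fix \<psi> assume \<psi>: "test_function {0<..<T} \<psi>"
    have s\<psi>: "smooth \<psi>" using \<psi> by (simp add: test_function_def)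
    define I where "I = integral {0..T} \<psi> / c0"
    define \<eta> where "\<eta> = (\<lambda>x. \<psi> x - I * \<chi>0 x)"
    have s\<eta>: "smooth \<eta>" unfolding \<eta>_def \<chi>0_def by (intro smooth_diff smooth_mult smooth_const s\<psi> smooth_bump)
    have c\<psi>: "continuous_on A \<psi>" for A by (rule smooth_imp_continuous_on[OF s\<psi>])
    have \<eta>0: "(\<eta> has_integral 0) {0..T}"
    proof -
      have "(\<eta> has_integral integral {0..T} \<psi> - I * integral {0..T} \<chi>0) {0..T}" unfolding \<eta>_def
        by (intro has_integral_diff has_integral_mult_right integrable_integral integrable_continuous_real c\<psi> c\<chi>0)
      then show ?thesis using pos by (simp add: I_def c0_def)
    qed
    obtain \<phi>0 where \<phi>0: "smooth \<phi>0" "deriv \<phi>0 = \<eta>" using smooth_primitive[OF s\<eta>] by blast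
    obtain p q where pq: "0 < p" "p \<le> q" "q < T" "\<And>x. x \<notin> {p..q} \<Longrightarrow> \<psi> x = 0"
      using test_function_support \<psi> T by blast
    obtain p' q' where pq': "0 < p'" "p' \<le> q'" "q' < T" "\<And>x. x \<notin> {p'..q'} \<Longrightarrow> \<chi>0 x = 0"
      using test_function_support t0 T by blast
    define P Q where "P = min p p'" and "Q = max q q'"
    have PQ: "0 < P" "P \<le> Q" "Q < T" using pq pq' by (auto simp: P_def Q_def)
    have \<eta>out: "\<eta> x = 0" if "x < P \<or> Q < x" for x
      using pq(4)[of x] pq'(4)[of x] that by (auto simp: \<eta>_def P_def Q_def)
    have D: "(\<phi>0 has_real_derivative \<eta> x) (at x)" for x using smooth_imp_DERIV[OF \<phi>0(1), of x] \<phi>0(2) by simp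
    have const: "\<phi>0 x = \<phi>0 y" if xy: "x \<le> y" and out: "y < P \<or> Q < x" for x y
    proof -
      obtain s where "s \<in> {x..y}" "\<phi>0 y - \<phi>0 x = \<eta> s * (y - x)"
        by (rule mean_value_within[OF xy subset_UNIV D])
      then show ?thesis using \<eta>out[of s] out by auto
    qed
    have low: "\<phi>0 x = \<phi>0 0" if "x < P" for x
      by (metis const linear PQ(1) that)
    have high: "\<phi>0 x = \<phi>0 T" if "Q < x" for x
      by (metis const linear PQ(3) that)
    have "(\<eta> has_integral \<phi>0 T - \<phi>0 0) {0..T}"
      using T by (intro fundamental_theorem_of_calculus)
        (auto intro!: has_field_derivative_at_within D simp: has_real_derivative_iff_has_vector_derivative[symmetric])
    then have T0: "\<phi>0 T = \<phi>0 0" using has_integral_unique[OF \<eta>0] by (metis eq_iff_diff_eq_0)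
    \<comment> \<open>On either side of the support of \<open>\<eta>\<close> the primitive
      \<open>\<phi>0\<close> is constant, and the two constants agree because \<open>\<eta>\<close>
      has integral 0. Subtracting their common value leaves compact support.\<close>
    define \<phi> where "\<phi> = (\<lambda>x. \<phi>0 x - \<phi>0 0)"
    have "test_function {0<..<T} \<phi>"
    proof (rule test_functionI[of _ P Q])
      show "smooth \<phi>" unfolding \<phi>_def by (intro smooth_diff \<phi>0 smooth_const)
      show "\<phi> x = 0" if "x \<notin> {P..Q}" for x
        using that low[of x] high[of x] T0 by (cases "x < P") (auto simp: \<phi>_def)
      show "{P..Q} \<subseteq> {0<..<T}" using PQ by auto
    qed
    moreover have "deriv \<phi> = \<eta>"
    proof
      fix x
      have "(\<phi> has_real_derivative \<eta> x - 0) (at x)" unfolding \<phi>_def by (intro DERIV_diff D) simp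
      then show "deriv \<phi> x = \<eta> x" by (simp add: DERIV_imp_deriv)
    qed
    ultimately have "?LT (\<lambda>x. f x * \<eta> x) = 0" using test by fastforce
    moreover have "?LT (\<lambda>x. f x * \<eta> x) = ?LT (\<lambda>x. f x * \<psi> x) - I * ?LT (\<lambda>x. f x * \<chi>0 x)"
    proof -
      have "?LT (\<lambda>x. f x * \<eta> x) = ?LT (\<lambda>x. f x * \<psi> x - I * (f x * \<chi>0 x))"
        by (simp add: \<eta>_def algebra_simps)
      also have "\<dots> = ?LT (\<lambda>x. f x * \<psi> x) - ?LT (\<lambda>x. I * (f x * \<chi>0 x))"
        by (intro set_integral_diff set_integrable_mult_right set_integrable_mult_test[OF loc] \<psi> t0 T)
      finally show ?thesis by simp
    qed
    moreover have "?LT (\<lambda>x. (f x - k) * \<psi> x) = ?LT (\<lambda>x. f x * \<psi> x) - k * integral {0..T} \<psi>"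
    proof -
      have "?LT (\<lambda>x. (f x - k) * \<psi> x) = ?LT (\<lambda>x. f x * \<psi> x) - ?LT (\<lambda>x. k * \<psi> x)"
        by (intro set_integral_diff_mult set_integrable_mult_test[OF loc] \<psi> T set_integrable_mult_right
            continuous_set_integrable_interior c\<psi>)
      then show ?thesis by (simp add: continuous_set_integrable_interior(2) c\<psi>)
    qed
    moreover have "k * integral {0..T} \<psi> = I * ?LT (\<lambda>x. f x * \<chi>0 x)" by (simp add: k_def I_def)
    ultimately show "?LT (\<lambda>x. (f x - k) * \<psi> x) = 0" by simp
  qed
  then show ?thesis using that[of k] by auto
qed

lemma AE_eq_imp_eq_on_open:
  fixes f g :: "real \<Rightarrow> real"
  assumes S: "open S" "continuous_on S f" "continuous_on S g"
    and ae: "AE x in lebesgue. x \<in> S \<longrightarrow> f x = g x" and x: "x \<in> S"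
  shows "f x = g x"
proof -
  have "open {x \<in> S. f x - g x \<in> - {0}}"
    using continuous_open_preimage[OF continuous_on_diff[OF S(2,3)] S(1), of "- {0}"]
    by (simp only: vimage_def Int_def mem_Collect_eq open_Compl closed_singleton simp_thms)
  then have "closed (- {x \<in> S. f x - g x \<in> - {0}})" by (rule closed_Compl)
  moreover have "AE x\<in>S in lebesgue. x \<in> - {x \<in> S. f x - g x \<in> - {0}}" using ae by auto
  ultimately have "x \<in> - {x \<in> S. f x - g x \<in> - {0}}"
    using mem_closed_if_AE_lebesgue_open[OF S(1) _ _ x] by blast
  then show ?thesis using x by auto
qed

section \<open>Square-integrable functions and weak derivatives of classical ones\<close>

lemma L2_on_imp_set_integrable:
  assumes "f \<in> L2_on {a<..<b}" shows "set_integrable lebesgue {a<..<b} f"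
proof (rule set_integrable_bound)
  show "set_integrable lebesgue {a<..<b} (\<lambda>x. 1 + (f x)\<^sup>2)"
    using assms by (intro set_integral_add(1)) (auto simp: L2_on_def absolutely_integrable_on_const)
  show "set_borel_measurable lebesgue {a<..<b} f" using assms by (simp add: L2_on_def)
  have "\<bar>t\<bar> \<le> \<bar>1 + t\<^sup>2\<bar>" for t :: real
    using sum_squares_bound[of 1 "\<bar>t\<bar>"] by simp
  then show "AE x in lebesgue. x \<in> {a<..<b} \<longrightarrow> norm (f x) \<le> norm (1 + (f x)\<^sup>2)" by simp
qed

lemma continuous_imp_L2_on:
  assumes "continuous_on {a..b} f" shows "f \<in> L2_on {a<..<b}"
  unfolding L2_on_def
  using continuous_set_integrable_interior(1)[OF assms] 
    continuous_set_integrable_interior(1)[OF continuous_on_power[OF assms, of 2]]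
  by (simp add: set_borel_measurable_def set_integrable_def borel_measurable_integrable)

lemma set_integrable_compact_subset:
  assumes "set_integrable lebesgue S f" "compact K" "K \<subseteq> S"
  shows "set_integrable lebesgue K (f :: real \<Rightarrow> real)"
  using assms by (intro set_integrable_subset[OF assms(1)]) (auto intro: lmeasurable_compact fmeasurableD)

lemma classical_imp_weak_deriv:
  assumes T: "0 < T" and V: "continuous_on {0..T} V" and u: "continuous_on {0..T} u"
    and D: "\<And>x. x \<in> {0<..<T} \<Longrightarrow> (V has_real_derivative u x) (at x)"
  shows "has_weak_deriv {0<..<T} V u"
  unfolding has_weak_deriv_def
proof (intro conjI allI impI)
  fix K assume "compact K \<and> K \<subseteq> {0<..<T}"
  then show "set_integrable lebesgue K V" "set_integrable lebesgue K u"
    using continuous_set_integrable_interior(1)[OF V] continuous_set_integrable_interior(1)[OF u]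
    by (blast intro: set_integrable_compact_subset)+
next
  fix \<phi> assume \<phi>: "test_function {0<..<T} \<phi>"
  then have s: "smooth \<phi>" by (simp add: test_function_def)
  note c = smooth_imp_continuous_on[OF s] smooth_imp_continuous_on[OF smooth_deriv[OF s]]
  obtain p q where pq: "0 < p" "q < T" "\<And>x. x \<notin> {p..q} \<Longrightarrow> \<phi> x = 0"
    using test_function_support[OF \<phi> T] by metis
  have "((\<lambda>x. V x * deriv \<phi> x + u x * \<phi> x) has_integral V T * \<phi> T - V 0 * \<phi> 0) {0..T}"
  proof (rule fundamental_theorem_of_calculus_interior)
    show "continuous_on {0..T} (\<lambda>x. V x * \<phi> x)" by (intro continuous_intros V c)
    show "((\<lambda>x. V x * \<phi> x) has_vector_derivative V x * deriv \<phi> x + u x * \<phi> x) (at x)" if "x \<in> {0<..<T}" for x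
      using DERIV_mult'[OF D[OF that] smooth_imp_DERIV[OF s, of x]]
      by (simp add: has_real_derivative_iff_has_vector_derivative)
  qed (use T in simp)
  moreover have "\<phi> T = 0" "\<phi> 0 = 0" using pq by auto
  ultimately have "integral {0..T} (\<lambda>x. V x * deriv \<phi> x + u x * \<phi> x) = 0" by (simp add: integral_unique)
  moreover have "integral {0..T} (\<lambda>x. V x * deriv \<phi> x + u x * \<phi> x)
    = integral {0..T} (\<lambda>x. V x * deriv \<phi> x) + integral {0..T} (\<lambda>x. u x * \<phi> x)"
    by (intro Henstock_Kurzweil_Integration.integral_add integrable_continuous_real continuous_intros V u c)
  ultimately show "(LINT x:{0<..<T}|lebesgue. V x * deriv \<phi> x) = - (LINT x:{0<..<T}|lebesgue. u x * \<phi> x)"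
    using c by (simp add: continuous_set_integrable_interior(2) continuous_intros V u)
qed

lemma weak_deriv_unique:
  assumes T: "0 < T" and "has_weak_deriv {0<..<T} f g" "has_weak_deriv {0<..<T} f h"
  shows "AE x in lebesgue. x \<in> {0<..<T} \<longrightarrow> g x = h x"
proof -
  have loc: "set_integrable lebesgue K g" "set_integrable lebesgue K h" if "compact K" "K \<subseteq> {0<..<T}" for K
    using that assms by (auto simp: has_weak_deriv_def)
  have "AE x in lebesgue. x \<in> {0<..<T} \<longrightarrow> g x - h x = 0"
  proof (rule fundamental_lemma_variations)
    show "set_integrable lebesgue K (\<lambda>x. g x - h x)" if "compact K" "K \<subseteq> {0<..<T}" for K
      using loc that by (intro set_integral_diff(1))
    fix \<phi> assume \<phi>: "test_function {0<..<T} \<phi>"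
    have "(LINT x:{0<..<T}|lebesgue. (g x - h x) * \<phi> x)
      = (LINT x:{0<..<T}|lebesgue. g x * \<phi> x) - (LINT x:{0<..<T}|lebesgue. h x * \<phi> x)"
      by (intro set_integral_diff_mult set_integrable_mult_test[OF loc(1) \<phi> T] set_integrable_mult_test[OF loc(2) \<phi> T])
    also have "\<dots> = 0" using assms \<phi> by (auto simp: has_weak_deriv_def)
    finally show "(LINT x:{0<..<T}|lebesgue. (g x - h x) * \<phi> x) = 0" .
  qed
  then show ?thesis by simp
qed

lemma weak_deriv_spec:
  assumes "V \<in> H1_on S"
  shows "weak_deriv S V \<in> L2_on S" "has_weak_deriv S V (weak_deriv S V)"
proof -
  have "\<exists>g. g \<in> L2_on S \<and> has_weak_deriv S V g" using assms by (auto simp: H1_on_def)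
  from someI_ex[OF this] show "weak_deriv S V \<in> L2_on S" "has_weak_deriv S V (weak_deriv S V)"
    by (auto simp: weak_deriv_def)
qed

lemma classical_H1_on:
  assumes T: "0 < T" and V: "continuous_on {0..T} V" and u: "continuous_on {0..T} u"
    and D: "\<And>x. x \<in> {0<..<T} \<Longrightarrow> (V has_real_derivative u x) (at x)"
  shows "V \<in> H1_on {0<..<T}" "AE x in lebesgue. x \<in> {0<..<T} \<longrightarrow> weak_deriv {0<..<T} V x = u x"
proof -
  have wd: "has_weak_deriv {0<..<T} V u" using assms by (rule classical_imp_weak_deriv)
  then show H: "V \<in> H1_on {0<..<T}" using V u by (auto simp: H1_on_def continuous_imp_L2_on)
  show "AE x in lebesgue. x \<in> {0<..<T} \<longrightarrow> weak_deriv {0<..<T} V x = u x"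
    by (rule weak_deriv_unique[OF T weak_deriv_spec(2)[OF H] wd])
qed

section \<open>Integration by parts against a primitive, and what it yields for weak
  equations\<close>

lemma integral_lborel_interior:
  fixes f :: "real \<Rightarrow> real"
  assumes "continuous_on {a..b} f" "a \<le> b"
  shows "integrable lborel (\<lambda>x. indicator {a<..<b} x * f x)"
    "(LINT x|lborel. indicator {a<..<b} x * f x) = integral {a..b} f"
proof -
  have "set_integrable lborel {a<..<b} f"
    by (rule set_integrable_subset[OF borel_integrable_atLeastAtMost'[OF assms(1)]]) auto
  then show "integrable lborel (\<lambda>x. indicator {a<..<b} x * f x)"
    "(LINT x|lborel. indicator {a<..<b} x * f x) = integral {a..b} f"
    using set_borel_integral_eq_integral(2)[of "{a<..<b}" f]
    by (simp_all add: set_integrable_def set_lebesgue_integral_def integral_open_interval_real)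
qed

text \<open>As \<open>r\<close> is merely integrable, this is an instance of Fubini's theorem on the triangle
  \<open>z < t\<close>.\<close>

lemma integration_by_parts_primitive:
  fixes r :: "real \<Rightarrow> real"
  assumes T: "0 < T" and r: "set_integrable lebesgue {0<..<T} r" and \<phi>: "smooth \<phi>"
  shows "(LINT z:{0<..<T}|lebesgue. r z * \<phi> z)
    = \<phi> T * (LINT z:{0<..<T}|lebesgue. r z) - (LINT t:{0<..<T}|lebesgue. integral {0..t} r * deriv \<phi> t)"
proof -
  obtain h where h: "integrable lborel h" and hr: "\<And>\<psi>. \<psi> \<in> borel_measurable borel \<Longrightarrow>
      (LINT x|lborel. h x * \<psi> x) = (LINT x:{0<..<T}|lebesgue. r x * \<psi> x)"
    using set_integrable_borel_representative[OF r] by metis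
  define D where "D = (\<lambda>t. indicator {0<..<T} t * deriv \<phi> t)"
  have c\<phi>: "continuous_on A \<phi>" "continuous_on A (deriv \<phi>)" for A
    using \<phi> smooth_deriv smooth_imp_continuous_on by auto
  note [measurable] = borel_measurable_continuous_onI[OF c\<phi>(1)] borel_measurable_continuous_onI[OF c\<phi>(2)]
    borel_measurable_integrable[OF h]
  have [measurable]: "D \<in> borel_measurable borel" unfolding D_def by measurable
  have D: "integrable lborel D"
    unfolding D_def using T by (intro integral_lborel_interior(1) c\<phi>) auto
  \<comment> \<open>Integrating this kernel in t first gives h z (\<phi> T - \<phi> z), integrating
    it in z first gives the primitive of h at t times the derivative of \<phi>; comparing the two is
    the claim.\<close>
  define K where "K = (\<lambda>z t. if z < t then h z * D t else 0)"
  have Km: "case_prod K \<in> borel_measurable (lborel \<Otimes>\<^sub>M lborel)" unfolding K_def by measurable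
  have Kz: "integrable lborel (\<lambda>t. K z t)" for z
  proof (rule Bochner_Integration.integrable_bound)
    show "integrable lborel (\<lambda>t. h z * D t)" using D by simp
    show "(\<lambda>t. K z t) \<in> borel_measurable lborel" unfolding K_def by measurable
    show "AE t in lborel. norm (K z t) \<le> norm (h z * D t)" by (simp add: K_def)
  qed
  have Kint: "integrable (lborel \<Otimes>\<^sub>M lborel) (case_prod K)"
  proof (rule lborel_pair.Fubini_integrable[OF Km])
    show "AE z in lborel. integrable lborel (\<lambda>t. case_prod K (z, t))" using Kz by simp
    show "integrable lborel (\<lambda>z. LINT t|lborel. norm (case_prod K (z, t)))"
    proof (rule Bochner_Integration.integrable_bound)
      show "integrable lborel (\<lambda>z. h z * (LINT t|lborel. norm (D t)))" using h by simp
      have "(\<lambda>(z, t). norm (K z t)) \<in> borel_measurable (lborel \<Otimes>\<^sub>M lborel)"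
        unfolding K_def by measurable
      then show "(\<lambda>z. LINT t|lborel. norm (case_prod K (z, t))) \<in> borel_measurable lborel"
        using lborel.borel_measurable_lebesgue_integral[of "\<lambda>z t. norm (K z t)" lborel] by simp
      have "norm (LINT t|lborel. norm (K z t)) \<le> norm (h z * (LINT t|lborel. norm (D t)))" for z
      proof -
        have "(LINT t|lborel. norm (K z t)) \<le> (LINT t|lborel. \<bar>h z\<bar> * norm (D t))"
          using Kz D by (intro integral_mono) (auto simp: K_def abs_mult)
        then show ?thesis by (simp add: abs_mult)
      qed
      then show "AE z in lborel. norm (LINT t|lborel. norm (case_prod K (z, t)))
          \<le> norm (h z * (LINT t|lborel. norm (D t)))" by simp
    qed
  qed
  have swap: "(LINT t|lborel. LINT z|lborel. K z t) = (LINT z|lborel. LINT t|lborel. K z t)"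
    by (rule lborel_pair.Fubini_integral[OF Kint])
  have lhs: "(LINT z|lborel. LINT t|lborel. K z t) = (LINT z:{0<..<T}|lebesgue. r z * (\<phi> T - \<phi> z))"
  proof -
    have "(LINT z|lborel. LINT t|lborel. K z t) = (LINT z|lborel. h z * (LINT t|lborel. (if z < t then D t else 0)))"
    proof (intro Bochner_Integration.integral_cong refl)
      fix z
      have "(\<lambda>t. K z t) = (\<lambda>t. h z * (if z < t then D t else 0))" by (auto simp: K_def)
      then show "(LINT t|lborel. K z t) = h z * (LINT t|lborel. (if z < t then D t else 0))" by simp
    qed
    also have "\<dots> = (LINT z:{0<..<T}|lebesgue. r z * (LINT t|lborel. (if z < t then D t else 0)))"
    proof (rule hr)
      have "(\<lambda>(z, t). if z < t then D t else 0) \<in> borel_measurable (borel \<Otimes>\<^sub>M lborel)" by measurable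
      then show "(\<lambda>z. LINT t|lborel. (if z < t then D t else 0)) \<in> borel_measurable borel"
        using lborel.borel_measurable_lebesgue_integral[of "\<lambda>z t. if z < t then D t else 0" borel] by simp
    qed
    also have "\<dots> = (LINT z:{0<..<T}|lebesgue. r z * (\<phi> T - \<phi> z))"
      unfolding set_lebesgue_integral_def
    proof (intro Bochner_Integration.integral_cong refl)
      fix z
      show "indicat_real {0<..<T} z *\<^sub>R (r z * (LINT t|lborel. (if z < t then D t else 0))) =
         indicat_real {0<..<T} z *\<^sub>R (r z * (\<phi> T - \<phi> z))"
      proof (cases "z \<in> {0<..<T}")
        case True
        have "(LINT t|lborel. (if z < t then D t else 0)) = (LINT t|lborel. indicator {z<..<T} t * deriv \<phi> t)"
          using True by (intro Bochner_Integration.integral_cong refl) (auto simp: D_def indicator_def)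
        also have "\<dots> = integral {z..T} (deriv \<phi>)"
          using True by (intro integral_lborel_interior(2) c\<phi>) auto
        also have "\<dots> = \<phi> T - \<phi> z"
          using True by (intro integral_unique fundamental_theorem_of_calculus)
            (auto intro!: has_field_derivative_at_within smooth_imp_DERIV \<phi>
              simp: has_real_derivative_iff_has_vector_derivative[symmetric])
        finally show ?thesis by simp
      qed simp
    qed
    finally show ?thesis .
  qed
  have rhs: "(LINT t|lborel. LINT z|lborel. K z t) = (LINT t:{0<..<T}|lebesgue. integral {0..t} r * deriv \<phi> t)"
  proof -
    have inner: "(LINT z|lborel. K z t) = indicator {0<..<T} t * (integral {0..t} r * deriv \<phi> t)" for t
    proof (cases "t \<in> {0<..<T}")
      case True
      have "(LINT z|lborel. K z t) = (LINT z|lborel. h z * (indicator {..<t} z * deriv \<phi> t))"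
        using True by (intro Bochner_Integration.integral_cong refl) (auto simp: K_def D_def indicator_def)
      also have "\<dots> = (LINT z:{0<..<T}|lebesgue. r z * (indicator {..<t} z * deriv \<phi> t))"
        by (rule hr) measurable
      also have "\<dots> = (LINT z:{0<..<t}|lebesgue. deriv \<phi> t * r z)"
        unfolding set_lebesgue_integral_def using True
        by (intro Bochner_Integration.integral_cong refl) (auto simp: indicator_def)
      also have "\<dots> = deriv \<phi> t * (LINT z:{0<..<t}|lebesgue. r z)" by simp
      also have "(LINT z:{0<..<t}|lebesgue. r z) = integral {0..t} r"
        unfolding integral_open_interval_real
        by (rule set_lebesgue_integral_eq_integral(2)[OF set_integrable_subset[OF r]]) (use True in auto)
      finally show ?thesis using True by simp
    next
      case False
      then have "K z t = 0" for z by (auto simp: K_def D_def)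
      then show ?thesis using False by simp
    qed
    have cR: "continuous_on {0..T} (\<lambda>t. integral {0..t} r * deriv \<phi> t)"
      using set_lebesgue_integral_eq_integral(1)[OF r]
      by (intro continuous_intros c\<phi> indefinite_integral_continuous_1) (simp add: integrable_on_open_interval_real)
    show ?thesis using T
      by (simp only: inner integral_lborel_interior(2)[OF cR] continuous_set_integrable_interior(2)[OF cR] less_imp_le)
  qed
  have i\<phi>: "set_integrable lebesgue {0<..<T} (\<lambda>z. r z * \<phi> z)"
    by (rule set_integrable_mult_continuous[OF r _ _ c\<phi>(1)[of "{0..T}"]]) auto
  have "(LINT z:{0<..<T}|lebesgue. r z * (\<phi> T - \<phi> z)) = (LINT z:{0<..<T}|lebesgue. \<phi> T * r z - r z * \<phi> z)"
    by (simp add: algebra_simps)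
  also have "\<dots> = \<phi> T * (LINT z:{0<..<T}|lebesgue. r z) - (LINT z:{0<..<T}|lebesgue. r z * \<phi> z)"
    using r i\<phi> by (subst set_integral_diff(2)) auto
  finally show ?thesis using swap lhs rhs by simp
qed

text \<open>Test functions need not vanish at the ends. The constant 1 gives the vanishing total
  integral of r, which removes the boundary term at T in the integration by parts. As the derivative
  of the test function is then arbitrary, d equals the primitive of r without an additive constant:
  this encodes both Neumann conditions.\<close>

lemma weak_neumann_imp_primitive:
  assumes T: "0 < T" and d: "set_integrable lebesgue {0<..<T} d" and r: "set_integrable lebesgue {0<..<T} r"
    and test: "\<And>\<phi>. smooth \<phi> \<Longrightarrow> (LINT z:{0<..<T}|lebesgue. d z * deriv \<phi> z + r z * \<phi> z) = 0"
  shows "integral {0..T} r = 0" "AE z in lebesgue. z \<in> {0<..<T} \<longrightarrow> d z = integral {0..z} r"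
proof -
  have r0: "(LINT z:{0<..<T}|lebesgue. r z) = 0"
    using test[OF smooth_const[of 1]] by simp
  then show "integral {0..T} r = 0"
    by (simp add: set_lebesgue_integral_eq_integral(2)[OF r] integral_open_interval_real)
  have cR: "continuous_on {0..T} (\<lambda>t. integral {0..t} r)"
    using set_lebesgue_integral_eq_integral(1)[OF r]
    by (intro indefinite_integral_continuous_1) (simp add: integrable_on_open_interval_real)
  have dR: "set_integrable lebesgue {0<..<T} (\<lambda>z. d z - integral {0..z} r)"
    by (intro set_integral_diff(1) d continuous_set_integrable_interior cR)
  have "AE z in lebesgue. z \<in> {0<..<T} \<longrightarrow> d z - integral {0..z} r = 0"
  proof (rule fundamental_lemma_variations)
    show "set_integrable lebesgue K (\<lambda>z. d z - integral {0..z} r)" if "compact K" "K \<subseteq> {0<..<T}" for K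
      using dR that by (rule set_integrable_compact_subset)
    fix \<psi> assume "test_function {0<..<T} \<psi>"
    then have "smooth \<psi>" by (simp add: test_function_def)
    then obtain \<phi> where \<phi>: "smooth \<phi>" "deriv \<phi> = \<psi>" using smooth_primitive by blast
    have c: "continuous_on {0..T} \<phi>" "continuous_on {0..T} \<psi>"
      using \<phi> \<open>smooth \<psi>\<close> smooth_imp_continuous_on by auto
    have i: "set_integrable lebesgue {0<..<T} (\<lambda>z. d z * \<psi> z)"
      by (rule set_integrable_mult_continuous[OF d _ _ c(2)]) auto
    have i': "set_integrable lebesgue {0<..<T} (\<lambda>z. r z * \<phi> z)"
      by (rule set_integrable_mult_continuous[OF r _ _ c(1)]) auto
    have i'': "set_integrable lebesgue {0<..<T} (\<lambda>z. integral {0..z} r * \<psi> z)"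
      by (intro continuous_set_integrable_interior continuous_on_mult cR c)
    have "(LINT z:{0<..<T}|lebesgue. (d z - integral {0..z} r) * \<psi> z)
      = (LINT z:{0<..<T}|lebesgue. d z * \<psi> z) - (LINT z:{0<..<T}|lebesgue. integral {0..z} r * \<psi> z)"
      by (rule set_integral_diff_mult[OF i i''])
    also have "\<dots> = (LINT z:{0<..<T}|lebesgue. d z * \<psi> z) + (LINT z:{0<..<T}|lebesgue. r z * \<phi> z)"
      using integration_by_parts_primitive[OF T r \<phi>(1)] r0 \<phi>(2) by simp
    also have "\<dots> = (LINT z:{0<..<T}|lebesgue. d z * \<psi> z + r z * \<phi> z)"
      using i i' by simp
    also have "\<dots> = 0" using test[OF \<phi>(1)] \<phi>(2) by simp
    finally show "(LINT z:{0<..<T}|lebesgue. (d z - integral {0..z} r) * \<psi> z) = 0" .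
  qed
  then show "AE z in lebesgue. z \<in> {0<..<T} \<longrightarrow> d z = integral {0..z} r" by simp
qed

lemma test_function_deriv:
  assumes T: "0 < T" and \<phi>: "test_function {0<..<T} \<phi>"
  shows "test_function {0<..<T} (deriv \<phi>)"
proof -
  obtain p q where pq: "0 < p" "p \<le> q" "q < T" "\<And>x. x \<notin> {p..q} \<Longrightarrow> \<phi> x = 0"
    using test_function_support[OF \<phi> T] by metis
  have "deriv \<phi> x = 0" if "x \<notin> {p..q}" for x
  proof -
    have "(\<phi> has_real_derivative 0) (at x)"
    proof (rule has_field_derivative_transform_within_open[where S = "- {p..q}" and f = "\<lambda>_. 0"])
      show "open (- {p..q})" by (intro open_Compl closed_atLeastAtMost)
      show "x \<in> - {p..q}" using that by (simp only: Compl_iff not_False_eq_True)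
      show "0 = \<phi> y" if "y \<in> - {p..q}" for y by (metis that Compl_iff pq(4))
    qed simp
    then show ?thesis by (rule DERIV_imp_deriv)
  qed
  then show ?thesis using pq \<phi>
    by (intro test_functionI[of _ p q] smooth_deriv) (auto simp: test_function_def)
qed

text \<open>The difference of f and the primitive of g has weak derivative 0, so it is constant
  almost everywhere by du Bois-Reymond's lemma, and everywhere by continuity. The boundary term at T
  drops out because \<phi> vanishes there.\<close>

lemma weak_deriv_imp_primitive:
  assumes T: "0 < T" and f: "continuous_on {0<..<T} f" and wd: "has_weak_deriv {0<..<T} f g"
    and g: "set_integrable lebesgue {0<..<T} g"
  obtains k where "\<And>x. x \<in> {0<..<T} \<Longrightarrow> f x = k + integral {0..x} g"
proof -
  define F where "F = (\<lambda>x. integral {0..x} g)"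
  have cF: "continuous_on {0..T} F"
    unfolding F_def using set_lebesgue_integral_eq_integral(1)[OF g]
    by (intro indefinite_integral_continuous_1) (simp add: integrable_on_open_interval_real)
  have loc: "set_integrable lebesgue K f" "set_integrable lebesgue K F"
    if "compact K" "K \<subseteq> {0<..<T}" for K
    using that wd set_integrable_compact_subset[OF continuous_set_integrable_interior(1)[OF cF]]
    by (auto simp: has_weak_deriv_def)
  obtain k where k: "AE x in lebesgue. x \<in> {0<..<T} \<longrightarrow> f x - F x = k"
  proof (rule du_bois_reymond[OF T, of "\<lambda>x. f x - F x"])
    show "set_integrable lebesgue K (\<lambda>x. f x - F x)" if "compact K" "K \<subseteq> {0<..<T}" for K
      using loc that by (intro set_integral_diff(1))
    fix \<phi> assume \<phi>: "test_function {0<..<T} \<phi>"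
    note d\<phi> = test_function_deriv[OF T \<phi>]
    have "\<phi> T = 0" using test_function_support[OF \<phi> T] by (metis atLeastAtMost_iff not_le)
    then have F: "(LINT x:{0<..<T}|lebesgue. F x * deriv \<phi> x) = - (LINT x:{0<..<T}|lebesgue. g x * \<phi> x)"
      using integration_by_parts_primitive[OF T g, of \<phi>] \<phi> by (simp add: test_function_def F_def)
    have "(LINT x:{0<..<T}|lebesgue. (f x - F x) * deriv \<phi> x)
      = (LINT x:{0<..<T}|lebesgue. f x * deriv \<phi> x) - (LINT x:{0<..<T}|lebesgue. F x * deriv \<phi> x)"
      by (intro set_integral_diff_mult set_integrable_mult_test[OF loc(1) d\<phi> T] set_integrable_mult_test[OF loc(2) d\<phi> T])
    also have "\<dots> = 0" using wd \<phi> F by (simp add: has_weak_deriv_def)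
    finally show "(LINT x:{0<..<T}|lebesgue. (f x - F x) * deriv \<phi> x) = 0" .
  qed blast
  have "f x - F x = k" if "x \<in> {0<..<T}" for x
    by (rule AE_eq_imp_eq_on_open[OF _ _ _ k that])
      (auto intro!: continuous_intros f continuous_on_subset[OF cF])
  then show ?thesis using that[of k] by (simp add: F_def algebra_simps)
qed

subsection \<open>A Hamilton-Jacobi-Bellman equation with Neumann boundary conditions\<close>

text \<open>The point x is the left end of the component of {y < 0} containing z; reflection gives
  the right end in \<open>first_nonneg_after\<close>. Such maximal intervals carry the barrier and
  comparison arguments below.\<close>

lemma last_nonneg_before:
  fixes y :: "real \<Rightarrow> real"
  assumes y: "continuous_on {b..z} y" "b \<le> z" "0 \<le> y b" "y z < 0"
  obtains x where "b \<le> x" "x < z" "y x = 0" "\<And>s. x < s \<Longrightarrow> s \<le> z \<Longrightarrow> y s < 0"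
proof -
  let ?S = "{s \<in> {b..z}. 0 \<le> y s}"
  have "closed ?S" by (intro continuous_closed_preimage_constant closed_Collect_le continuous_on_closed_Collect_le y continuous_on_const) auto
  then have "compact ?S" by (metis (no_types, lifting) bounded_closed_interval bounded_subset compact_eq_bounded_closed mem_Collect_eq subsetI)
  moreover have "b \<in> ?S" using y by auto
  ultimately obtain x where x: "x \<in> ?S" "\<forall>t\<in>?S. t \<le> x" using compact_attains_sup[of ?S] by blast
  have neg: "y s < 0" if "x < s" "s \<le> z" for s
  proof (rule ccontr)
    assume "\<not> y s < 0"
    then have "s \<in> ?S" using that x(1) by auto
    then show False using x(2) that by fastforce
  qed
  have xz: "x < z" using x y by (cases "x = z") auto
  have "y x = 0"
  proof (rule ccontr)
    assume "y x \<noteq> 0"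
    then have "y x > 0" using x(1) by simp
    moreover have "continuous_on {x..z} y" using x(1) by (intro continuous_on_subset[OF y(1)]) auto
    ultimately obtain s where s: "x \<le> s" "s \<le> z" "y s = 0"
      using IVT2'[of y z 0 x] y(4) xz by auto
    with \<open>y x \<noteq> 0\<close> have "x < s" by (cases "x = s") auto
    then show False using neg[of s] s by simp
  qed
  then show ?thesis using that x xz neg by auto
qed

lemma first_nonneg_after:
  fixes y :: "real \<Rightarrow> real"
  assumes y: "continuous_on {z..b} y" "z \<le> b" "0 \<le> y b" "y z < 0"
  obtains x where "z < x" "x \<le> b" "y x = 0" "\<And>s. z \<le> s \<Longrightarrow> s < x \<Longrightarrow> y s < 0"
proof -
  have "continuous_on {- b..- z} (\<lambda>s. y (- s))"
    by (intro continuous_on_compose2[OF y(1)] continuous_intros) auto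
  then obtain x where x: "- b \<le> x" "x < - z" "y (- x) = 0" "\<And>s. x < s \<Longrightarrow> s \<le> - z \<Longrightarrow> y (- s) < 0"
    using last_nonneg_before[of "- b" "- z" "\<lambda>s. y (- s)"] y by auto
  show ?thesis
  proof (rule that[of "- x"])
    show "y s < 0" if "z \<le> s" "s < - x" for s using x(4)[of "- s"] that by simp
  qed (use x in auto)
qed

lemma has_derivative_nonpos_if_max_right:
  assumes D: "(y has_real_derivative D) (at x within {0..T})" and b: "0 \<le> x" "x < b" "b \<le> T"
    and max: "\<And>s. x < s \<Longrightarrow> s \<le> b \<Longrightarrow> y s \<le> y x"
  shows "D \<le> (0::real)"
proof (rule ccontr)
  assume "\<not> D \<le> 0"
  then obtain d where d: "d > 0" "\<And>h. h > 0 \<Longrightarrow> x + h \<in> {0..T} \<Longrightarrow> h < d \<Longrightarrow> y x < y (x + h)"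
    using has_real_derivative_pos_inc_right[OF D] by auto
  define e where "e = min d (b - x) / 2"
  have "0 < e" "e < d" "x + e \<le> b" using d b by (auto simp: e_def min_def field_simps)
  then show False using d(2)[of e] max[of "x + e"] b by auto
qed

lemma has_derivative_nonneg_if_max_left:
  assumes D: "(y has_real_derivative D) (at x within {0..T})" and b: "0 \<le> b" "b < x" "x \<le> T"
    and max: "\<And>s. b \<le> s \<Longrightarrow> s < x \<Longrightarrow> y s \<le> y x"
  shows "(0::real) \<le> D"
proof (rule ccontr)
  assume "\<not> 0 \<le> D"
  then obtain d where d: "d > 0" "\<And>h. h > 0 \<Longrightarrow> x - h \<in> {0..T} \<Longrightarrow> h < d \<Longrightarrow> y x < y (x - h)"
    using has_real_derivative_neg_dec_left[OF D] by auto
  define e where "e = min d (x - b) / 2"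
  have "0 < e" "e < d" "b \<le> x - e" using d b by (auto simp: e_def min_def field_simps)
  then show False using d(2)[of e] max[of "x - e"] b by auto
qed

text \<open>To become positive, y would have to leave 0 at a first time, where its slope is
  negative. The premise of \<open>dec\<close> also offers the sign of y at all earlier times: in the
  shooting argument y is the slope, and its past sign controls the value function at the
  zero.\<close>

lemma nonpos_if_decreasing_at_zeros:
  fixes y :: "real \<Rightarrow> real"
  assumes D: "\<And>z. z \<in> {0..T} \<Longrightarrow> (y has_real_derivative y' z) (at z within {0..T})"
    and y0: "y 0 \<le> 0"
    and dec: "\<And>x. 0 \<le> x \<Longrightarrow> x < T \<Longrightarrow> y x = 0 \<Longrightarrow> (\<And>s. 0 \<le> s \<Longrightarrow> s \<le> x \<Longrightarrow> y s \<le> 0) \<Longrightarrow> y' x < 0"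
    and z: "z \<in> {0..T}"
  shows "y z \<le> 0"
proof (rule ccontr)
  assume "\<not> y z \<le> 0"
  then have yz: "y z > 0" by simp
  have cont: "continuous_on {0..T} y"
    by (rule DERIV_continuous_on) (rule D)
  define Z where "Z = {s \<in> {0..z}. y s > 0}"
  \<comment> \<open>The infimum of the times with positive y. It must be a zero of y; there the
    negative slope keeps y nonpositive for a further time e, which contradicts the choice of
    x.\<close>
  define x where "x = Inf Z"
  have Z: "Z \<noteq> {}" "bdd_below Z" using yz z by (auto simp: Z_def)
  have below: "y s \<le> 0" if "0 \<le> s" "s < x" "s \<le> z" for s
  proof (rule ccontr)
    assume "\<not> y s \<le> 0"
    then have "s \<in> Z" using that by (simp add: Z_def)
    then have "x \<le> s" unfolding x_def using Z(2) by (rule cInf_lower)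
    then show False using that by simp
  qed
  have "x \<in> closure Z" unfolding x_def by (rule closure_contains_Inf[OF Z])
  moreover have "closure Z \<subseteq> {s \<in> {0..z}. 0 \<le> y s}"
  proof (rule closure_minimal)
    have "continuous_on {0..z} y" using z by (intro continuous_on_subset[OF cont]) auto
    then show "closed {s \<in> {0..z}. 0 \<le> y s}"
      by (intro continuous_on_closed_Collect_le continuous_on_const) auto
  qed (auto simp: Z_def)
  ultimately have x: "0 \<le> x" "x \<le> z" "0 \<le> y x" by auto
  have "y x \<le> 0"
  proof (rule ccontr)
    assume "\<not> y x \<le> 0"
    then have yx: "- y x < 0" by simp
    obtain x1 where x1: "0 \<le> x1" "x1 < x" "\<And>s. x1 < s \<Longrightarrow> s \<le> x \<Longrightarrow> - y s < 0"
    proof (rule last_nonneg_before[of 0 x "\<lambda>s. - y s"])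
      show "continuous_on {0..x} (\<lambda>s. - y s)"
        by (intro continuous_on_minus continuous_on_subset[OF cont]) (use x z in auto)
    qed (use x y0 yx in auto)
    obtain s where "x1 < s" "s < x" using dense[OF x1(2)] by blast
    then show False using below[of s] x1(1) x1(3)[of s] x by auto
  qed
  then have yx: "y x = 0" using x by simp
  then have xz: "x < z" using x yz by (cases "x = z") auto
  have "y' x < 0"
  proof (rule dec[OF x(1) _ yx])
    show "x < T" using xz z by auto
    show "y s \<le> 0" if "0 \<le> s" "s \<le> x" for s using below[of s] that yx x by (cases "s = x") auto
  qed
  then obtain d where d: "d > 0" "\<And>h. h > 0 \<Longrightarrow> x + h \<in> {0..T} \<Longrightarrow> h < d \<Longrightarrow> y (x + h) < y x"
    using has_real_derivative_neg_dec_right[OF D[of x]] x xz z by auto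
  define e where "e = min d (z - x) / 2"
  have e: "0 < e" "e < d" "e < z - x" using d xz by (auto simp: e_def min_def field_simps)
  have "x + e \<le> Inf Z"
  proof (rule cInf_greatest[OF Z(1)])
    fix s assume s: "s \<in> Z"
    then have "x \<le> s" unfolding x_def using Z(2) by (rule cInf_lower)
    show "x + e \<le> s"
    proof (rule ccontr)
      assume "\<not> x + e \<le> s"
      then have "y s \<le> 0" using d(2)[of "s - x"] \<open>x \<le> s\<close> e yx x xz z s by (cases "s = x") (auto simp: Z_def)
      then show False using s by (simp add: Z_def)
    qed
  qed
  then show False using e by (simp add: x_def)
qed

section \<open>The equation as a first order system\<close>

text \<open>Keeping the slope u as a separate function makes one-sided derivatives at the ends
  expressible and puts the second order equation into the form to which the initial value theory
  applies.\<close>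

definition hjb_solution ::
  "real \<Rightarrow> real \<Rightarrow> real \<Rightarrow> (real \<Rightarrow> real) \<Rightarrow> (real \<Rightarrow> real) \<Rightarrow> real \<Rightarrow> (real \<Rightarrow> real) \<Rightarrow> (real \<Rightarrow> real) \<Rightarrow> bool"
where
  "hjb_solution a \<rho> T h f c V u \<longleftrightarrow>
     (\<forall>z\<in>{0..T}. (V has_real_derivative u z) (at z within {0..T}) \<and>
        (u has_real_derivative (\<rho> * V z - h (u z) - c * u z - f z) / a) (at z within {0..T})) \<and>
     u 0 = 0 \<and> u T = 0"

lemma hjb_solutionD:
  assumes "hjb_solution a \<rho> T h f c V u"
  shows "\<And>z. z \<in> {0..T} \<Longrightarrow> (V has_real_derivative u z) (at z within {0..T})"
    "\<And>z. z \<in> {0..T} \<Longrightarrow> (u has_real_derivative (\<rho> * V z - h (u z) - c * u z - f z) / a) (at z within {0..T})"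
    "u 0 = 0" "u T = 0"
  using assms by (auto simp: hjb_solution_def)

lemma hjb_solution_continuous:
  assumes S: "hjb_solution a \<rho> T h f c V u"
  shows "continuous_on {0..T} V" "continuous_on {0..T} u"
  using DERIV_continuous_on[OF hjb_solutionD(1)[OF S]] DERIV_continuous_on[OF hjb_solutionD(2)[OF S]] by auto

text \<open>Here h stands for the truncated Hamiltonian, which is why a global Lipschitz constant
  may be assumed. No Lipschitz condition is put on f, since the revenue has infinite slope at 0; its
  growth rate \<open>\<phi>0\<close> is what forces the slope of solutions to be positive
  inside.\<close>

locale hjb =
  fixes a \<rho> T \<Lambda> \<phi>0 :: real and h f :: "real \<Rightarrow> real"
  assumes pos: "0 < a" "0 < \<rho>" "0 < T" "0 \<le> \<Lambda>" "0 < \<phi>0"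
    and h_mono: "\<And>x y. x \<le> y \<Longrightarrow> h x \<le> h y"
    and h_0: "h 0 = 0"
    and h_lip: "\<And>x y. \<bar>h x - h y\<bar> \<le> \<Lambda> * \<bar>x - y\<bar>"
    and f_cont: "continuous_on {0..T} f"
    and f_0: "0 \<le> f 0"
    and f_incr: "\<And>x y. 0 \<le> x \<Longrightarrow> x \<le> y \<Longrightarrow> y \<le> T \<Longrightarrow> \<phi>0 * (y - x) \<le> f y - f x"
begin

abbreviation "sol \<equiv> hjb_solution a \<rho> T h f"

abbreviation "u_max \<equiv> T * f T / a"

lemma f_mono: "0 \<le> x \<Longrightarrow> x \<le> y \<Longrightarrow> y \<le> T \<Longrightarrow> f x \<le> f y"
  using f_incr[of x y] pos by (smt (verit) mult_nonneg_nonneg)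

lemma f_nonneg: "0 \<le> x \<Longrightarrow> x \<le> T \<Longrightarrow> 0 \<le> f x"
  using f_mono[of 0 x] f_0 by simp

lemma u_max_nonneg: "0 \<le> u_max"
  using f_nonneg[of T] pos by simp

abbreviation "slope c V u z \<equiv> (\<rho> * V z - h (u z) - c * u z - f z) / a"

lemmas sol_continuous = hjb_solution_continuous[of a \<rho> T h f]
  and solD = hjb_solutionD[of a \<rho> T h f]

section \<open>A priori bounds on the slope\<close>

lemma sol_mean_value:
  assumes S: "sol c V u" and xy: "0 \<le> x" "x \<le> y" "y \<le> T"
  shows "\<exists>s\<in>{x..y}. V y - V x = u s * (y - x)" "\<exists>s\<in>{x..y}. u y - u x = slope c V u s * (y - x)"
proof -
  have sub: "{x..y} \<subseteq> {0..T}" using xy by auto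
  show "\<exists>s\<in>{x..y}. V y - V x = u s * (y - x)"
    by (rule mean_value_within[OF xy(2) sub, of V u]) (use sub solD(1)[OF S] in auto)
  show "\<exists>s\<in>{x..y}. u y - u x = slope c V u s * (y - x)"
    by (rule mean_value_within[OF xy(2) sub, of u "slope c V u"]) (use sub solD(2)[OF S] in auto)
qed

text \<open>The nonlocal comparison argument: if \<open>u\<close> dipped below the parabola on a maximal interval
  \<open>(x1, x2)\<close>, comparing the slopes at its two ends and subtracting the two resulting inequalities
  contradicts the growth of \<open>f\<close>.\<close>

lemma sol_lower_barrier:
  assumes S: "sol c V u" and c: "0 \<le> c" and \<epsilon>: "0 \<le> \<epsilon>"
    and small: "\<epsilon> * (2 * a + \<rho> * T\<^sup>2 + (\<Lambda> + c) * T) < \<phi>0" and z: "z \<in> {0..T}"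
  shows "\<epsilon> * z * (T - z) \<le> u z"
proof (rule ccontr)
  assume neg: "\<not> \<epsilon> * z * (T - z) \<le> u z"
  define \<psi> where "\<psi> = (\<lambda>z. \<epsilon> * z * (T - z))"
  define y where "y = (\<lambda>z. u z - \<psi> z)"
  note D = solD(2)[OF S]
  have y0: "y 0 = 0" "y T = 0" using solD(3,4)[OF S] by (auto simp: y_def \<psi>_def)
  have Dy: "(y has_real_derivative slope c V u z - \<epsilon> * (T - 2 * z)) (at z within {0..T})"
    if "z \<in> {0..T}" for z
    unfolding y_def \<psi>_def using D[OF that] by (auto intro!: derivative_eq_intros simp: algebra_simps)
  have cy: "continuous_on {0..T} y"
    unfolding y_def \<psi>_def by (intro continuous_intros sol_continuous(2)[OF S])
  have yz: "y z < 0" using neg by (simp add: y_def \<psi>_def)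
  obtain x1 where x1: "0 \<le> x1" "x1 < z" "y x1 = 0" "\<And>s. x1 < s \<Longrightarrow> s \<le> z \<Longrightarrow> y s < 0"
    using last_nonneg_before[of 0 z y, OF continuous_on_subset[OF cy]] z yz y0 by auto
  obtain x2 where x2: "z < x2" "x2 \<le> T" "y x2 = 0" "\<And>s. z \<le> s \<Longrightarrow> s < x2 \<Longrightarrow> y s < 0"
    using first_nonneg_after[of z T y, OF continuous_on_subset[OF cy]] z yz y0 by auto
  have x12: "x1 < x2" "x1 \<in> {0..T}" "x2 \<in> {0..T}" using x1 x2 by auto
  have yneg: "y s \<le> 0" if "x1 \<le> s" "s \<le> x2" for s
    using x1(3) x1(4)[of s] x2(3) x2(4)[of s] that by (cases "s = x1"; cases "s = x2"; cases "s \<le> z") (auto simp: less_eq_real_def)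
  have e1: "(\<rho> * V x1 - h (\<psi> x1) - c * \<psi> x1 - f x1) / a - \<epsilon> * (T - 2 * x1) \<le> 0"
    using has_derivative_nonpos_if_max_right[OF Dy[OF x12(2)] x1(1) x12(1) x2(2)] yneg x1(3) by (simp add: y_def)
  have e2: "(\<rho> * V x2 - h (\<psi> x2) - c * \<psi> x2 - f x2) / a - \<epsilon> * (T - 2 * x2) \<ge> 0"
    using has_derivative_nonneg_if_max_left[OF Dy[OF x12(3)] x1(1) x12(1) x2(2)] yneg x2(3) by (simp add: y_def)
  define \<Delta> where "\<Delta> = x2 - x1"
  have \<Delta>: "\<Delta> > 0" using x12 by (simp add: \<Delta>_def)
  have f12: "\<phi>0 * \<Delta> \<le> f x2 - f x1" unfolding \<Delta>_def using x12 by (intro f_incr) auto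
  \<comment> \<open>On the dip u stays below the parabola, so V can increase there only at a rate of
    order \<epsilon>. This controls the term \<rho> V, which at a point depends on the slope
    elsewhere.\<close>
  have V12: "V x2 - V x1 \<le> \<epsilon> * T\<^sup>2 * \<Delta>"
  proof -
    obtain s where s: "x1 \<le> s" "s \<le> x2" "V x2 - V x1 = u s * (x2 - x1)"
      using sol_mean_value(1)[OF S, of x1 x2] x12 by auto
    have "s * (T - s) \<le> T * T" using s x1(1) x2(2) by (intro mult_mono) auto
    then have "\<epsilon> * (s * (T - s)) \<le> \<epsilon> * (T * T)" using \<epsilon> by (rule mult_left_mono)
    then have "u s \<le> \<epsilon> * T\<^sup>2" using yneg[of s] s by (simp add: y_def \<psi>_def power2_eq_square mult.assoc)
    then show ?thesis using s \<Delta> by (simp add: \<Delta>_def mult_right_mono)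
  qed
  have \<psi>12: "\<bar>\<psi> x1 - \<psi> x2\<bar> \<le> \<epsilon> * T * \<Delta>"
  proof -
    have "\<psi> x1 - \<psi> x2 = \<epsilon> * (x1 + x2 - T) * \<Delta>" by (simp add: \<psi>_def \<Delta>_def algebra_simps)
    moreover have "\<bar>x1 + x2 - T\<bar> \<le> T" using x12 by auto
    ultimately show ?thesis using \<epsilon> \<Delta> by (simp add: abs_mult mult_left_mono mult_right_mono)
  qed
  have h12: "h (\<psi> x1) - h (\<psi> x2) \<le> \<Lambda> * (\<epsilon> * T * \<Delta>)"
    using h_lip[of "\<psi> x1" "\<psi> x2"] mult_left_mono[OF \<psi>12 pos(4)] by linarith
  have c12: "c * \<psi> x1 - c * \<psi> x2 \<le> c * (\<epsilon> * T * \<Delta>)"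
  proof -
    have "\<psi> x1 - \<psi> x2 \<le> \<epsilon> * T * \<Delta>" using \<psi>12 by linarith
    from mult_left_mono[OF this c] show ?thesis by (simp add: right_diff_distrib)
  qed
  have \<rho>12: "\<rho> * V x2 - \<rho> * V x1 \<le> \<rho> * (\<epsilon> * T\<^sup>2 * \<Delta>)"
    using mult_left_mono[OF V12, of \<rho>] pos by (simp add: right_diff_distrib)
  have "\<rho> * V x1 - h (\<psi> x1) - c * \<psi> x1 - f x1 \<le> a * (\<epsilon> * (T - 2 * x1))"
    using e1 pos by (simp add: field_simps)
  moreover have "\<rho> * V x2 - h (\<psi> x2) - c * \<psi> x2 - f x2 \<ge> a * (\<epsilon> * (T - 2 * x2))"
    using e2 pos by (simp add: field_simps)
  moreover have "a * (\<epsilon> * (T - 2 * x1)) - a * (\<epsilon> * (T - 2 * x2)) = 2 * a * \<epsilon> * \<Delta>"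
    by (simp add: \<Delta>_def algebra_simps)
  ultimately have "\<phi>0 * \<Delta> \<le> 2 * a * \<epsilon> * \<Delta> + \<rho> * (\<epsilon> * T\<^sup>2 * \<Delta>) + \<Lambda> * (\<epsilon> * T * \<Delta>) + c * (\<epsilon> * T * \<Delta>)"
    using f12 h12 c12 \<rho>12 by linarith
  also have "\<dots> = (\<epsilon> * (2 * a + \<rho> * T\<^sup>2 + (\<Lambda> + c) * T)) * \<Delta>" by (simp add: algebra_simps)
  also have "\<dots> < \<phi>0 * \<Delta>" using small \<Delta> by (rule mult_strict_right_mono)
  finally show False by simp
qed

lemma sol_u_nonneg: "sol c V u \<Longrightarrow> 0 \<le> c \<Longrightarrow> z \<in> {0..T} \<Longrightarrow> 0 \<le> u z"
  using sol_lower_barrier[of c V u 0 z] pos by simp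

text \<open>As u is nonnegative and vanishes at T, its derivative there is nonpositive, so \<rho> V
  T is at most f T. Because V is nondecreasing, this bounds \<rho> V everywhere and u' by f T / a.
  The bound does not contain \<Lambda>, which is what allows the truncation to be removed.\<close>

lemma sol_u_le:
  assumes S: "sol c V u" and c: "0 \<le> c" and z: "z \<in> {0..T}"
  shows "u z \<le> u_max"
proof -
  note nn = sol_u_nonneg[OF S c]
  have uT: "u T = 0" "u 0 = 0" using S by (auto simp: hjb_solution_def)
  have "(u has_real_derivative slope c V u T) (at T within {0..T})"
    using solD(2)[OF S, of T] pos by simp
  from has_derivative_nonneg_if_max_left[OF DERIV_minus[OF this], of 0]
  have "slope c V u T \<le> 0" using nn uT pos by simp
  then have VT: "\<rho> * V T \<le> f T" using pos uT h_0 by (simp add: divide_le_0_iff)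
  have V: "\<rho> * V s \<le> f T" if s: "s \<in> {0..T}" for s
  proof -
    obtain t where t: "s \<le> t" "t \<le> T" "V T - V s = u t * (T - s)"
      using sol_mean_value(1)[OF S, of s T] s by auto
    have "0 \<le> u t * (T - s)" using nn[of t] t s by (intro mult_nonneg_nonneg) auto
    then have "V s \<le> V T" using t by simp
    then have "\<rho> * V s \<le> \<rho> * V T" using pos by simp
    with VT show ?thesis by simp
  qed
  obtain s where s: "0 \<le> s" "s \<le> z" "u z - u 0 = slope c V u s * (z - 0)"
    using sol_mean_value(2)[OF S, of 0 z] z by auto
  have sT: "s \<in> {0..T}" using s z by auto
  have "h (u s) \<ge> 0" "c * u s \<ge> 0" using nn[OF sT] h_mono[of 0 "u s"] h_0 c by auto
  then have "\<rho> * V s - h (u s) - c * u s - f s \<le> f T" using V[OF sT] f_nonneg[of s] sT by simp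
  then have "slope c V u s \<le> f T / a" using pos by (simp add: divide_right_mono)
  then have "slope c V u s * z \<le> f T / a * z" using z by (intro mult_right_mono) auto
  then have "u z \<le> f T / a * z" using s uT by simp
  also have "\<dots> \<le> f T / a * T" using z f_nonneg[of T] pos by (intro mult_left_mono) auto
  finally show ?thesis by (simp add: mult.commute)
qed

section \<open>Dependence of solutions on the number c\<close>

lemma sol_diff_deriv:
  assumes S: "sol c1 V1 u1" "sol c2 V2 u2" and z: "z \<in> {0..T}"
  shows "((\<lambda>z. V1 z - V2 z) has_real_derivative u1 z - u2 z) (at z within {0..T})"
    "((\<lambda>z. u1 z - u2 z) has_real_derivative
      (\<rho> * (V1 z - V2 z) - (h (u1 z) - h (u2 z)) - c1 * (u1 z - u2 z) - (c1 - c2) * u2 z) / a) (at z within {0..T})"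
proof -
  have "slope c1 V1 u1 z - slope c2 V2 u2 z
      = (\<rho> * (V1 z - V2 z) - (h (u1 z) - h (u2 z)) - c1 * (u1 z - u2 z) - (c1 - c2) * u2 z) / a"
    by (simp add: diff_divide_distrib[symmetric] algebra_simps)
  then show "((\<lambda>z. u1 z - u2 z) has_real_derivative
      (\<rho> * (V1 z - V2 z) - (h (u1 z) - h (u2 z)) - c1 * (u1 z - u2 z) - (c1 - c2) * u2 z) / a) (at z within {0..T})"
    using DERIV_diff[OF solD(2)[OF S(1) z] solD(2)[OF S(2) z]] by simp
qed (intro DERIV_diff solD(1)[OF S(1) z] solD(1)[OF S(2) z])

lemma coupling_term_le:
  assumes S: "sol c2 V2 u2" and c: "0 \<le> c2" and z: "z \<in> {0..T}"
  shows "\<bar>(c1 - c2) * u2 z\<bar> \<le> \<bar>c1 - c2\<bar> * u_max"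
  using sol_u_nonneg[OF S c z] sol_u_le[OF S c z] unfolding abs_mult by (intro mult_left_mono) auto

text \<open>The maximum principle. At a maximum of V1 - V2 the slopes agree, by criticality inside
  and by the Neumann condition at the ends, and the derivative D of u1 - u2 is nonpositive; what
  remains of the equation is \<rho> (V1 - V2) \<le> (c1 - c2) u2.\<close>

lemma sol_V_diff_le:
  assumes S1: "sol c1 V1 u1" and S2: "sol c2 V2 u2" and c: "0 \<le> c1" "0 \<le> c2" and z: "z \<in> {0..T}"
  shows "\<rho> * (V1 z - V2 z) \<le> \<bar>c1 - c2\<bar> * u_max"
proof -
  define \<delta> where "\<delta> = (\<lambda>z. V1 z - V2 z)"
  have "continuous_on {0..T} \<delta>" unfolding \<delta>_def
    by (intro continuous_intros sol_continuous(1)[OF S1] sol_continuous(1)[OF S2])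
  then obtain x where x: "x \<in> {0..T}" "\<And>y. y \<in> {0..T} \<Longrightarrow> \<delta> y \<le> \<delta> x"
    using continuous_attains_sup[of "{0..T}" \<delta>] pos by auto
  have D\<delta>: "(\<delta> has_real_derivative u1 z - u2 z) (at z within {0..T})" if "z \<in> {0..T}" for z
    unfolding \<delta>_def by (rule sol_diff_deriv(1)[OF S1 S2 that])
  have mv: "\<exists>s\<in>{y<..<y'}. \<delta> y' - \<delta> y = (u1 s - u2 s) * (y' - y)" if "0 \<le> y" "y < y'" "y' \<le> T" for y y'
  proof (rule mvt_simple[OF that(2), of \<delta> "\<lambda>s. (*) (u1 s - u2 s)"])
    fix s assume "y \<le> s" "s \<le> y'"
    then have "s \<in> {0..T}" using that by simp
    from has_derivative_subset[OF D\<delta>[OF this, unfolded has_field_derivative_def], of "{y..y'}"]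
    show "(\<delta> has_derivative (*) (u1 s - u2 s)) (at s within {y..y'})" using that by simp
  qed
  have d0: "u1 x - u2 x = 0"
  proof (cases "x = 0 \<or> x = T")
    case True
    then show ?thesis using S1 S2 by (auto simp: hjb_solution_def)
  next
    case False
    then have xi: "x \<in> {0<..<T}" using x by auto
    have "(\<delta> has_real_derivative u1 x - u2 x) (at x)"
      using D\<delta>[OF x(1)] at_within_interior[of x "{0..T}"] xi by simp
    then show ?thesis
    proof (rule DERIV_local_max)
      show "0 < min x (T - x)" using xi by simp
      show "\<forall>y. \<bar>x - y\<bar> < min x (T - x) \<longrightarrow> \<delta> y \<le> \<delta> x"
        by (intro allI impI x(2)) (use xi in \<open>auto simp: abs_less_iff\<close>)
    qed
  qed
  define D where "D = (\<rho> * (V1 x - V2 x) - (h (u1 x) - h (u2 x)) - c1 * (u1 x - u2 x) - (c1 - c2) * u2 x) / a"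
  note Dd = sol_diff_deriv(2)[OF S1 S2 x(1), folded D_def]
  \<comment> \<open>If D were positive, u1 - u2 would be positive just to the right of x, or
    negative just to the left if x = T. In either case x would not be a maximum; this argument
    covers the end points too.\<close>
  have "D \<le> 0"
  proof (rule ccontr)
    assume "\<not> D \<le> 0"
    then have D: "D > 0" by simp
    show False
    proof (cases "x < T")
      case True
      obtain d where d: "d > 0" "\<And>h. h > 0 \<Longrightarrow> x + h \<in> {0..T} \<Longrightarrow> h < d \<Longrightarrow> u1 x - u2 x < u1 (x + h) - u2 (x + h)"
        using has_real_derivative_pos_inc_right[OF Dd D] by blast
      define e where "e = min d (T - x) / 2"
      have e: "0 < e" "e < d" "x + e \<le> T" using d True by (auto simp: e_def min_def field_simps)
      then obtain s where s: "x < s" "s < x + e" "\<delta> (x + e) - \<delta> x = (u1 s - u2 s) * e"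
        using mv[of x "x + e"] x(1) by auto
      then have "0 < u1 s - u2 s" using d(2)[of "s - x"] d0 e x by auto
      then have "0 < \<delta> (x + e) - \<delta> x" unfolding s(3) using e(1) by (rule mult_pos_pos)
      then show False using e x(2)[of "x + e"] x(1) by auto
    next
      case False
      then have xT: "x = T" using x by simp
      obtain d where d: "d > 0" "\<And>h. h > 0 \<Longrightarrow> x - h \<in> {0..T} \<Longrightarrow> h < d \<Longrightarrow> u1 (x - h) - u2 (x - h) < u1 x - u2 x"
        using has_real_derivative_pos_inc_left[OF Dd D] by blast
      define e where "e = min d T / 2"
      have e: "0 < e" "e < d" "e \<le> T" using d pos by (auto simp: e_def min_def field_simps)
      then obtain s where s: "x - e < s" "s < x" "\<delta> x - \<delta> (x - e) = (u1 s - u2 s) * e"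
        using mv[of "x - e" x] xT by auto
      then have "u1 s - u2 s < 0" using d(2)[of "x - s"] d0 e xT by auto
      then have "\<delta> x - \<delta> (x - e) < 0" unfolding s(3) using e(1) by (rule mult_neg_pos)
      then show False using e x(2)[of "x - e"] xT by auto
    qed
  qed
  moreover have "D = (\<rho> * \<delta> x - (c1 - c2) * u2 x) / a" using d0 by (simp add: D_def \<delta>_def)
  ultimately have "\<rho> * \<delta> x \<le> (c1 - c2) * u2 x" using pos by (simp add: divide_le_0_iff)
  also have "\<dots> \<le> \<bar>c1 - c2\<bar> * u_max" using coupling_term_le[OF S2 c(2) x(1), of c1] by linarith
  finally have "\<rho> * \<delta> x \<le> \<bar>c1 - c2\<bar> * u_max" .
  moreover have "\<rho> * \<delta> z \<le> \<rho> * \<delta> x" using x(2)[OF z] pos by simp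
  ultimately show ?thesis by (simp add: \<delta>_def)
qed

lemma sol_u_diff_le:
  assumes S1: "sol c1 V1 u1" and S2: "sol c2 V2 u2" and c: "0 \<le> c1" "0 \<le> c2" and z: "z \<in> {0..T}"
  shows "u1 z - u2 z \<le> 2 * u_max * T / a * \<bar>c1 - c2\<bar>"
proof (cases "u1 z - u2 z \<le> 0")
  case True
  moreover have "0 \<le> 2 * u_max * T / a * \<bar>c1 - c2\<bar>"
    using u_max_nonneg f_nonneg[of T] pos by (intro mult_nonneg_nonneg divide_nonneg_nonneg) auto
  ultimately show ?thesis by linarith
next
  case False
  have u0: "u1 0 = 0" "u2 0 = 0" using S1 S2 by (auto simp: hjb_solution_def)
  have "continuous_on {0..z} (\<lambda>s. - (u1 s - u2 s))"
    using z by (intro continuous_intros continuous_on_subset[OF sol_continuous(2)[OF S1]] continuous_on_subset[OF sol_continuous(2)[OF S2]]) auto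
  then obtain x where x: "0 \<le> x" "x < z" "- (u1 x - u2 x) = 0" "\<And>s. x < s \<Longrightarrow> s \<le> z \<Longrightarrow> - (u1 s - u2 s) < 0"
    using last_nonneg_before[of 0 z "\<lambda>s. - (u1 s - u2 s)"] z False u0 by auto
  let ?D = "\<lambda>z. (\<rho> * (V1 z - V2 z) - (h (u1 z) - h (u2 z)) - c1 * (u1 z - u2 z) - (c1 - c2) * u2 z) / a"
  obtain s where s: "s \<in> {x..z}" "(u1 z - u2 z) - (u1 x - u2 x) = ?D s * (z - x)"
    using mean_value_within[of x z "{0..T}" "\<lambda>z. u1 z - u2 z" ?D] sol_diff_deriv(2)[OF S1 S2] x z by auto
  have sT: "s \<in> {0..T}" using s x z by auto
  have d: "u2 s \<le> u1 s" using x(3) x(4)[of s] s(1) by (cases "s = x") auto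
  have "?D s \<le> (2 * (\<bar>c1 - c2\<bar> * u_max)) / a"
  proof (rule divide_right_mono)
    have *: "p - (q1 - q2) - r - t \<le> 2 * B" if "\<bar>t\<bar> \<le> B" "p \<le> B" "q2 \<le> q1" "0 \<le> r" for p q1 q2 r t B :: real
      using that by linarith
    show "\<rho> * (V1 s - V2 s) - (h (u1 s) - h (u2 s)) - c1 * (u1 s - u2 s) - (c1 - c2) * u2 s \<le> 2 * (\<bar>c1 - c2\<bar> * u_max)"
    proof (rule *)
      show "\<bar>(c1 - c2) * u2 s\<bar> \<le> \<bar>c1 - c2\<bar> * u_max" by (rule coupling_term_le[OF S2 c(2) sT])
      show "\<rho> * (V1 s - V2 s) \<le> \<bar>c1 - c2\<bar> * u_max" by (rule sol_V_diff_le[OF S1 S2 c sT])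
      show "h (u2 s) \<le> h (u1 s)" by (rule h_mono[OF d])
      show "0 \<le> c1 * (u1 s - u2 s)" using c d by simp
    qed
  qed (use pos in simp)
  then have "?D s * (z - x) \<le> (2 * (\<bar>c1 - c2\<bar> * u_max)) / a * (z - x)"
    using x by (intro mult_right_mono) auto
  also have "\<dots> \<le> (2 * (\<bar>c1 - c2\<bar> * u_max)) / a * T"
    using x z pos f_nonneg[of T] by (intro mult_left_mono divide_nonneg_nonneg mult_nonneg_nonneg) auto
  finally show ?thesis using s(2) x(3) by (simp add: algebra_simps)
qed

lemma sol_unique:
  assumes S1: "sol c V1 u1" and S2: "sol c V2 u2" and c: "0 \<le> c" and z: "z \<in> {0..T}"
  shows "V1 z = V2 z" "u1 z = u2 z"
proof -
  have "\<rho> * (V1 z - V2 z) \<le> 0" "\<rho> * (V2 z - V1 z) \<le> 0"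
    using sol_V_diff_le[OF S1 S2 c c z] sol_V_diff_le[OF S2 S1 c c z] by auto
  then show "V1 z = V2 z" using pos by (simp add: mult_le_0_iff)
  show "u1 z = u2 z" using sol_u_diff_le[OF S1 S2 c c z] sol_u_diff_le[OF S2 S1 c c z] by auto
qed

text \<open>A bound for the derivative of u1 - u2 relative to |c1 - c2|. The first summand collects
  the terms \<rho> (V1 - V2) and (c1 - c2) u2, the second the terms with h and c1, estimated by
  \<open>sol_u_diff_le\<close>.\<close>

definition lip_const :: "real \<Rightarrow> real" where
  "lip_const M = (2 * u_max + (\<Lambda> + M) * (2 * u_max * T / a)) / a"

text \<open>All slopes vanish at both ends, so a bound on the derivative of the difference can be
  integrated from whichever end is nearer.\<close>

lemma sol_u_lipschitz_boundary:
  assumes S1: "sol c1 V1 u1" and S2: "sol c2 V2 u2" and c: "0 \<le> c1" "0 \<le> c2" "c1 \<le> M" and z: "z \<in> {0..T}"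
  shows "\<bar>u1 z - u2 z\<bar> \<le> lip_const M * \<bar>c1 - c2\<bar> * min z (T - z)"
proof -
  let ?D = "\<lambda>z. (\<rho> * (V1 z - V2 z) - (h (u1 z) - h (u2 z)) - c1 * (u1 z - u2 z) - (c1 - c2) * u2 z) / a"
  note D = sol_diff_deriv(2)[OF S1 S2]
  have bd: "\<bar>?D s\<bar> \<le> lip_const M * \<bar>c1 - c2\<bar>" if sT: "s \<in> {0..T}" for s
  proof -
    let ?U = "2 * u_max * T / a * \<bar>c1 - c2\<bar>"
    note 1 = coupling_term_le[OF S2 c(2) sT, of c1]
    have 2: "\<bar>\<rho> * (V1 s - V2 s)\<bar> \<le> \<bar>c1 - c2\<bar> * u_max"
      using sol_V_diff_le[OF S1 S2 c(1,2) sT] sol_V_diff_le[OF S2 S1 c(2,1) sT]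
      by (auto simp: abs_le_iff abs_minus_commute right_diff_distrib)
    have U: "\<bar>u1 s - u2 s\<bar> \<le> ?U"
      using sol_u_diff_le[OF S1 S2 c(1,2) sT] sol_u_diff_le[OF S2 S1 c(2,1) sT] by (auto simp: abs_le_iff abs_minus_commute)
    have 3: "\<bar>h (u1 s) - h (u2 s)\<bar> \<le> \<Lambda> * ?U"
      using h_lip[of "u1 s" "u2 s"] mult_left_mono[OF U pos(4)] by linarith
    have 4: "\<bar>c1 * (u1 s - u2 s)\<bar> \<le> M * ?U"
      unfolding abs_mult using U c by (intro mult_mono) auto
    have "\<bar>?D s\<bar> = \<bar>\<rho> * (V1 s - V2 s) - (h (u1 s) - h (u2 s)) - c1 * (u1 s - u2 s) - (c1 - c2) * u2 s\<bar> / a"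
      using pos by (simp add: abs_divide)
    also have "\<dots> \<le> (\<bar>c1 - c2\<bar> * u_max + \<Lambda> * ?U + M * ?U + \<bar>c1 - c2\<bar> * u_max) / a"
    proof (rule divide_right_mono)
      have *: "\<bar>p - q - r - s\<bar> \<le> \<bar>p\<bar> + \<bar>q\<bar> + \<bar>r\<bar> + \<bar>s\<bar>" for p q r s :: real by linarith
      show "\<bar>\<rho> * (V1 s - V2 s) - (h (u1 s) - h (u2 s)) - c1 * (u1 s - u2 s) - (c1 - c2) * u2 s\<bar>
          \<le> \<bar>c1 - c2\<bar> * u_max + \<Lambda> * ?U + M * ?U + \<bar>c1 - c2\<bar> * u_max"
        by (rule order_trans[OF * add_mono[OF add_mono[OF add_mono[OF 2 3] 4] 1]])
    qed (use pos in simp)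
    also have "\<dots> = lip_const M * \<bar>c1 - c2\<bar>" by (simp add: lip_const_def algebra_simps add_divide_distrib)
    finally show ?thesis .
  qed
  have u0: "u1 0 = 0" "u2 0 = 0" "u1 T = 0" "u2 T = 0" using S1 S2 by (auto simp: hjb_solution_def)
  obtain s where s: "s \<in> {0..z}" "(u1 z - u2 z) - (u1 0 - u2 0) = ?D s * (z - 0)"
    using mean_value_within[of 0 z "{0..T}" "\<lambda>z. u1 z - u2 z" ?D] D z by auto
  obtain t where t: "t \<in> {z..T}" "(u1 T - u2 T) - (u1 z - u2 z) = ?D t * (T - z)"
    using mean_value_within[of z T "{0..T}" "\<lambda>z. u1 z - u2 z" ?D] D z by auto
  have "\<bar>u1 z - u2 z\<bar> = \<bar>?D s\<bar> * z" using s u0 z by (simp add: abs_mult)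
  also have "\<dots> \<le> lip_const M * \<bar>c1 - c2\<bar> * z" using bd[of s] s z by (intro mult_right_mono) auto
  finally have A: "\<bar>u1 z - u2 z\<bar> \<le> lip_const M * \<bar>c1 - c2\<bar> * z" .
  have "u1 z - u2 z = - (?D t * (T - z))" using t(2) u0 by simp
  then have "\<bar>u1 z - u2 z\<bar> = \<bar>?D t\<bar> * (T - z)" using z by (simp add: abs_mult)
  also have "\<dots> \<le> lip_const M * \<bar>c1 - c2\<bar> * (T - z)" using bd[of t] t z by (intro mult_right_mono) auto
  finally show ?thesis using A by (auto simp: min_def)
qed

text \<open>Shooting: the final slope \<open>u T\<close> depends continuously on the initial value \<open>V 0\<close> and changes
  sign.\<close>

lemma sol_exists:
  assumes c: "0 \<le> c" obtains V u where "sol c V u"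
proof -
  define F where "F = (\<lambda>t (x :: real \<times> real). (snd x, (\<rho> * fst x - h (snd x) - c * snd x - f t) / a))"
  define \<Lambda>' where "\<Lambda>' = 1 + (\<rho> + \<Lambda> + c) / a"
  have \<Lambda>': "0 \<le> \<Lambda>'" using pos c by (simp add: \<Lambda>'_def)
  have ch: "continuous_on UNIV h"
    by (rule lipschitz_on_continuous_on[of \<Lambda>]) (auto intro!: lipschitz_onI simp: dist_real_def h_lip pos)
  have cF: "continuous_on ({0..T} \<times> UNIV) (\<lambda>(t, x). F t x)"
    unfolding F_def split_beta using pos
    by (intro continuous_intros continuous_on_compose2[OF ch] continuous_on_compose2[OF f_cont]) auto
  have lF: "norm (F t x - F t y) \<le> \<Lambda>' * norm (x - y)" if "t \<in> {0..T}" for t x y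
  proof -
    define p q where "p = fst x - fst y" and "q = snd x - snd y"
    have pq: "\<bar>p\<bar> \<le> norm (x - y)" "\<bar>q\<bar> \<le> norm (x - y)"
      using norm_fst_le[of "fst (x - y)" "snd (x - y)"] norm_snd_le[of "snd (x - y)" "fst (x - y)"]
      by (simp_all add: p_def q_def del: fst_diff snd_diff flip: fst_diff snd_diff)
    have eq: "F t x - F t y = (q, (\<rho> * p - (h (snd x) - h (snd y)) - c * q) / a)"
      by (simp add: F_def p_def q_def diff_divide_distrib[symmetric] algebra_simps minus_prod_def)
    have "norm (F t x - F t y) \<le> \<bar>q\<bar> + \<bar>(\<rho> * p - (h (snd x) - h (snd y)) - c * q) / a\<bar>"
      unfolding eq using norm_Pair_le[of q "(\<rho> * p - (h (snd x) - h (snd y)) - c * q) / a"] by simp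
    also have "\<bar>(\<rho> * p - (h (snd x) - h (snd y)) - c * q) / a\<bar> = \<bar>\<rho> * p - (h (snd x) - h (snd y)) - c * q\<bar> / a"
      using pos by (simp add: abs_divide)
    also have "\<dots> \<le> (\<rho> * norm (x - y) + \<Lambda> * norm (x - y) + c * norm (x - y)) / a"
    proof (rule divide_right_mono)
      have "\<bar>\<rho> * p\<bar> \<le> \<rho> * norm (x - y)" "\<bar>c * q\<bar> \<le> c * norm (x - y)"
        unfolding abs_mult using pq pos c by (auto intro!: mult_mono)
      moreover have "\<bar>h (snd x) - h (snd y)\<bar> \<le> \<Lambda> * norm (x - y)"
        using h_lip[of "snd x" "snd y"] mult_left_mono[OF pq(2) pos(4)] by (simp add: q_def)
      ultimately show "\<bar>\<rho> * p - (h (snd x) - h (snd y)) - c * q\<bar> \<le> \<rho> * norm (x - y) + \<Lambda> * norm (x - y) + c * norm (x - y)"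
        by linarith
    qed (use pos in simp)
    finally show ?thesis using pq by (simp add: \<Lambda>'_def field_simps)
  qed
  have "\<forall>v. \<exists>X. X 0 = (v, 0) \<and> (\<forall>t\<in>{0..T}. (X has_vector_derivative F t (X t)) (at t within {0..T}))"
    using lipschitz_ivp_exists[of T F \<Lambda>', OF _ cF \<Lambda>' lF] pos by auto
  then obtain X where X0: "\<And>v. X v 0 = (v, 0)"
    and XD: "\<And>v t. t \<in> {0..T} \<Longrightarrow> (X v has_vector_derivative F t (X v t)) (at t within {0..T})"
    by metis
  define VV where "VV = (\<lambda>v t. fst (X v t))"
  define uu where "uu = (\<lambda>v t. snd (X v t))"
  have DV: "(VV v has_real_derivative uu v t) (at t within {0..T})" if "t \<in> {0..T}" for v t
    using bounded_linear.has_vector_derivative[OF bounded_linear_fst XD[OF that, of v]]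
    by (simp add: VV_def uu_def F_def has_real_derivative_iff_has_vector_derivative)
  have Du: "(uu v has_real_derivative (\<rho> * VV v t - h (uu v t) - c * uu v t - f t) / a) (at t within {0..T})" if "t \<in> {0..T}" for v t
    using bounded_linear.has_vector_derivative[OF bounded_linear_snd XD[OF that, of v]]
    by (simp add: VV_def uu_def F_def has_real_derivative_iff_has_vector_derivative)
  have cont: "continuous_on UNIV (\<lambda>v. uu v T)"
  proof (rule lipschitz_on_continuous_on[of "exp (\<Lambda>' * T)"], rule lipschitz_onI)
    fix v w
    have "\<bar>uu v T - uu w T\<bar> \<le> norm (X v T - X w T)"
      unfolding uu_def using norm_snd_le[of "snd (X v T - X w T)" "fst (X v T - X w T)"]
      by (simp del: snd_diff fst_diff flip: snd_diff)
    also have "\<dots> \<le> exp (\<Lambda>' * T) * norm (X v 0 - X w 0)"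
      by (rule lipschitz_ivp_dependence[OF \<Lambda>' lF XD XD]) (use pos in auto)
    also have "norm (X v 0 - X w 0) = dist v w" by (simp add: X0 dist_real_def norm_Pair)
    finally show "dist (uu v T) (uu w T) \<le> exp (\<Lambda>' * T) * dist v w" by (simp add: dist_real_def)
  qed simp
  have mvt: "\<exists>r. 0 \<le> r \<and> r \<le> x \<and> VV v x = v + uu v r * x" if "0 \<le> x" "x \<le> T" for v x
  proof -
    have "(VV v has_real_derivative uu v t) (at t within {0..T})" if "t \<in> {0..x}" for t
      using DV that \<open>x \<le> T\<close> by auto
    then obtain r where "r \<in> {0..x}" "VV v x - VV v 0 = uu v r * (x - 0)"
      by (rule mean_value_within[of 0 x "{0..T}" "VV v" "uu v", rotated 2]) (use \<open>0 \<le> x\<close> \<open>x \<le> T\<close> in auto)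
    then show ?thesis by (auto simp: VV_def X0)
  qed
  \<comment> \<open>From V 0 = - 1, as long as the slope has not been positive, V stays at or below
    - 1; at a zero of the slope its derivative is then negative because f is nonnegative.\<close>
  have low: "uu (- 1) T \<le> 0"
  proof (rule nonpos_if_decreasing_at_zeros[where y = "uu (-1)", OF Du])
    show "uu (- 1) 0 \<le> 0" by (simp add: uu_def X0)
    fix x assume x: "0 \<le> x" "x < T" "uu (- 1) x = 0" "\<And>s. 0 \<le> s \<Longrightarrow> s \<le> x \<Longrightarrow> uu (- 1) s \<le> 0"
    obtain r where r: "0 \<le> r" "r \<le> x" "VV (-1) x = -1 + uu (-1) r * x" using mvt[of x "-1"] x by auto
    have "uu (-1) r * x \<le> 0" using x(4)[of r] r x by (intro mult_nonpos_nonneg) auto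
    then have "\<rho> * VV (-1) x < 0" using r pos by (intro mult_pos_neg) auto
    then show "(\<rho> * VV (- 1) x - h (uu (- 1) x) - c * uu (- 1) x - f x) / a < 0"
      using x f_nonneg[of x] pos h_0 by (simp add: divide_neg_pos)
  qed (use pos in auto)
  \<comment> \<open>Symmetrically, this start satisfies \<rho> V 0 = f T + 1. As long as the slope
    has not been negative, \<rho> V exceeds f, so at a zero the slope increases.\<close>
  define v1 where "v1 = (f T + 1) / \<rho>"
  have v1: "\<rho> * v1 = f T + 1" using pos by (simp add: v1_def)
  have "- uu v1 T \<le> 0"
  proof (rule nonpos_if_decreasing_at_zeros[where y = "\<lambda>t. - uu v1 t", OF DERIV_minus[OF Du]])
    show "- uu v1 0 \<le> 0" by (simp add: uu_def X0)
    fix x assume x: "0 \<le> x" "x < T" "- uu v1 x = 0" "\<And>s. 0 \<le> s \<Longrightarrow> s \<le> x \<Longrightarrow> - uu v1 s \<le> 0"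
    obtain r where r: "0 \<le> r" "r \<le> x" "VV v1 x = v1 + uu v1 r * x" using mvt[of x v1] x by auto
    have "uu v1 r * x \<ge> 0" using x(4)[of r] r x by (intro mult_nonneg_nonneg) auto
    then have "\<rho> * VV v1 x \<ge> \<rho> * v1" using r pos by (intro mult_left_mono) auto
    then have "\<rho> * VV v1 x - f x > 0" using v1 f_mono[of x T] x by simp
    then show "- ((\<rho> * VV v1 x - h (uu v1 x) - c * uu v1 x - f x) / a) < 0"
      using x pos h_0 by simp
  qed (use pos in auto)
  then have high: "0 \<le> uu v1 T" by simp
  have "-1 \<le> v1" using f_nonneg[of T] pos by (simp add: v1_def field_simps)
  then obtain v where v: "uu v T = 0"
    using IVT'[of "\<lambda>v. uu v T" "-1" 0 v1] low high continuous_on_subset[OF cont] by auto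
  have "sol c (VV v) (uu v)"
    unfolding hjb_solution_def using DV Du v by (auto simp: uu_def X0)
  then show ?thesis by (rule that)
qed

end

subsection \<open>Gibbs densities\<close>

lemma powr_mean_value:
  fixes x y \<beta> :: real
  assumes "0 \<le> x" "x < y" "0 < \<beta>"
  obtains \<xi> where "x < \<xi>" "\<xi> < y" "y powr \<beta> - x powr \<beta> = \<beta> * \<xi> powr (\<beta> - 1) * (y - x)"
proof -
  have "continuous_on {x..y} (\<lambda>t. t powr \<beta>)"
    using assms by (intro continuous_on_powr' continuous_intros) auto
  moreover have "((\<lambda>t. t powr \<beta>) has_derivative (*) (\<beta> * t powr (\<beta> - 1))) (at t)" if "x < t" "t < y" for t
    using has_real_derivative_powr[of t \<beta>] that assms by (simp add: has_field_derivative_def)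
  ultimately show ?thesis
    using that mvt[OF assms(2), of "\<lambda>t. t powr \<beta>" "\<lambda>t. (*) (\<beta> * t powr (\<beta> - 1))"] by metis
qed

text \<open>The singular factor is taken at the larger argument. For \<beta> \<le> 1 this rests on x
  y^(\<beta> - 1) \<le> x^\<beta>, which remains true at x = 0; for \<beta> > 1 it is the mean value
  theorem.\<close>

lemma powr_diff_le:
  fixes x y \<beta> :: real
  assumes "0 \<le> x" "x \<le> y" "0 < \<beta>"
  shows "y powr \<beta> - x powr \<beta> \<le> max 1 \<beta> * (y - x) * y powr (\<beta> - 1)"
proof (cases "x < y")
  case True
  then have y: "y > 0" using assms by simp
  have yb: "y * y powr (\<beta> - 1) = y powr \<beta>" using y powr_add[of y 1 "\<beta> - 1"] by simp
  show ?thesis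
  proof (cases "\<beta> \<le> 1")
    case le: True
    have "x * y powr (\<beta> - 1) \<le> x powr \<beta>"
    proof (cases "x = 0")
      case False
      then have x: "x > 0" using assms by simp
      have "y powr (\<beta> - 1) \<le> x powr (\<beta> - 1)" using x assms le by (intro powr_mono2') auto
      then have "x * y powr (\<beta> - 1) \<le> x * x powr (\<beta> - 1)" using x by simp
      also have "\<dots> = x powr \<beta>" using x powr_add[of x 1 "\<beta> - 1"] by simp
      finally show ?thesis .
    qed simp
    then have "y powr \<beta> - x powr \<beta> \<le> (y - x) * y powr (\<beta> - 1)" using yb by (simp add: left_diff_distrib)
    then show ?thesis using le by (simp only: max_absorb1 mult_1)
  next
    case ge: False
    obtain \<xi> where \<xi>: "x < \<xi>" "\<xi> < y" "y powr \<beta> - x powr \<beta> = \<beta> * \<xi> powr (\<beta> - 1) * (y - x)"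
      using powr_mean_value assms True by metis
    have "\<xi> powr (\<beta> - 1) \<le> y powr (\<beta> - 1)" using \<xi> ge assms by (intro powr_mono2) auto
    then have "\<beta> * \<xi> powr (\<beta> - 1) * (y - x) \<le> \<beta> * y powr (\<beta> - 1) * (y - x)"
      using True assms by (intro mult_right_mono mult_left_mono) auto
    then show ?thesis using \<xi> ge by (simp add: max_def ac_simps)
  qed
qed (use assms in auto)

text \<open>The weight \<open>d\<close> is the distance to the boundary: both a boundary-linear lower bound on the
  arguments and a boundary-linear bound on their difference are needed when \<open>\<beta> < 1\<close>.\<close>

lemma powr_diff_le_weighted:
  fixes x y \<beta> :: real
  assumes xy: "0 \<le> x" "x \<le> y" and \<beta>: "0 < \<beta>" and d: "0 \<le> d" "d \<le> T"
    and low: "\<eta> * d \<le> y" "0 < \<eta>" and up: "y \<le> R" and diff: "y - x \<le> k * d" "0 \<le> k"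
  shows "y powr \<beta> - x powr \<beta> \<le> max 1 \<beta> * (T * R powr (\<beta> - 1) + \<eta> powr (\<beta> - 1) * T powr \<beta>) * k"
proof (cases "d = 0")
  case True
  then have "x = y" using xy diff by simp
  then show ?thesis using d diff by simp
next
  case False
  then have d0: "0 < d" using d by simp
  then have y: "0 < y" using low by (smt (verit) mult_pos_pos)
  have T: "0 < T" using d0 d by simp
  \<comment> \<open>The factor d supplied by the difference absorbs the singularity when \<beta>
    \<le> 1; for \<beta> > 1 the bounds d \<le> T and y \<le> R are enough. The sum of both bounds
    gives one constant for all \<beta>.\<close>
  have key: "d * y powr (\<beta> - 1) \<le> T * R powr (\<beta> - 1) + \<eta> powr (\<beta> - 1) * T powr \<beta>"
  proof (cases "\<beta> \<le> 1")
    case True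
    have "y powr (\<beta> - 1) \<le> (\<eta> * d) powr (\<beta> - 1)" using True low d0 by (intro powr_mono2') auto
    then have "d * y powr (\<beta> - 1) \<le> d * (\<eta> * d) powr (\<beta> - 1)" using d0 by simp
    also have "\<dots> = \<eta> powr (\<beta> - 1) * d powr \<beta>"
      using d0 powr_add[of d 1 "\<beta> - 1"] by (simp add: powr_mult)
    also have "\<dots> \<le> \<eta> powr (\<beta> - 1) * T powr \<beta>"
      using d d0 \<beta> by (intro mult_left_mono powr_mono2) auto
    finally show ?thesis using T by (simp add: add_increasing)
  next
    case False
    have "d * y powr (\<beta> - 1) \<le> T * R powr (\<beta> - 1)"
      using False d up y by (intro mult_mono powr_mono2) auto
    then show ?thesis by (simp add: add_increasing2)
  qed
  have "y powr \<beta> - x powr \<beta> \<le> max 1 \<beta> * (y - x) * y powr (\<beta> - 1)" by (rule powr_diff_le[OF xy \<beta>])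
  also have "\<dots> \<le> max 1 \<beta> * (k * d) * y powr (\<beta> - 1)"
    using diff by (intro mult_right_mono mult_left_mono) auto
  also have "\<dots> = max 1 \<beta> * k * (d * y powr (\<beta> - 1))" by simp
  also have "\<dots> \<le> max 1 \<beta> * k * (T * R powr (\<beta> - 1) + \<eta> powr (\<beta> - 1) * T powr \<beta>)"
    using diff by (intro mult_left_mono key) auto
  finally show ?thesis by (simp add: ac_simps)
qed

section \<open>Gibbs densities and their means\<close>

definition gibbs :: "real \<Rightarrow> (real \<Rightarrow> real) \<Rightarrow> real \<Rightarrow> real" where
  "gibbs T b z = exp (integral {0..z} b) / integral {0..T} (\<lambda>z. exp (integral {0..z} b))"

definition gibbs_mean :: "real \<Rightarrow> (real \<Rightarrow> real) \<Rightarrow> real" where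
  "gibbs_mean T b = integral {0..T} (\<lambda>z. z * gibbs T b z)"

lemma continuous_on_exp_integral:
  fixes b :: "real \<Rightarrow> real"
  assumes "continuous_on {0..T} b" shows "continuous_on {0..T} (\<lambda>z. exp (integral {0..z} b))"
  by (intro continuous_intros indefinite_integral_continuous_1 integrable_continuous_real assms)

context
  fixes T :: real and b :: "real \<Rightarrow> real"
  assumes T: "0 < T" and b: "continuous_on {0..T} b" and nn: "\<And>z. z \<in> {0..T} \<Longrightarrow> 0 \<le> b z"
begin

text \<open>A nonnegative drift keeps the exponential at least 1. This lower bound on the
  normalising integral is what makes the quotients below Lipschitz.\<close>

lemma integral_exp_pos:
  shows "T \<le> integral {0..T} (\<lambda>z. exp (integral {0..z} b))"
proof -
  have "integral {0..T} (\<lambda>_. 1) \<le> integral {0..T} (\<lambda>z. exp (integral {0..z} b))"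
  proof (intro integral_le integrable_continuous_real continuous_on_exp_integral b continuous_on_const)
    fix z assume z: "z \<in> {0..T}"
    have "0 \<le> integral {0..z} b"
      using z nn by (intro integral_nonneg integrable_continuous_real continuous_on_subset[OF b]) auto
    then show "1 \<le> exp (integral {0..z} b)" by simp
  qed
  then show ?thesis using T by simp
qed

lemma continuous_on_gibbs:
  shows "continuous_on {0..T} (gibbs T b)"
  unfolding gibbs_def using integral_exp_pos T
  by (intro continuous_on_divide continuous_on_exp_integral b continuous_on_const) auto

lemma gibbs_pos:
  shows "0 < gibbs T b z"
  unfolding gibbs_def using integral_exp_pos T by simp

lemma integral_gibbs:
  shows "integral {0..T} (gibbs T b) = 1"
proof -
  have "integral {0..T} (\<lambda>z. exp (integral {0..z} b) / integral {0..T} (\<lambda>z. exp (integral {0..z} b))) = 1"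
    using integral_exp_pos T by (subst integral_divide) auto
  then show ?thesis by (simp add: gibbs_def[abs_def])
qed

lemma gibbs_mean_bounds:
  shows "0 \<le> gibbs_mean T b" "gibbs_mean T b \<le> T"
proof -
  note c = continuous_on_gibbs and p = gibbs_pos
  show "0 \<le> gibbs_mean T b" unfolding gibbs_mean_def
    using p by (intro integral_nonneg integrable_continuous_real continuous_intros c) (auto simp: less_imp_le)
  have "gibbs_mean T b \<le> integral {0..T} (\<lambda>z. T * gibbs T b z)" unfolding gibbs_mean_def
    using p by (intro integral_le integrable_continuous_real continuous_intros c) (auto simp: less_imp_le)
  then show "gibbs_mean T b \<le> T" using integral_gibbs by simp
qed

end

lemma abs_exp_diff_le:
  fixes x y :: real
  assumes "x \<le> m" "y \<le> m" shows "\<bar>exp x - exp y\<bar> \<le> exp m * \<bar>x - y\<bar>"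
proof -
  have *: "exp v - exp u \<le> exp m * (v - u)" if "u \<le> v" "v \<le> m" for u v :: real
  proof -
    have "exp v * (1 + (u - v)) \<le> exp v * exp (u - v)" by (intro mult_left_mono exp_ge_add_one_self) simp
    also have "\<dots> = exp u" by (simp add: exp_add[symmetric])
    finally have "exp v - exp u \<le> exp v * (v - u)" by (simp add: algebra_simps)
    also have "\<dots> \<le> exp m * (v - u)" using that by (intro mult_right_mono) auto
    finally show ?thesis .
  qed
  show ?thesis
  proof (cases "x \<le> y")
    case True
    then have "exp x \<le> exp y" by simp
    then show ?thesis using *[OF True assms(2)] True by (simp add: abs_if)
  next
    case False
    then have "exp y \<le> exp x" by simp
    then show ?thesis using *[OF _ assms(1), of y] False by (simp add: abs_if)
  qed
qed

text \<open>The mean is a quotient N / Z of integrals of the exponential e b, and the values of e b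
  differ by at most D = exp (m T) d T. Hence Z changes by at most D T and N by at most T D T, while
  Z is at least T.\<close>

lemma gibbs_mean_lipschitz:
  assumes T: "0 < T" and b1: "continuous_on {0..T} b1" "\<And>z. z \<in> {0..T} \<Longrightarrow> 0 \<le> b1 z" "\<And>z. z \<in> {0..T} \<Longrightarrow> b1 z \<le> m"
    and b2: "continuous_on {0..T} b2" "\<And>z. z \<in> {0..T} \<Longrightarrow> 0 \<le> b2 z" "\<And>z. z \<in> {0..T} \<Longrightarrow> b2 z \<le> m"
    and d: "\<And>z. z \<in> {0..T} \<Longrightarrow> \<bar>b1 z - b2 z\<bar> \<le> d"
  shows "\<bar>gibbs_mean T b1 - gibbs_mean T b2\<bar> \<le> 2 * T\<^sup>2 * exp (m * T) * d"
proof -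
  define e :: "(real \<Rightarrow> real) \<Rightarrow> real \<Rightarrow> real" where "e = (\<lambda>b z. exp (integral {0..z} b))"
  define Z where "Z = (\<lambda>b. integral {0..T} (e b))"
  define N where "N = (\<lambda>b. integral {0..T} (\<lambda>z. z * e b z))"
  have mean: "gibbs_mean T b = N b / Z b" for b
    by (simp add: gibbs_mean_def gibbs_def N_def Z_def e_def)
  have ce: "continuous_on {0..T} (e b1)" "continuous_on {0..T} (e b2)"
    unfolding e_def by (intro continuous_on_exp_integral b1 b2)+
  have Z: "T \<le> Z b1" "T \<le> Z b2"
    unfolding Z_def e_def by (intro integral_exp_pos T b1 b2; assumption)+
  define D where "D = exp (m * T) * (d * T)"
  have eD: "\<bar>e b1 z - e b2 z\<bar> \<le> D" if z: "z \<in> {0..T}" for z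
  proof -
    have int: "b1 integrable_on {0..z}" "b2 integrable_on {0..z}"
      using z by (auto intro!: integrable_continuous_real continuous_on_subset[OF b1(1)] continuous_on_subset[OF b2(1)])
    have m0: "0 \<le> m" using b1(2,3)[OF z] by simp
    have d0: "0 \<le> d" using d[OF z] by simp
    have le: "integral {0..z} b \<le> m * T" if "b integrable_on {0..z}" "\<And>s. s \<in> {0..T} \<Longrightarrow> b s \<le> m" for b
    proof -
      have "integral {0..z} b \<le> integral {0..z} (\<lambda>_. m)" using that z by (intro integral_le) auto
      also have "\<dots> \<le> m * T" using z m0 mult_right_mono[of z T m] by (simp add: mult.commute)
      finally show ?thesis .
    qed
    have "\<bar>e b1 z - e b2 z\<bar> \<le> exp (m * T) * \<bar>integral {0..z} b1 - integral {0..z} b2\<bar>"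
      unfolding e_def by (intro abs_exp_diff_le le int b1 b2)
    also have "integral {0..z} b1 - integral {0..z} b2 = integral {0..z} (\<lambda>s. b1 s - b2 s)"
      using int by (simp add: Henstock_Kurzweil_Integration.integral_diff)
    also have "\<bar>integral {0..z} (\<lambda>s. b1 s - b2 s)\<bar> \<le> integral {0..z} (\<lambda>_. d)"
      using integral_norm_bound_integral[of "\<lambda>s. b1 s - b2 s" "{0..z}" "\<lambda>_. d"] int d z by (auto intro: integrable_diff)
    also have "\<dots> \<le> d * T" using z d0 mult_right_mono[of z T d] by (simp add: mult.commute)
    finally show ?thesis by (simp add: D_def)
  qed
  have D0: "0 \<le> D" using eD[of 0] T by (smt (verit) atLeastAtMost_iff)
  have Zd: "\<bar>Z b1 - Z b2\<bar> \<le> D * T"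
  proof -
    have "Z b1 - Z b2 = integral {0..T} (\<lambda>z. e b1 z - e b2 z)"
      unfolding Z_def using ce by (simp add: Henstock_Kurzweil_Integration.integral_diff integrable_continuous_real)
    also have "\<bar>\<dots>\<bar> \<le> integral {0..T} (\<lambda>_. D)"
      using integral_norm_bound_integral[OF integrable_continuous_real[OF continuous_on_diff[OF ce]] integrable_const_ivl[of D]] eD
      by auto
    also have "\<dots> = D * T" using T by simp
    finally show ?thesis .
  qed
  have Nd: "\<bar>N b1 - N b2\<bar> \<le> T * D * T"
  proof -
    have cz: "continuous_on {0..T} (\<lambda>z. z * e b1 z)" "continuous_on {0..T} (\<lambda>z. z * e b2 z)"
      by (intro continuous_intros ce)+
    have "N b1 - N b2 = integral {0..T} (\<lambda>z. z * e b1 z - z * e b2 z)"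
      unfolding N_def using cz by (simp add: Henstock_Kurzweil_Integration.integral_diff integrable_continuous_real)
    also have "\<bar>\<dots>\<bar> \<le> integral {0..T} (\<lambda>_. T * D)"
    proof -
      have "\<bar>z * e b1 z - z * e b2 z\<bar> \<le> T * D" if "z \<in> {0..T}" for z
        unfolding right_diff_distrib[symmetric] abs_mult using that eD[OF that] by (intro mult_mono) auto
      then show ?thesis
        using integral_norm_bound_integral[OF integrable_continuous_real[OF continuous_on_diff[OF cz]] integrable_const_ivl[of "T * D"]]
        by auto
    qed
    also have "\<dots> = T * D * T" using T by simp
    finally show ?thesis .
  qed
  have q: "0 \<le> N b2 / Z b2" "N b2 / Z b2 \<le> T"
    using gibbs_mean_bounds[OF T b2(1,2)] by (auto simp: mean)
  \<comment> \<open>Arranged so that the only division is by Z b1 \<ge> T and the factor N b2 / Z b2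
    is itself a mean, hence at most T.\<close>
  have "N b1 / Z b1 - N b2 / Z b2 = ((N b1 - N b2) - N b2 / Z b2 * (Z b1 - Z b2)) / Z b1"
    using Z T by (simp add: field_simps)
  then have "\<bar>gibbs_mean T b1 - gibbs_mean T b2\<bar> = \<bar>(N b1 - N b2) - N b2 / Z b2 * (Z b1 - Z b2)\<bar> / Z b1"
    using Z T by (simp add: mean abs_divide)
  also have "\<dots> \<le> (T * D * T + T * (D * T)) / Z b1"
  proof (rule divide_right_mono)
    have "\<bar>N b2 / Z b2 * (Z b1 - Z b2)\<bar> \<le> T * (D * T)"
      unfolding abs_mult using q Zd T by (intro mult_mono) auto
    then show "\<bar>(N b1 - N b2) - N b2 / Z b2 * (Z b1 - Z b2)\<bar> \<le> T * D * T + T * (D * T)"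
      using Nd by linarith
  qed (use Z T in simp)
  also have "\<dots> \<le> (T * D * T + T * (D * T)) / T"
    using Z T D0 by (intro divide_left_mono) auto
  also have "\<dots> = 2 * T\<^sup>2 * exp (m * T) * d"
    using T by (simp add: D_def power2_eq_square field_simps)
  finally show ?thesis .
qed

subsection \<open>The decoupled system\<close>

locale innovation_mfg =
  fixes \<sigma> \<rho> w \<alpha> \<gamma> B zb :: real
  assumes params: "0 < \<sigma>" "0 < \<rho>" "0 < w" "0 < B" "0 < zb" "0 < \<alpha>" "\<alpha> < 1" "0 < \<gamma>" "\<gamma> < 1"
begin

definition diffusion :: real where
  "diffusion = \<sigma>\<^sup>2 / 2"

definition revenue :: "real \<Rightarrow> real" where
  "revenue z = z powr \<alpha> / B powr (\<alpha> - 1)"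

definition innov_ham :: "real \<Rightarrow> real" where
  "innov_ham \<mu> = (1 - \<gamma>) * (\<gamma> / w) powr (\<gamma> / (1 - \<gamma>)) * max 0 \<mu> powr (1 / (1 - \<gamma>))"

definition innov_rate :: "real \<Rightarrow> real" where
  "innov_rate \<mu> = (\<gamma> / w * max 0 \<mu>) powr (\<gamma> / (1 - \<gamma>))"

abbreviation "vf_solution \<equiv> hjb_solution diffusion \<rho> zb innov_ham revenue"

text \<open>The logarithmic derivative of the stationary density: vanishing flux means m' = growth
  m.\<close>

definition growth :: "real \<Rightarrow> (real \<Rightarrow> real) \<Rightarrow> real \<Rightarrow> real" where
  "growth c u z = (innov_rate (u z) + c) / diffusion"

lemma diffusion_pos: "0 < diffusion"
  using params by (simp add: diffusion_def)

lemma innov_ham_deriv: "(innov_ham has_real_derivative innov_rate \<mu>) (at \<mu>)"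
  \<comment> \<open>With L = 0 the spillover is an empty sum, and z = 0 makes the revenue vanish,
    which leaves the innovation part alone.\<close>
  using hamiltonian_has_deriv[of w \<gamma> \<alpha> B zb 0 undefined undefined undefined 0 undefined \<mu>] params
  by (simp add: hamiltonian_def hamiltonian_deriv_def spillover_def innov_ham_def[abs_def] innov_rate_def)

lemma innov_rate_nonneg: "0 \<le> innov_rate \<mu>"
  by (simp add: innov_rate_def)

lemma innov_rate_mono: "x \<le> y \<Longrightarrow> innov_rate x \<le> innov_rate y"
  unfolding innov_rate_def using params by (intro powr_mono2 mult_left_mono) (auto simp: max_def)

lemma continuous_on_innov_rate: "continuous_on S innov_rate"
  unfolding innov_rate_def using params
  by (intro continuous_on_powr' continuous_intros) auto

lemma innov_ham_diff:
  assumes "x \<le> y" obtains \<xi> where "x \<le> \<xi>" "\<xi> \<le> y" "innov_ham y - innov_ham x = innov_rate \<xi> * (y - x)"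
proof (rule mean_value_within[of x y UNIV innov_ham innov_rate])
  show "(innov_ham has_real_derivative innov_rate z) (at z)" for z by (rule innov_ham_deriv)
next
  fix \<xi> assume "\<xi> \<in> {x..y}" "innov_ham y - innov_ham x = innov_rate \<xi> * (y - x)"
  then show thesis by (intro that[of \<xi>]) auto
qed (use assms in auto)

section \<open>Growth of the revenue and truncation of the Hamiltonian\<close>

text \<open>The derivative of the revenue at zb, which is its smallest value on the interval because
  the revenue is concave.\<close>

definition revenue_slope :: real where
  "revenue_slope = \<alpha> * zb powr (\<alpha> - 1) / B powr (\<alpha> - 1)"

lemma revenue_incr:
  assumes "0 \<le> x" "x \<le> y" "y \<le> zb"
  shows "revenue_slope * (y - x) \<le> revenue y - revenue x"
proof (cases "x < y")
  case True
  obtain \<xi> where \<xi>: "x < \<xi>" "\<xi> < y" "y powr \<alpha> - x powr \<alpha> = \<alpha> * \<xi> powr (\<alpha> - 1) * (y - x)"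
    using powr_mean_value[of x y \<alpha>] True assms params by metis
  have "zb powr (\<alpha> - 1) \<le> \<xi> powr (\<alpha> - 1)" using \<xi> assms params by (intro powr_mono2') auto
  then have "\<alpha> * zb powr (\<alpha> - 1) * (y - x) \<le> y powr \<alpha> - x powr \<alpha>"
    unfolding \<xi>(3) using params True by (intro mult_right_mono mult_left_mono) auto
  then have "\<alpha> * zb powr (\<alpha> - 1) * (y - x) / B powr (\<alpha> - 1) \<le> (y powr \<alpha> - x powr \<alpha>) / B powr (\<alpha> - 1)"
    by (rule divide_right_mono) simp
  then show ?thesis by (simp add: revenue_slope_def revenue_def diff_divide_distrib)
qed (use assms in auto)

lemma continuous_on_revenue: "continuous_on {0..zb} revenue"
  unfolding revenue_def using params by (intro continuous_on_divide continuous_on_powr' continuous_intros) auto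

text \<open>Cutting the argument at R leaves a monotone function whose slope never exceeds the
  derivative of the Hamiltonian at R; for negative arguments the Hamiltonian vanishes
  anyway.\<close>

lemma hjb_truncated:
  assumes R: "0 \<le> R"
  shows "hjb diffusion \<rho> zb (innov_rate R) revenue_slope (\<lambda>x. innov_ham (min x R)) revenue"
proof
  show "0 < diffusion" "0 < \<rho>" "0 < zb" "0 \<le> innov_rate R" "0 < revenue_slope"
    using diffusion_pos params innov_rate_nonneg by (auto simp: revenue_slope_def)
  have mono: "innov_ham x \<le> innov_ham y" if "x \<le> y" for x y
  proof -
    obtain \<xi> where "innov_ham y - innov_ham x = innov_rate \<xi> * (y - x)" using innov_ham_diff[OF \<open>x \<le> y\<close>] by metis
    then show ?thesis using mult_nonneg_nonneg[OF innov_rate_nonneg[of \<xi>], of "y - x"] that by simp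
  qed
  show "innov_ham (min x R) \<le> innov_ham (min y R)" if "x \<le> y" for x y
    using that by (intro mono) auto
  show "innov_ham (min 0 R) = 0" using R params by (simp add: innov_ham_def)
  have lip: "\<bar>innov_ham y - innov_ham x\<bar> \<le> innov_rate R * (y - x)" if "x \<le> y" "y \<le> R" for x y
  proof -
    obtain \<xi> where \<xi>: "\<xi> \<le> y" "innov_ham y - innov_ham x = innov_rate \<xi> * (y - x)"
      using innov_ham_diff[OF \<open>x \<le> y\<close>] by metis
    have "innov_rate \<xi> \<le> innov_rate R" using \<xi> that by (intro innov_rate_mono) auto
    then show ?thesis unfolding \<xi>(2) using that innov_rate_nonneg[of \<xi>] by (simp add: abs_mult mult_right_mono)
  qed
  show "\<bar>innov_ham (min x R) - innov_ham (min y R)\<bar> \<le> innov_rate R * \<bar>x - y\<bar>" for x y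
  proof -
    have "\<bar>innov_ham (min x R) - innov_ham (min y R)\<bar> \<le> innov_rate R * \<bar>min x R - min y R\<bar>"
      using lip[of "min x R" "min y R"] lip[of "min y R" "min x R"] by (cases "x \<le> y") (auto simp: abs_minus_commute)
    also have "\<dots> \<le> innov_rate R * \<bar>x - y\<bar>"
      by (intro mult_left_mono innov_rate_nonneg) (auto simp: min_def)
    finally show ?thesis .
  qed
  show "continuous_on {0..zb} revenue" by (rule continuous_on_revenue)
  show "0 \<le> revenue 0" by (simp add: revenue_def)
  show "revenue_slope * (y - x) \<le> revenue y - revenue x" if "0 \<le> x" "x \<le> y" "y \<le> zb" for x y
    using that by (rule revenue_incr)
qed

text \<open>The bound \<open>u_max\<close> of the locale \<open>hjb\<close>. Since it is the same
  for every truncation level, truncating at exactly this level does not change the equation along a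
  solution.\<close>

definition slope_max :: real where
  "slope_max = zb * revenue zb / diffusion"

lemma slope_max_nonneg: "0 \<le> slope_max"
  using params diffusion_pos by (auto simp: slope_max_def revenue_def)

lemma truncated_iff:
  assumes "\<And>z. z \<in> {0..zb} \<Longrightarrow> u z \<le> R"
  shows "hjb_solution diffusion \<rho> zb (\<lambda>x. innov_ham (min x R)) revenue c V u \<longleftrightarrow> vf_solution c V u"
  using assms by (auto simp: hjb_solution_def min_absorb1)

lemmas vf_continuous = hjb_solution_continuous[of diffusion \<rho> zb innov_ham revenue]

text \<open>A given solution is first truncated at a level R taken from the supremum of its own
  slope, where the cut is invisible. The bounds of \<open>hjb\<close> then apply and replace R by
  the universal level \<open>slope_max\<close>.\<close>

lemma vf_truncated:
  assumes S: "vf_solution c V u" and c: "0 \<le> c"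
  shows "\<And>z. z \<in> {0..zb} \<Longrightarrow> 0 \<le> u z" "\<And>z. z \<in> {0..zb} \<Longrightarrow> u z \<le> slope_max"
    "hjb_solution diffusion \<rho> zb (\<lambda>x. innov_ham (min x slope_max)) revenue c V u"
proof -
  have "bounded (u ` {0..zb})"
    by (intro compact_imp_bounded compact_continuous_image vf_continuous(2)[OF S]) simp
  then obtain R0 where R0: "\<And>z. z \<in> {0..zb} \<Longrightarrow> \<bar>u z\<bar> \<le> R0" unfolding bounded_iff by fastforce
  define R where "R = max 0 R0"
  have R: "0 \<le> R" "\<And>z. z \<in> {0..zb} \<Longrightarrow> u z \<le> R" using R0 by (fastforce simp: R_def)+
  interpret hjb diffusion \<rho> zb "innov_rate R" revenue_slope "\<lambda>x. innov_ham (min x R)" revenue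
    by (rule hjb_truncated[OF R(1)])
  have S': "sol c V u" using truncated_iff[OF R(2)] S by simp
  show "\<And>z. z \<in> {0..zb} \<Longrightarrow> 0 \<le> u z" by (rule sol_u_nonneg[OF S' c])
  show *: "\<And>z. z \<in> {0..zb} \<Longrightarrow> u z \<le> slope_max" unfolding slope_max_def by (rule sol_u_le[OF S' c])
  show "hjb_solution diffusion \<rho> zb (\<lambda>x. innov_ham (min x slope_max)) revenue c V u"
    using truncated_iff[OF *] S by simp
qed

lemma vf_exists:
  assumes "0 \<le> c" shows "\<exists>V u. vf_solution c V u"
proof -
  interpret hjb diffusion \<rho> zb "innov_rate slope_max" revenue_slope "\<lambda>x. innov_ham (min x slope_max)" revenue
    by (rule hjb_truncated[OF slope_max_nonneg])
  obtain V u where S: "sol c V u" using sol_exists[OF assms] by blast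
  have "vf_solution c V u"
    using truncated_iff[of u slope_max] sol_u_le[OF S assms] S by (simp add: slope_max_def)
  then show ?thesis by blast
qed

lemma vf_unique:
  assumes S: "vf_solution c V1 u1" "vf_solution c V2 u2" and c: "0 \<le> c" and z: "z \<in> {0..zb}"
  shows "V1 z = V2 z" "u1 z = u2 z"
proof -
  interpret hjb diffusion \<rho> zb "innov_rate slope_max" revenue_slope "\<lambda>x. innov_ham (min x slope_max)" revenue
    by (rule hjb_truncated[OF slope_max_nonneg])
  show "V1 z = V2 z" "u1 z = u2 z"
    using sol_unique[OF vf_truncated(3)[OF S(1) c] vf_truncated(3)[OF S(2) c] c z] by auto
qed

section \<open>Lipschitz constants of the innovation rate and of the mean\<close>

text \<open>Half the value of \<epsilon> at which the smallness condition of
  \<open>sol_lower_barrier\<close> fails for c = M; it therefore serves all c \<le> M.\<close>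

definition barrier_coeff :: "real \<Rightarrow> real" where
  "barrier_coeff M = revenue_slope / (2 * (2 * diffusion + \<rho> * zb\<^sup>2 + (innov_rate slope_max + M) * zb))"

text \<open>The constant of \<open>powr_diff_le_weighted\<close> for the weight d = min z (zb - z).
  The factor zb / 2 in \<eta> converts the parabola into a multiple of d, and k is the boundary
  Lipschitz constant of the slope.\<close>

definition rate_lip :: "real \<Rightarrow> real" where
  "rate_lip M = (let \<beta> = \<gamma> / (1 - \<gamma>); \<eta> = barrier_coeff M * (zb / 2);
       k = hjb.lip_const diffusion zb (innov_rate slope_max) revenue M
     in (\<gamma> / w) powr \<beta> * (max 1 \<beta> * (zb * slope_max powr (\<beta> - 1) + \<eta> powr (\<beta> - 1) * zb powr \<beta>) * k))"

text \<open>Only the larger of the two slopes has to be bounded below, since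
  \<open>powr_diff_le_weighted\<close> places the singular factor there. So it suffices to treat u2
  z \<le> u1 z, and the other case follows by exchanging the solutions.\<close>

lemma innov_rate_lipschitz:
  assumes M: "0 \<le> M"
  shows "0 \<le> rate_lip M"
    and "vf_solution c1 V1 u1 \<Longrightarrow> vf_solution c2 V2 u2 \<Longrightarrow> 0 \<le> c1 \<Longrightarrow> c1 \<le> M \<Longrightarrow> 0 \<le> c2 \<Longrightarrow> c2 \<le> M \<Longrightarrow>
      z \<in> {0..zb} \<Longrightarrow> \<bar>innov_rate (u1 z) - innov_rate (u2 z)\<bar> \<le> rate_lip M * \<bar>c1 - c2\<bar>"
proof -
  interpret hjb diffusion \<rho> zb "innov_rate slope_max" revenue_slope "\<lambda>x. innov_ham (min x slope_max)" revenue
    by (rule hjb_truncated[OF slope_max_nonneg])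
  define \<beta> where "\<beta> = \<gamma> / (1 - \<gamma>)"
  have \<beta>: "0 < \<beta>" using params by (simp add: \<beta>_def)
  define q where "q = 2 * diffusion + \<rho> * zb\<^sup>2 + (innov_rate slope_max + M) * zb"
  have q: "0 < q" using pos M by (auto simp: q_def intro!: add_pos_nonneg)
  define \<epsilon> where "\<epsilon> = revenue_slope / (2 * q)"
  have \<epsilon>: "0 < \<epsilon>" using pos q by (simp add: \<epsilon>_def)
  have small: "\<epsilon> * (2 * diffusion + \<rho> * zb\<^sup>2 + (innov_rate slope_max + c) * zb) < revenue_slope" if "c \<le> M" for c
  proof -
    have "2 * diffusion + \<rho> * zb\<^sup>2 + (innov_rate slope_max + c) * zb \<le> q"
      unfolding q_def using that pos by (intro add_left_mono mult_right_mono) auto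
    then have "\<epsilon> * (2 * diffusion + \<rho> * zb\<^sup>2 + (innov_rate slope_max + c) * zb) \<le> \<epsilon> * q"
      using \<epsilon> by simp
    also have "\<dots> < revenue_slope" using pos q by (simp add: \<epsilon>_def)
    finally show ?thesis .
  qed
  define \<eta> where "\<eta> = \<epsilon> * (zb / 2)"
  have \<eta>: "0 < \<eta>" using \<epsilon> pos by (simp add: \<eta>_def)
  define k where "k = lip_const M"
  have k: "0 \<le> k" unfolding k_def lip_const_def
    using pos M u_max_nonneg f_nonneg[of zb] by (intro divide_nonneg_nonneg add_nonneg_nonneg mult_nonneg_nonneg) auto
  define K where "K = (\<gamma> / w) powr \<beta> * (max 1 \<beta> * (zb * slope_max powr (\<beta> - 1) + \<eta> powr (\<beta> - 1) * zb powr \<beta>) * k)"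
  have K: "rate_lip M = K"
    by (simp only: rate_lip_def barrier_coeff_def K_def \<beta>_def \<eta>_def \<epsilon>_def q_def k_def Let_def)
  have rate: "innov_rate x = (\<gamma> / w) powr \<beta> * x powr \<beta>" if "0 \<le> x" for x
    using that by (simp add: innov_rate_def \<beta>_def powr_mult[symmetric])
  have half: "innov_rate (u1 z) - innov_rate (u2 z) \<le> K * \<bar>c1 - c2\<bar>"
    if S1: "vf_solution c1 V1 u1" and S2: "vf_solution c2 V2 u2" and c: "0 \<le> c1" "c1 \<le> M" "0 \<le> c2" "c2 \<le> M"
      and z: "z \<in> {0..zb}" and le: "u2 z \<le> u1 z" for c1 c2 V1 V2 u1 u2 z
  proof -
    note t1 = vf_truncated[OF S1 c(1)] and t2 = vf_truncated[OF S2 c(3)]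
    define d where "d = min z (zb - z)"
    have d: "0 \<le> d" "d \<le> zb" using z by (auto simp: d_def)
    \<comment> \<open>The larger of z and zb - z is at least zb / 2, while their product is the
      parabola of the barrier.\<close>
    have "d * (zb / 2) \<le> d * max z (zb - z)" using d by (intro mult_left_mono) (auto simp: max_def)
    also have "\<dots> = z * (zb - z)" by (simp add: d_def min_def max_def)
    finally have "d * (zb / 2) \<le> z * (zb - z)" .
    then have "\<epsilon> * (d * (zb / 2)) \<le> \<epsilon> * (z * (zb - z))" using \<epsilon> by (intro mult_left_mono) auto
    also have "\<dots> \<le> u1 z" using sol_lower_barrier[OF t1(3) c(1) _ small[OF c(2)] z] \<epsilon> by (simp add: mult.assoc)
    finally have low: "\<eta> * d \<le> u1 z" by (simp add: \<eta>_def ac_simps)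
    have "\<bar>u1 z - u2 z\<bar> \<le> k * \<bar>c1 - c2\<bar> * d"
      unfolding k_def d_def by (rule sol_u_lipschitz_boundary[OF t1(3) t2(3) c(1,3,2) z])
    then have diff: "u1 z - u2 z \<le> (k * \<bar>c1 - c2\<bar>) * d" by simp
    have "u1 z powr \<beta> - u2 z powr \<beta> \<le> max 1 \<beta> * (zb * slope_max powr (\<beta> - 1) + \<eta> powr (\<beta> - 1) * zb powr \<beta>) * (k * \<bar>c1 - c2\<bar>)"
      by (rule powr_diff_le_weighted[OF t2(1)[OF z] le \<beta> d low \<eta> t1(2)[OF z] diff]) (use k in simp)
    then have "(\<gamma> / w) powr \<beta> * (u1 z powr \<beta> - u2 z powr \<beta>) \<le> (\<gamma> / w) powr \<beta> *
        (max 1 \<beta> * (zb * slope_max powr (\<beta> - 1) + \<eta> powr (\<beta> - 1) * zb powr \<beta>) * (k * \<bar>c1 - c2\<bar>))"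
      by (rule mult_left_mono) simp
    then show ?thesis using rate[OF t1(1)[OF z]] rate[OF t2(1)[OF z]]
      by (simp add: K_def right_diff_distrib mult.assoc)
  qed
  show "0 \<le> rate_lip M" unfolding K K_def using k pos by (intro mult_nonneg_nonneg add_nonneg_nonneg) auto
  assume *: "vf_solution c1 V1 u1" "vf_solution c2 V2 u2" "0 \<le> c1" "c1 \<le> M" "0 \<le> c2" "c2 \<le> M" "z \<in> {0..zb}"
  show "\<bar>innov_rate (u1 z) - innov_rate (u2 z)\<bar> \<le> rate_lip M * \<bar>c1 - c2\<bar>"
  proof (cases "u2 z \<le> u1 z")
    case True
    then show ?thesis using half[OF *(1-6,7) True] innov_rate_mono[OF True] by (simp add: K)
  next
    case False
    then have le: "u1 z \<le> u2 z" by simp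
    show ?thesis using half[OF *(2,1,5,6,3,4,7) le] innov_rate_mono[OF le] by (simp add: K abs_minus_commute)
  qed
qed

lemma growth_facts:
  assumes S: "vf_solution c V u" and c: "0 \<le> c"
  shows "continuous_on {0..zb} (growth c u)" "\<And>z. 0 \<le> growth c u z"
    "\<And>z. z \<in> {0..zb} \<Longrightarrow> growth c u z \<le> (innov_rate slope_max + c) / diffusion"
proof -
  show "continuous_on {0..zb} (growth c u)" unfolding growth_def using diffusion_pos
    by (intro continuous_intros continuous_on_compose2[OF continuous_on_innov_rate] vf_continuous(2)[OF S]) auto
  show "\<And>z. 0 \<le> growth c u z" unfolding growth_def
    using c diffusion_pos innov_rate_nonneg by (simp add: add_nonneg_nonneg)
  show "\<And>z. z \<in> {0..zb} \<Longrightarrow> growth c u z \<le> (innov_rate slope_max + c) / diffusion" unfolding growth_def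
    using vf_truncated(2)[OF S c] diffusion_pos by (intro divide_right_mono add_right_mono innov_rate_mono) auto
qed

text \<open>The constant of \<open>gibbs_mean_lipschitz\<close>: the exponent contains the bound on
  \<open>growth\<close> for c \<le> M, and the last factor is the Lipschitz constant of
  \<open>growth\<close> in c, whose summand 1 comes from the explicit occurrence of c. Beyond the
  parameters of the model only M enters.\<close>

definition mean_lip :: "real \<Rightarrow> real" where
  "mean_lip M = 2 * zb\<^sup>2 * exp ((innov_rate slope_max + M) / diffusion * zb) * ((rate_lip M + 1) / diffusion)"

lemma mean_lip_nonneg: "0 \<le> M \<Longrightarrow> 0 \<le> mean_lip M"
  using innov_rate_lipschitz(1)[of M] diffusion_pos by (simp add: mean_lip_def)

lemma mean_lipschitz:
  assumes S: "vf_solution c1 V1 u1" "vf_solution c2 V2 u2" and c: "0 \<le> c1" "c1 \<le> M" "0 \<le> c2" "c2 \<le> M"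
  shows "\<bar>gibbs_mean zb (growth c1 u1) - gibbs_mean zb (growth c2 u2)\<bar> \<le> mean_lip M * \<bar>c1 - c2\<bar>"
proof -
  have M: "0 \<le> M" using c by simp
  define m where "m = (innov_rate slope_max + M) / diffusion"
  define K0 where "K0 = rate_lip M"
  have le: "growth c u z \<le> m" if "vf_solution c V u" "0 \<le> c" "c \<le> M" "z \<in> {0..zb}" for c V u z
  proof -
    have "(innov_rate slope_max + c) / diffusion \<le> m"
      unfolding m_def using that diffusion_pos by (intro divide_right_mono) auto
    then show ?thesis using growth_facts(3)[OF that(1,2,4)] by linarith
  qed
  have "\<bar>growth c1 u1 z - growth c2 u2 z\<bar> \<le> (K0 + 1) / diffusion * \<bar>c1 - c2\<bar>" if z: "z \<in> {0..zb}" for z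
  proof -
    have "growth c1 u1 z - growth c2 u2 z = ((innov_rate (u1 z) - innov_rate (u2 z)) + (c1 - c2)) / diffusion"
      by (simp add: growth_def diff_divide_distrib[symmetric])
    then have "\<bar>growth c1 u1 z - growth c2 u2 z\<bar> = \<bar>(innov_rate (u1 z) - innov_rate (u2 z)) + (c1 - c2)\<bar> / diffusion"
      using diffusion_pos by (simp add: abs_divide)
    also have "\<dots> \<le> (K0 * \<bar>c1 - c2\<bar> + \<bar>c1 - c2\<bar>) / diffusion"
    proof (rule divide_right_mono)
      show "\<bar>(innov_rate (u1 z) - innov_rate (u2 z)) + (c1 - c2)\<bar> \<le> K0 * \<bar>c1 - c2\<bar> + \<bar>c1 - c2\<bar>"
        using innov_rate_lipschitz(2)[OF M S c z] by (simp add: K0_def)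
    qed (use diffusion_pos in simp)
    finally show ?thesis by (simp add: algebra_simps)
  qed
  from gibbs_mean_lipschitz[OF params(5) growth_facts(1,2)[OF S(1) c(1)] le[OF S(1) c(1,2)]
      growth_facts(1,2)[OF S(2) c(3)] le[OF S(2) c(3,4)] this]
  show ?thesis by (simp add: mean_lip_def m_def K0_def ac_simps)
qed

subsection \<open>Weak solutions and fixed points\<close>

abbreviation "\<Omega> \<equiv> {0<..<zb}"

lemma hamiltonian_eq:
  "hamiltonian w \<alpha> \<gamma> B zb L A p l z m \<mu> = innov_ham \<mu> + \<mu> * spillover zb L A p l m + revenue z"
  by (simp add: hamiltonian_def innov_ham_def revenue_def)

lemma hamiltonian_deriv_eq:
  "hamiltonian_deriv w \<gamma> zb L A p l m \<mu> = innov_rate \<mu> + spillover zb L A p l m"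
  by (simp add: hamiltonian_deriv_def innov_rate_def)

text \<open>With a number c in place of the spillover, the equations for different l no longer see
  each other; the coupling survives only in the choice of these numbers.\<close>

definition weak_value :: "real \<Rightarrow> (real \<Rightarrow> real) \<Rightarrow> bool" where
  "weak_value c V \<longleftrightarrow>
     (let dV = weak_deriv \<Omega> V; H = (\<lambda>z. innov_ham (dV z) + dV z * c + revenue z)
      in V \<in> H1_on \<Omega> \<and> continuous_on \<Omega> V \<and> set_integrable lebesgue \<Omega> H \<and>
         (\<forall>\<phi>. smooth \<phi> \<longrightarrow>
           (LINT z:\<Omega>|lebesgue. diffusion * dV z * deriv \<phi> z + \<rho> * V z * \<phi> z - H z * \<phi> z) = 0))"

definition weak_density :: "real \<Rightarrow> (real \<Rightarrow> real) \<Rightarrow> (real \<Rightarrow> real) \<Rightarrow> bool" where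
  "weak_density c V m \<longleftrightarrow>
     (let b = (\<lambda>z. innov_rate (weak_deriv \<Omega> V z) + c)
      in m \<in> H1_on \<Omega> \<and> continuous_on \<Omega> m \<and> (\<forall>z\<in>\<Omega>. 0 < m z) \<and>
         set_integrable lebesgue \<Omega> (\<lambda>z. b z * m z) \<and>
         (\<forall>\<phi>. smooth \<phi> \<longrightarrow>
           (LINT z:\<Omega>|lebesgue. (diffusion * weak_deriv \<Omega> m z - b z * m z) * deriv \<phi> z) = 0) \<and>
         (LINT z:\<Omega>|lebesgue. m z) = 1)"

lemma mfg_solution_iff:
  "mfg_solution \<sigma> \<rho> w \<alpha> \<gamma> B zb L A p m V \<longleftrightarrow>
    (\<forall>l\<in>{1..L}. weak_value (spillover zb L A p l m) (V l) \<and> weak_density (spillover zb L A p l m) (V l) (m l))"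
  unfolding mfg_solution_def Let_def hamiltonian_eq hamiltonian_deriv_eq weak_value_def weak_density_def
    diffusion_def by (rule ball_cong) (simp_all only: conj_ac simp_thms, blast?)

definition fixed_point ::
  "nat \<Rightarrow> (nat \<Rightarrow> real) \<Rightarrow> (nat \<Rightarrow> nat \<Rightarrow> real) \<Rightarrow> (nat \<Rightarrow> real) \<Rightarrow> (nat \<Rightarrow> real \<Rightarrow> real) \<Rightarrow>
    (nat \<Rightarrow> real \<Rightarrow> real) \<Rightarrow> bool" where
  "fixed_point L A p c V u \<longleftrightarrow>
     (\<forall>l\<in>{1..L}. 0 \<le> c l \<and> vf_solution (c l) (V l) (u l) \<and>
        c l = (\<Sum>l'=1..L. A l' * p l l' * gibbs_mean zb (growth (c l') (u l'))))"

section \<open>From fixed points to weak solutions\<close>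

lemma continuous_on_innov_ham: "continuous_on S innov_ham"
  using innov_ham_deriv by (meson DERIV_isCont continuous_at_imp_continuous_on)

lemma vf_rhs_continuous:
  assumes "continuous_on {0..zb} u"
  shows "continuous_on {0..zb} (\<lambda>z. innov_ham (u z) + u z * c + revenue z)"
  by (intro continuous_intros continuous_on_compose2[OF continuous_on_innov_ham] continuous_on_revenue assms) auto

lemma vf_solution_H1:
  assumes S: "vf_solution c V u"
  shows "V \<in> H1_on \<Omega>" "AE z in lebesgue. z \<in> \<Omega> \<longrightarrow> weak_deriv \<Omega> V z = u z"
proof -
  have "(V has_real_derivative u z) (at z)" if "z \<in> \<Omega>" for z
  proof -
    have "(V has_real_derivative u z) (at z within {0..zb})" using S that by (auto simp: hjb_solution_def)
    then show ?thesis using at_within_interior[of z "{0..zb}"] that by simp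
  qed
  then show "V \<in> H1_on \<Omega>" "AE z in lebesgue. z \<in> \<Omega> \<longrightarrow> weak_deriv \<Omega> V z = u z"
    using classical_H1_on[OF params(5) vf_continuous[OF S]] by auto
qed

lemma vf_classical_imp_weak:
  assumes S: "vf_solution c V u" shows "weak_value c V"
proof -
  define dV where "dV = weak_deriv \<Omega> V"
  have ae: "AE z in lebesgue. z \<in> \<Omega> \<longrightarrow> dV z = u z" unfolding dV_def by (rule vf_solution_H1(2)[OF S])
  note cV = vf_continuous(1)[OF S] and cu = vf_continuous(2)[OF S]
  have int: "set_integrable lebesgue \<Omega> (\<lambda>z. innov_ham (dV z) + dV z * c + revenue z)"
    by (rule set_integral_spike(1)[OF continuous_set_integrable_interior(1)[OF vf_rhs_continuous[OF cu]]])
      (use ae in auto)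
  have "(LINT z:\<Omega>|lebesgue. diffusion * dV z * deriv \<phi> z + \<rho> * V z * \<phi> z
        - (innov_ham (dV z) + dV z * c + revenue z) * \<phi> z) = 0" if \<phi>: "smooth \<phi>" for \<phi>
  proof -
    note c\<phi> = smooth_imp_continuous_on[OF \<phi>] smooth_imp_continuous_on[OF smooth_deriv[OF \<phi>]]
    let ?f = "\<lambda>z. diffusion * u z * deriv \<phi> z + \<rho> * V z * \<phi> z - (innov_ham (u z) + u z * c + revenue z) * \<phi> z"
    have cf: "continuous_on {0..zb} ?f"
      by (intro continuous_intros cV cu c\<phi> continuous_on_compose2[OF continuous_on_innov_ham] continuous_on_revenue) auto
    \<comment> \<open>The integrand is the derivative of diffusion u \<phi>. Its boundary terms
      vanish because the slope is 0 at both ends, whatever the boundary values of \<phi>.\<close>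
    have "(?f has_integral diffusion * u zb * \<phi> zb - diffusion * u 0 * \<phi> 0) {0..zb}"
    proof (rule fundamental_theorem_of_calculus)
      fix z assume z: "z \<in> {0..zb}"
      have "((\<lambda>z. diffusion * u z * \<phi> z) has_real_derivative
          diffusion * u z * deriv \<phi> z + diffusion * ((\<rho> * V z - innov_ham (u z) - c * u z - revenue z) / diffusion) * \<phi> z) (at z within {0..zb})"
        using S z by (intro DERIV_mult' DERIV_cmult has_field_derivative_at_within[OF smooth_imp_DERIV[OF \<phi>]])
          (auto simp: hjb_solution_def)
      moreover have "diffusion * u z * deriv \<phi> z + diffusion * ((\<rho> * V z - innov_ham (u z) - c * u z - revenue z) / diffusion) * \<phi> z = ?f z"
      proof -
        have "diffusion * (X / diffusion) = X" for X using diffusion_pos by simp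
        then show ?thesis by (simp only:) (simp add: algebra_simps)
      qed
      ultimately show "((\<lambda>z. diffusion * u z * \<phi> z) has_vector_derivative ?f z) (at z within {0..zb})"
        by (simp only: has_real_derivative_iff_has_vector_derivative)
    qed (use params in simp)
    moreover have "u zb = 0" "u 0 = 0" using S by (auto simp: hjb_solution_def)
    ultimately have "integral {0..zb} ?f = 0" by (simp add: integral_unique)
    moreover have "(LINT z:\<Omega>|lebesgue. diffusion * dV z * deriv \<phi> z + \<rho> * V z * \<phi> z
        - (innov_ham (dV z) + dV z * c + revenue z) * \<phi> z) = (LINT z:\<Omega>|lebesgue. ?f z)"
      by (rule set_integral_spike(2)[OF continuous_set_integrable_interior(1)[OF cf]]) (use ae in auto)
    ultimately show ?thesis by (simp add: continuous_set_integrable_interior(2)[OF cf])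
  qed
  moreover have "continuous_on \<Omega> V" by (rule continuous_on_subset[OF cV]) auto
  ultimately show ?thesis
    using int vf_solution_H1(1)[OF S] by (auto simp: weak_value_def Let_def dV_def)
qed

lemma gibbs_H1:
  assumes T: "0 < T" and b: "continuous_on {0..T} b" and nn: "\<And>z. 0 \<le> b z"
  shows "gibbs T b \<in> H1_on {0<..<T}"
    "AE z in lebesgue. z \<in> {0<..<T} \<longrightarrow> weak_deriv {0<..<T} (gibbs T b) z = b z * gibbs T b z"
proof -
  have cg: "continuous_on {0..T} (gibbs T b)" by (rule continuous_on_gibbs[OF T b nn])
  have "(gibbs T b has_real_derivative b z * gibbs T b z) (at z)" if z: "z \<in> {0<..<T}" for z
  proof -
    have "((\<lambda>z. integral {0..z} b) has_real_derivative b z) (at z within {0..T})"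
      using z by (intro integral_has_real_derivative[OF b]) auto
    then have "((\<lambda>z. integral {0..z} b) has_real_derivative b z) (at z)"
      using at_within_interior[of z "{0..T}"] z by simp
    from DERIV_cdivide[OF DERIV_fun_exp[OF this]] show ?thesis
      by (simp add: gibbs_def[abs_def] mult.commute)
  qed
  then show "gibbs T b \<in> H1_on {0<..<T}"
    "AE z in lebesgue. z \<in> {0<..<T} \<longrightarrow> weak_deriv {0<..<T} (gibbs T b) z = b z * gibbs T b z"
    using classical_H1_on[OF T cg continuous_on_mult[OF b cg]] by auto
qed

lemma spillover_cong:
  assumes "\<And>l' z. l' \<in> {1..L} \<Longrightarrow> z \<in> \<Omega> \<Longrightarrow> m l' z = m' l' z"
  shows "spillover zb L A p l m = spillover zb L A p l m'"
  unfolding spillover_def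
proof (intro sum.cong refl arg_cong2[where f = "(*)"])
  fix l' assume "l' \<in> {1..L}"
  then show "(LINT z:\<Omega>|lebesgue. z * m l' z) = (LINT z:\<Omega>|lebesgue. z * m' l' z)"
    using assms by (intro set_lebesgue_integral_cong) auto
qed

lemma LINT_gibbs_mean:
  assumes "continuous_on {0..zb} b" "\<And>z. 0 \<le> b z"
  shows "(LINT z:\<Omega>|lebesgue. z * gibbs zb b z) = gibbs_mean zb b"
  unfolding gibbs_mean_def using params assms
  by (intro continuous_set_integrable_interior(2) continuous_intros continuous_on_gibbs) auto

text \<open>The flux vanishes almost everywhere, not just after integration, so the weak equation
  holds for every test function.\<close>

lemma gibbs_weak_density:
  assumes S: "vf_solution c V u" and c: "0 \<le> c"
  shows "weak_density c V (gibbs zb (growth c u))"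
proof -
  define m where "m = gibbs zb (growth c u)"
  note g = growth_facts(1,2)[OF S c]
  note m1 = gibbs_H1[OF params(5) g, folded m_def]
  have cg: "continuous_on {0..zb} m" unfolding m_def by (rule continuous_on_gibbs[OF params(5) g])
  have flux: "AE z in lebesgue. z \<in> \<Omega> \<longrightarrow>
      (innov_rate (weak_deriv \<Omega> V z) + c) * m z = diffusion * (growth c u z * m z)"
    using vf_solution_H1(2)[OF S] by eventually_elim (use diffusion_pos in \<open>auto simp: growth_def\<close>)
  have "set_integrable lebesgue \<Omega> (\<lambda>z. diffusion * (growth c u z * m z))"
    by (intro continuous_set_integrable_interior(1) continuous_intros g cg)
  from set_integral_spike(1)[OF this flux]
  have int: "set_integrable lebesgue \<Omega> (\<lambda>z. (innov_rate (weak_deriv \<Omega> V z) + c) * m z)" .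
  have "AE z in lebesgue. z \<in> \<Omega> \<longrightarrow>
      (diffusion * weak_deriv \<Omega> m z - (innov_rate (weak_deriv \<Omega> V z) + c) * m z) * deriv \<phi> z = 0" for \<phi>
    using flux m1(2) by eventually_elim (auto simp: mult.assoc)
  then have zero: "(LINT z:\<Omega>|lebesgue.
      (diffusion * weak_deriv \<Omega> m z - (innov_rate (weak_deriv \<Omega> V z) + c) * m z) * deriv \<phi> z) = 0" for \<phi>
    using set_integral_spike(2)[of \<Omega> "\<lambda>_. 0"] by (simp add: set_integrable_def)
  have one: "(LINT z:\<Omega>|lebesgue. m z) = 1"
    unfolding continuous_set_integrable_interior(2)[OF cg] unfolding m_def by (rule integral_gibbs[OF params(5) g])
  have pos: "\<forall>z\<in>\<Omega>. 0 < m z" using gibbs_pos[OF params(5) g] by (simp add: m_def)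
  have "continuous_on \<Omega> m" by (rule continuous_on_subset[OF cg]) auto
  then show ?thesis unfolding m_def[symmetric] weak_density_def Let_def
    by (intro conjI allI impI m1(1) pos int zero one)
qed

lemma fixed_point_imp_solution:
  assumes "fixed_point L A p c V u"
  shows "mfg_solution \<sigma> \<rho> w \<alpha> \<gamma> B zb L A p (\<lambda>l. gibbs zb (growth (c l) (u l))) V"
proof -
  let ?m = "\<lambda>l. gibbs zb (growth (c l) (u l))"
  have S: "vf_solution (c l) (V l) (u l)" and c: "0 \<le> c l"
    and fp: "c l = (\<Sum>l'=1..L. A l' * p l l' * gibbs_mean zb (growth (c l') (u l')))" if "l \<in> {1..L}" for l
    using assms that unfolding fixed_point_def by blast+
  have "spillover zb L A p l ?m = c l" if "l \<in> {1..L}" for l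
    unfolding fp[OF that] spillover_def using growth_facts[OF S c]
    by (intro sum.cong refl) (simp add: LINT_gibbs_mean)
  then show ?thesis
    unfolding mfg_solution_iff using vf_classical_imp_weak[OF S] gibbs_weak_density[OF S c] by simp
qed

section \<open>From weak solutions to fixed points\<close>

text \<open>Bootstrapping: the weak derivative equals almost everywhere the primitive u of an
  integrable r, so it has a continuous version and V extends to a continuously differentiable
  \<open>V'\<close> on the closed interval. Inserting u into the equation shows that r has the
  continuous version \<open>rc\<close>, hence u is differentiable with derivative \<open>rc\<close>
  up to the ends.\<close>

lemma vf_weak_imp_classical:
  assumes weak: "weak_value c V"
  shows "\<exists>V' u. vf_solution c V' u \<and> (\<forall>z\<in>\<Omega>. V z = V' z) \<and>
    (AE z in lebesgue. z \<in> \<Omega> \<longrightarrow> weak_deriv \<Omega> V z = u z)"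
proof -
  have H1: "V \<in> H1_on \<Omega>" and cV: "continuous_on \<Omega> V"
    using weak by (simp_all add: weak_value_def Let_def)
  note wd = weak_deriv_spec[OF H1]
  define d where "d = weak_deriv \<Omega> V"
  have d: "set_integrable lebesgue \<Omega> d" unfolding d_def by (rule L2_on_imp_set_integrable[OF wd(1)])
  have V: "set_integrable lebesgue \<Omega> V" using H1 by (intro L2_on_imp_set_integrable) (simp add: H1_on_def)
  define r where "r = (\<lambda>z. (\<rho> * V z - (innov_ham (d z) + d z * c + revenue z)) / diffusion)"
  have r: "set_integrable lebesgue \<Omega> r"
    unfolding r_def using V by (intro set_integrable_divide set_integral_diff(1) set_integrable_mult_right)
      (use weak in \<open>simp_all add: d_def weak_value_def Let_def\<close>)
  have t: "(LINT z:\<Omega>|lebesgue. d z * deriv \<phi> z + r z * \<phi> z) = 0" if "smooth \<phi>" for \<phi>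
  proof -
    have "diffusion * (LINT z:\<Omega>|lebesgue. d z * deriv \<phi> z + r z * \<phi> z)
        = (LINT z:\<Omega>|lebesgue. diffusion * (d z * deriv \<phi> z + r z * \<phi> z))" by simp
    also have "\<dots> = (LINT z:\<Omega>|lebesgue. diffusion * d z * deriv \<phi> z + \<rho> * V z * \<phi> z
        - (innov_ham (d z) + d z * c + revenue z) * \<phi> z)"
    proof (intro set_lebesgue_integral_cong allI impI)
      fix z
      have "diffusion * r z = \<rho> * V z - (innov_ham (d z) + d z * c + revenue z)"
        using diffusion_pos by (simp add: r_def)
      then show "diffusion * (d z * deriv \<phi> z + r z * \<phi> z) = diffusion * d z * deriv \<phi> z + \<rho> * V z * \<phi> z
        - (innov_ham (d z) + d z * c + revenue z) * \<phi> z"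
        by (simp add: distrib_left left_diff_distrib flip: mult.assoc)
    qed simp
    also have "\<dots> = 0" using weak that by (simp add: d_def weak_value_def Let_def)
    finally show ?thesis using diffusion_pos by simp
  qed
  define u where "u = (\<lambda>z. integral {0..z} r)"
  have uT: "u zb = 0" and du: "AE z in lebesgue. z \<in> \<Omega> \<longrightarrow> d z = u z"
    using weak_neumann_imp_primitive[OF params(5) d r t] by (auto simp: u_def)
  have cu: "continuous_on {0..zb} u"
    unfolding u_def using set_lebesgue_integral_eq_integral(1)[OF r]
    by (intro indefinite_integral_continuous_1) (simp add: integrable_on_open_interval_real)
  obtain k where k: "\<And>z. z \<in> \<Omega> \<Longrightarrow> V z = k + integral {0..z} d"
    using weak_deriv_imp_primitive[OF params(5) cV wd(2)] d unfolding d_def by metis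
  define V' where "V' = (\<lambda>z. k + integral {0..z} u)"
  have VV: "V z = V' z" if z: "z \<in> \<Omega>" for z
    using k[OF z] integral_cong_AE_continuous[OF du cu, of z] z by (simp add: V'_def)
  have DV': "(V' has_real_derivative u z) (at z within {0..zb})" if "z \<in> {0..zb}" for z
    unfolding V'_def using integral_has_real_derivative[OF cu that] by (auto intro!: derivative_eq_intros)
  have cV': "continuous_on {0..zb} V'" using DV' by (rule DERIV_continuous_on)
  define rc where "rc = (\<lambda>z. (\<rho> * V' z - innov_ham (u z) - c * u z - revenue z) / diffusion)"
  have crc: "continuous_on {0..zb} rc" unfolding rc_def using diffusion_pos
    by (intro continuous_intros continuous_on_compose2[OF continuous_on_innov_ham] continuous_on_revenue cu cV') auto
  have "AE z in lebesgue. z \<in> \<Omega> \<longrightarrow> r z = rc z"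
    using du by eventually_elim (auto simp: r_def rc_def VV algebra_simps)
  then have u_rc: "u z = integral {0..z} rc" if "z \<in> {0..zb}" for z
    unfolding u_def using crc that by (rule integral_cong_AE_continuous)
  have Du: "(u has_real_derivative rc z) (at z within {0..zb})" if z: "z \<in> {0..zb}" for z
    by (rule has_field_derivative_transform_within[OF integral_has_real_derivative[OF crc z] zero_less_one z])
      (simp add: u_rc)
  have "vf_solution c V' u"
    unfolding hjb_solution_def using DV' Du uT by (auto simp: rc_def u_def)
  then show ?thesis using VV du unfolding d_def by blast
qed

text \<open>Derivatives of test functions are arbitrary smooth functions, so the flux is zero rather
  than merely constant. The resulting linear equation m' = b m is solved by an integrating factor,
  and unit mass fixes the remaining constant k.\<close>

lemma density_weak_imp_gibbs:
  assumes S: "vf_solution c V' u" and c: "0 \<le> c" and ae: "AE z in lebesgue. z \<in> \<Omega> \<longrightarrow> weak_deriv \<Omega> V z = u z"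
    and weak: "weak_density c V m" and z: "z \<in> \<Omega>"
  shows "m z = gibbs zb (growth c u) z"
proof -
  define dV where "dV = weak_deriv \<Omega> V"
  have H1: "m \<in> H1_on \<Omega>" and cm: "continuous_on \<Omega> m"
    and int: "set_integrable lebesgue \<Omega> (\<lambda>z. (innov_rate (dV z) + c) * m z)"
    and one: "(LINT z:\<Omega>|lebesgue. m z) = 1"
    using weak by (simp_all add: weak_density_def Let_def dV_def)
  note g = growth_facts(1,2)[OF S c]
  note wd = weak_deriv_spec[OF H1]
  define b where "b = growth c u"
  have cb: "continuous_on {0..zb} b" unfolding b_def by (rule g)
  define d where "d = weak_deriv \<Omega> m"
  have d: "set_integrable lebesgue \<Omega> d" unfolding d_def by (rule L2_on_imp_set_integrable[OF wd(1)])
  \<comment> \<open>The zero-order term r is 0 here, so the flux is the primitive of 0.\<close>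
  have "AE z in lebesgue. z \<in> \<Omega> \<longrightarrow> diffusion * d z - (innov_rate (dV z) + c) * m z = integral {0..z} (\<lambda>_. 0)"
  proof (rule weak_neumann_imp_primitive(2)[OF params(5)])
    show "set_integrable lebesgue \<Omega> (\<lambda>z. diffusion * d z - (innov_rate (dV z) + c) * m z)"
      using d int by (intro set_integral_diff(1) set_integrable_mult_right)
    show "set_integrable lebesgue \<Omega> (\<lambda>_. 0 :: real)" by (simp add: set_integrable_def)
  qed (use weak in \<open>simp add: d_def weak_density_def Let_def dV_def\<close>)
  then have dm: "AE z in lebesgue. z \<in> \<Omega> \<longrightarrow> d z = b z * m z"
    using ae by eventually_elim (use diffusion_pos in \<open>auto simp: b_def growth_def dV_def field_simps\<close>)
  obtain k where k: "\<And>z. z \<in> \<Omega> \<Longrightarrow> m z = k + integral {0..z} d"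
    using weak_deriv_imp_primitive[OF params(5) cm wd(2)] d unfolding d_def by metis
  define M where "M = (\<lambda>z. k + integral {0..z} d)"
  have cM: "continuous_on {0..zb} M"
    unfolding M_def using set_lebesgue_integral_eq_integral(1)[OF d]
    by (intro continuous_intros indefinite_integral_continuous_1) (simp add: integrable_on_open_interval_real)
  have cbM: "continuous_on {0..zb} (\<lambda>z. b z * M z)" by (intro continuous_intros cb cM)
  have mM: "m z = M z" if "z \<in> \<Omega>" for z using k[OF that] by (simp add: M_def)
  have "AE z in lebesgue. z \<in> \<Omega> \<longrightarrow> d z = b z * M z"
    using dm by eventually_elim (auto simp: mM)
  from integral_cong_AE_continuous[OF this cbM]
  have M: "M z = k + integral {0..z} (\<lambda>z. b z * M z)" if "z \<in> {0..zb}" for z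
    using fun_cong[OF M_def, of z] that by simp
  define E where "E = (\<lambda>z. exp (integral {0..z} b))"
  have DM: "(M has_real_derivative b z * M z) (at z within {0..zb})" if z: "z \<in> {0..zb}" for z
  proof -
    have "((\<lambda>z. k + integral {0..z} (\<lambda>z. b z * M z)) has_real_derivative b z * M z) (at z within {0..zb})"
      using integral_has_real_derivative[OF cbM z] by (auto intro!: derivative_eq_intros)
    then show ?thesis
      by (rule has_field_derivative_transform_within[OF _ zero_less_one z]) (rule M[symmetric])
  qed
  have ME: "M z = k * E z" if z: "z \<in> {0..zb}" for z
  proof -
    have D: "((\<lambda>z. M z * exp (- integral {0..z} b)) has_real_derivative 0) (at z within {0..zb})" if z: "z \<in> {0..zb}" for z
      using DM[OF z] integral_has_real_derivative[OF cb z]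
      by (auto intro!: derivative_eq_intros simp: algebra_simps)
    obtain C where C: "\<forall>z\<in>{0..zb}. M z * exp (- integral {0..z} b) = C"
      using has_field_derivative_zero_constant[OF _ D] by auto
    have "M z * exp (- integral {0..z} b) = M 0 * exp (- integral {0..0} b)"
      using bspec[OF C z] bspec[OF C, of 0] params by simp
    then have "M z * exp (- integral {0..z} b) = k" by (simp add: M_def)
    then have "M z * (exp (- integral {0..z} b) * E z) = k * E z" by (simp flip: mult.assoc)
    then show ?thesis by (simp add: E_def exp_add[symmetric])
  qed
  have "1 = (LINT z:\<Omega>|lebesgue. M z)"
    unfolding one[symmetric] by (intro set_lebesgue_integral_cong) (auto simp: mM)
  also have "\<dots> = integral {0..zb} M" by (rule continuous_set_integrable_interior(2)[OF cM])
  also have "\<dots> = integral {0..zb} (\<lambda>z. k * E z)" by (rule Henstock_Kurzweil_Integration.integral_cong) (rule ME)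
  finally have "1 = k * integral {0..zb} E" by simp
  then have "k = 1 / integral {0..zb} E" by (metis mult_zero_right nonzero_eq_divide_eq zero_neq_one)
  moreover have "m z = k * E z" using ME[of z] mM[of z] z by simp
  ultimately show ?thesis by (simp add: gibbs_def E_def b_def)
qed

text \<open>A probability density on \<Omega> has its mean between 0 and zb. This makes every
  spillover nonnegative, as the scalar theory requires, and bounds it by a row of PA.\<close>

lemma solution_imp_fixed_point:
  assumes net: "network_data L A p" and sol: "mfg_solution \<sigma> \<rho> w \<alpha> \<gamma> B zb L A p m V"
  obtains c V' u where "fixed_point L A p c V' u" "\<forall>l\<in>{1..L}. c l \<le> zb * mat_vec L p A l"
    "\<forall>l\<in>{1..L}. \<forall>z\<in>\<Omega>. V l z = V' l z \<and> m l z = gibbs zb (growth (c l) (u l)) z"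
proof -
  define c where "c = (\<lambda>l. spillover zb L A p l m)"
  have A: "\<And>l. l \<in> {1..L} \<Longrightarrow> 0 \<le> A l" and p: "\<And>l l'. l \<in> {1..L} \<Longrightarrow> l' \<in> {1..L} \<Longrightarrow> 0 \<le> p l l'"
    using net by (auto simp: network_data_def less_imp_le)
  have weak: "weak_value (c l) (V l)" "weak_density (c l) (V l) (m l)" if "l \<in> {1..L}" for l
    using sol that by (auto simp: mfg_solution_iff c_def)
  have S: "m l \<in> H1_on \<Omega>" "\<forall>z\<in>\<Omega>. 0 < m l z" "(LINT z:\<Omega>|lebesgue. m l z) = 1" if "l \<in> {1..L}" for l
    using weak(2)[OF that] by (simp_all add: weak_density_def Let_def)
  have mean: "0 \<le> (LINT z:\<Omega>|lebesgue. z * m l z)" "(LINT z:\<Omega>|lebesgue. z * m l z) \<le> zb" if l: "l \<in> {1..L}" for l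
  proof -
    have mi: "set_integrable lebesgue \<Omega> (m l)"
      using S(1)[OF l] by (intro L2_on_imp_set_integrable) (simp add: H1_on_def)
    have zmi: "set_integrable lebesgue \<Omega> (\<lambda>z. m l z * z)"
      by (rule set_integrable_mult_continuous[OF mi _ _ continuous_on_id[of "{0..zb}"]]) auto
    show "0 \<le> (LINT z:\<Omega>|lebesgue. z * m l z)"
      unfolding set_lebesgue_integral_def
      by (rule Bochner_Integration.integral_nonneg) (use S(2)[OF l] in \<open>auto simp: indicator_def less_imp_le\<close>)
    have "(LINT z:\<Omega>|lebesgue. z * m l z) \<le> (LINT z:\<Omega>|lebesgue. zb * m l z)"
    proof (rule set_integral_mono)
      show "set_integrable lebesgue \<Omega> (\<lambda>z. z * m l z)" using zmi by (simp add: mult.commute)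
      show "set_integrable lebesgue \<Omega> (\<lambda>z. zb * m l z)" using mi by (rule set_integrable_mult_right)
      show "z * m l z \<le> zb * m l z" if "z \<in> \<Omega>" for z
        using that S(2)[OF l] by (intro mult_right_mono) (auto simp: less_imp_le)
    qed
    then show "(LINT z:\<Omega>|lebesgue. z * m l z) \<le> zb" using S(3)[OF l] by simp
  qed
  have c0: "0 \<le> c l" if l: "l \<in> {1..L}" for l
    unfolding c_def spillover_def using A p mean l by (intro sum_nonneg mult_nonneg_nonneg) auto
  have cM: "c l \<le> zb * mat_vec L p A l" if l: "l \<in> {1..L}" for l
  proof -
    have "c l \<le> (\<Sum>l'=1..L. A l' * p l l' * zb)"
      unfolding c_def spillover_def using A p mean l by (intro sum_mono mult_left_mono) auto
    then show ?thesis by (simp add: mat_vec_def sum_distrib_left ac_simps)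
  qed
  have "\<forall>l\<in>{1..L}. \<exists>V' u. vf_solution (c l) V' u \<and> (\<forall>z\<in>\<Omega>. V l z = V' z) \<and>
      (AE z in lebesgue. z \<in> \<Omega> \<longrightarrow> weak_deriv \<Omega> (V l) z = u z)"
    by (intro ballI vf_weak_imp_classical weak)
  from bchoice[OF this] obtain V' where "\<forall>l\<in>{1..L}. \<exists>u. vf_solution (c l) (V' l) u \<and> (\<forall>z\<in>\<Omega>. V l z = V' l z) \<and>
      (AE z in lebesgue. z \<in> \<Omega> \<longrightarrow> weak_deriv \<Omega> (V l) z = u z)" by (elim exE)
  from bchoice[OF this] obtain u where "\<forall>l\<in>{1..L}. vf_solution (c l) (V' l) (u l) \<and> (\<forall>z\<in>\<Omega>. V l z = V' l z) \<and>
      (AE z in lebesgue. z \<in> \<Omega> \<longrightarrow> weak_deriv \<Omega> (V l) z = u l z)" by (elim exE)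
  then have vf: "vf_solution (c l) (V' l) (u l)" and V: "\<forall>z\<in>\<Omega>. V l z = V' l z"
    and ae: "AE z in lebesgue. z \<in> \<Omega> \<longrightarrow> weak_deriv \<Omega> (V l) z = u l z" if "l \<in> {1..L}" for l
    using that by blast+
  have mg: "m l z = gibbs zb (growth (c l) (u l)) z" if l: "l \<in> {1..L}" and z: "z \<in> \<Omega>" for l z
    by (rule density_weak_imp_gibbs[OF vf[OF l] c0[OF l] ae[OF l] weak(2)[OF l] z])
  have fp: "c l = (\<Sum>l'=1..L. A l' * p l l' * gibbs_mean zb (growth (c l') (u l')))" for l
  proof -
    have "c l = spillover zb L A p l (\<lambda>l'. gibbs zb (growth (c l') (u l')))"
      unfolding c_def by (rule spillover_cong) (use mg in \<open>simp add: c_def\<close>)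
    then show ?thesis
      unfolding spillover_def using growth_facts(1,2)[OF vf c0] by (simp add: LINT_gibbs_mean)
  qed
  have "fixed_point L A p c V' u" unfolding fixed_point_def by (intro ballI conjI c0 vf fp)
  then show ?thesis by (rule that) (use cM V mg in blast)+
qed

section \<open>Existence and uniqueness\<close>

text \<open>Brouwer is applied to the means divided by zb instead of the spillovers. The means
  always lie in [0, zb], so the unit box is mapped to itself however large the network weights
  are.\<close>

lemma mfg_exists:
  assumes net: "network_data L A p"
  shows "\<exists>m V. mfg_solution \<sigma> \<rho> w \<alpha> \<gamma> B zb L A p m V"
proof -
  have A: "\<And>l. l \<in> {1..L} \<Longrightarrow> 0 \<le> A l" and p: "\<And>l l'. l \<in> {1..L} \<Longrightarrow> l' \<in> {1..L} \<Longrightarrow> 0 \<le> p l l'"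
    using net by (auto simp: network_data_def less_imp_le)
  have "\<forall>c. \<exists>Vu. 0 \<le> c \<longrightarrow> vf_solution c (fst Vu) (snd Vu)"
    using vf_exists by (metis fst_conv snd_conv)
  then obtain Vu where Vu: "\<And>c. 0 \<le> c \<Longrightarrow> vf_solution c (fst (Vu c)) (snd (Vu c))" by metis
  define E where "E = (\<lambda>c. gibbs_mean zb (growth c (snd (Vu c))))"
  have E: "0 \<le> E c" "E c \<le> zb" if "0 \<le> c" for c
    unfolding E_def using gibbs_mean_bounds[OF params(5) growth_facts(1,2)[OF Vu[OF that] that]] by auto
  define W where "W = (\<lambda>l l'. A l' * p l l')"
  have W: "0 \<le> W l l'" if "l \<in> {1..L}" "l' \<in> {1..L}" for l l' using A p that by (simp add: W_def)
  define T where "T = (\<Sum>l=1..L. \<Sum>l'=1..L. W l l')"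
  have T0: "0 \<le> T" unfolding T_def by (intro sum_nonneg W)
  have rowT: "(\<Sum>l'=1..L. W l l') \<le> T" if "l \<in> {1..L}" for l
    unfolding T_def using that by (intro member_le_sum) (auto intro!: sum_nonneg W)
  \<comment> \<open>Bounds every spillover that can arise from means in [0, zb]; the Lipschitz
    constant of the mean is only available on a bounded range of c.\<close>
  define M where "M = T * zb"
  have M: "0 \<le> M" using T0 params by (simp add: M_def)
  define K where "K = mean_lip M"
  have K: "0 \<le> K" "\<And>c1 c2. 0 \<le> c1 \<Longrightarrow> c1 \<le> M \<Longrightarrow> 0 \<le> c2 \<Longrightarrow> c2 \<le> M \<Longrightarrow> \<bar>E c1 - E c2\<bar> \<le> K * \<bar>c1 - c2\<bar>"
    unfolding K_def E_def by (rule mean_lip_nonneg[OF M], rule mean_lipschitz[OF Vu Vu])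
  \<comment> \<open>Coordinate i of the box belongs to sector i + 1, since the box is indexed from 0
    and the sectors from 1.\<close>
  define cc where "cc = (\<lambda>x l. \<Sum>l'=1..L. W l l' * (zb * x (l' - 1)))"
  define F where "F = (\<lambda>x i. E (cc x (Suc i)) / zb)"
  define Q where "Q = {x :: nat \<Rightarrow> real. \<forall>i<L. 0 \<le> x i \<and> x i \<le> 1}"
  have cc: "0 \<le> cc x l" "cc x l \<le> M" if x: "x \<in> Q" and l: "l \<in> {1..L}" for x l
  proof -
    have xb: "0 \<le> x (l' - 1)" "x (l' - 1) \<le> 1" if "l' \<in> {1..L}" for l'
      using x that by (auto simp: Q_def)
    show "0 \<le> cc x l" unfolding cc_def using W l xb params by (intro sum_nonneg mult_nonneg_nonneg) auto
    have "cc x l \<le> (\<Sum>l'=1..L. W l l' * zb)"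
      unfolding cc_def using W l xb params by (intro sum_mono mult_left_mono) auto
    also have "\<dots> = (\<Sum>l'=1..L. W l l') * zb" by (simp add: sum_distrib_right)
    also have "\<dots> \<le> M" unfolding M_def using rowT[OF l] params by (intro mult_right_mono) auto
    finally show "cc x l \<le> M" .
  qed
  obtain x where x: "x \<in> Q" "\<And>i. i < L \<Longrightarrow> F x i = x i"
  proof (rule brouwer_unit_box[OF Q_def, of F "K * T"])
    show "0 \<le> F x i \<and> F x i \<le> 1" if "x \<in> Q" "i < L" for x i
      using E[OF cc(1)[OF that(1), of "Suc i"]] that params by (auto simp: F_def)
    show "0 \<le> K * T" using K T0 by simp
    fix x y :: "nat \<Rightarrow> real" and i d
    assume xy: "x \<in> Q" "y \<in> Q" "i < L" "\<And>j. j < L \<Longrightarrow> \<bar>x j - y j\<bar> \<le> d"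
    have l: "Suc i \<in> {1..L}" using xy by auto
    have d0: "0 \<le> d" using xy(4)[OF xy(3)] by simp
    have "\<bar>cc x (Suc i) - cc y (Suc i)\<bar> = \<bar>\<Sum>l'=1..L. W (Suc i) l' * (zb * (x (l' - 1) - y (l' - 1)))\<bar>"
      by (simp add: cc_def sum_subtractf[symmetric] right_diff_distrib)
    also have "\<dots> \<le> (\<Sum>l'=1..L. W (Suc i) l' * (zb * d))"
    proof (rule order_trans[OF sum_abs sum_mono])
      fix l' assume l': "l' \<in> {1..L}"
      have "\<bar>x (l' - 1) - y (l' - 1)\<bar> \<le> d" using l' by (intro xy(4)) auto
      then show "\<bar>W (Suc i) l' * (zb * (x (l' - 1) - y (l' - 1)))\<bar> \<le> W (Suc i) l' * (zb * d)"
        using W[OF l l'] params by (simp add: abs_mult mult_left_mono)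
    qed
    also have "\<dots> = (\<Sum>l'=1..L. W (Suc i) l') * (zb * d)" by (simp add: sum_distrib_right)
    also have "\<dots> \<le> T * (zb * d)" using rowT[OF l] params d0 by (intro mult_right_mono) auto
    finally have "\<bar>cc x (Suc i) - cc y (Suc i)\<bar> \<le> T * (zb * d)" .
    then have "K * \<bar>cc x (Suc i) - cc y (Suc i)\<bar> \<le> K * (T * (zb * d))" using K by (intro mult_left_mono) auto
    then have "\<bar>E (cc x (Suc i)) - E (cc y (Suc i))\<bar> \<le> K * (T * (zb * d))"
      using K(2)[OF cc[OF xy(1) l] cc[OF xy(2) l]] by linarith
    then have "\<bar>E (cc x (Suc i)) - E (cc y (Suc i))\<bar> / zb \<le> K * (T * (zb * d)) / zb"
      using params by (intro divide_right_mono) auto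
    moreover have "\<bar>F x i - F y i\<bar> = \<bar>E (cc x (Suc i)) - E (cc y (Suc i))\<bar> / zb"
      using params by (simp add: F_def abs_divide flip: diff_divide_distrib)
    moreover have "K * (T * (zb * d)) / zb = K * T * d" using params by simp
    ultimately show "\<bar>F x i - F y i\<bar> \<le> K * T * d" by simp
  qed blast
  define c where "c = cc x"
  have c0: "0 \<le> c l" if "l \<in> {1..L}" for l unfolding c_def using cc(1)[OF x(1) that] .
  have fp: "c l = (\<Sum>l'=1..L. A l' * p l l' * gibbs_mean zb (growth (c l') (snd (Vu (c l')))))" for l
  proof -
    have "zb * x (l' - 1) = E (cc x l')" if "l' \<in> {1..L}" for l'
      using x(2)[of "l' - 1"] that params by (auto simp: F_def field_simps)
    then have "cc x l = (\<Sum>l'=1..L. W l l' * E (cc x l'))" by (simp add: cc_def)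
    then show ?thesis by (simp add: c_def W_def E_def)
  qed
  have "fixed_point L A p c (\<lambda>l. fst (Vu (c l))) (\<lambda>l. snd (Vu (c l)))"
    unfolding fixed_point_def by (intro ballI conjI c0 Vu fp)
  then show ?thesis using fixed_point_imp_solution by blast
qed

lemma mfg_unique:
  "\<exists>C>0. \<forall>L A p. network_data L A p \<and> norm1 L (mat_vec L p A) = s \<and>
      (\<forall>l\<in>{1..L}. A l * col_sum L p l < 1 / C) \<longrightarrow>
      (\<forall>m V m' V'. mfg_solution \<sigma> \<rho> w \<alpha> \<gamma> B zb L A p m V \<and> mfg_solution \<sigma> \<rho> w \<alpha> \<gamma> B zb L A p m' V' \<longrightarrow>
        (\<forall>l\<in>{1..L}. \<forall>z\<in>\<Omega>. m l z = m' l z \<and> V l z = V' l z))"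
proof -
  \<comment> \<open>Chosen before L, A and p, so that K depends on the network only through s. The
    absolute value keeps M nonnegative also for those s that are not the norm of any vector.\<close>
  define M where "M = zb * \<bar>s\<bar>"
  have M: "0 \<le> M" using params by (simp add: M_def)
  define K where "K = mean_lip M"
  have K: "0 \<le> K" unfolding K_def using M by (rule mean_lip_nonneg)
  show ?thesis
  \<comment> \<open>The summand 1 makes the constant positive and leaves the factor K / (K + 1) < 1
    in the final estimate.\<close>
  proof (rule exI[of _ "K + 1"], intro conjI[of "0 < K + 1"] allI impI ballI)
    show "0 < K + 1" using K by simp
    fix L A p m V m' V' l z
    assume "network_data L A p \<and> norm1 L (mat_vec L p A) = s \<and> (\<forall>l\<in>{1..L}. A l * col_sum L p l < 1 / (K + 1))"
      "mfg_solution \<sigma> \<rho> w \<alpha> \<gamma> B zb L A p m V \<and> mfg_solution \<sigma> \<rho> w \<alpha> \<gamma> B zb L A p m' V'"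
      and l: "l \<in> {1..L}" and z: "z \<in> \<Omega>"
    then have net: "network_data L A p" and s: "norm1 L (mat_vec L p A) = s"
      and small: "\<forall>l\<in>{1..L}. A l * col_sum L p l < 1 / (K + 1)"
      and sol: "mfg_solution \<sigma> \<rho> w \<alpha> \<gamma> B zb L A p m V" "mfg_solution \<sigma> \<rho> w \<alpha> \<gamma> B zb L A p m' V'"
      by auto
    obtain c1 V1 u1 where 1: "fixed_point L A p c1 V1 u1" "\<forall>l\<in>{1..L}. c1 l \<le> zb * mat_vec L p A l"
      "\<forall>l\<in>{1..L}. \<forall>z\<in>\<Omega>. V l z = V1 l z \<and> m l z = gibbs zb (growth (c1 l) (u1 l)) z"
      by (rule solution_imp_fixed_point[OF net sol(1)])
    obtain c2 V2 u2 where 2: "fixed_point L A p c2 V2 u2" "\<forall>l\<in>{1..L}. c2 l \<le> zb * mat_vec L p A l"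
      "\<forall>l\<in>{1..L}. \<forall>z\<in>\<Omega>. V' l z = V2 l z \<and> m' l z = gibbs zb (growth (c2 l) (u2 l)) z"
      by (rule solution_imp_fixed_point[OF net sol(2)])
    have fp1: "0 \<le> c1 l" "vf_solution (c1 l) (V1 l) (u1 l)"
        "c1 l = (\<Sum>l'=1..L. A l' * p l l' * gibbs_mean zb (growth (c1 l') (u1 l')))"
      and fp2: "0 \<le> c2 l" "vf_solution (c2 l) (V2 l) (u2 l)"
        "c2 l = (\<Sum>l'=1..L. A l' * p l l' * gibbs_mean zb (growth (c2 l') (u2 l')))" if "l \<in> {1..L}" for l
      using 1(1) 2(1) that unfolding fixed_point_def by blast+
    have A: "\<And>l. l \<in> {1..L} \<Longrightarrow> 0 \<le> A l" and p: "\<And>l l'. l \<in> {1..L} \<Longrightarrow> l' \<in> {1..L} \<Longrightarrow> 0 \<le> p l l'"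
      using net by (auto simp: network_data_def less_imp_le)
    have row: "zb * mat_vec L p A l \<le> M" if "l \<in> {1..L}" for l
    proof -
      have "mat_vec L p A l \<le> \<bar>mat_vec L p A l\<bar>" by simp
      also have "\<dots> \<le> norm1 L (mat_vec L p A)"
        unfolding norm1_def using that by (intro member_le_sum) auto
      finally show ?thesis using s params by (simp add: M_def mult_left_mono)
    qed
    have cM: "c1 l \<le> M" "c2 l \<le> M" if "l \<in> {1..L}" for l
      using bspec[OF 1(2) that] bspec[OF 2(2) that] row[OF that] by auto
    define \<delta> where "\<delta> = (\<lambda>l. \<bar>c1 l - c2 l\<bar>)"
    define g where "g = (\<lambda>l. gibbs_mean zb (growth (c1 l) (u1 l)) - gibbs_mean zb (growth (c2 l) (u2 l)))"
    have g: "\<bar>g l\<bar> \<le> K * \<delta> l" if "l \<in> {1..L}" for l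
      unfolding g_def \<delta>_def K_def using that by (intro mean_lipschitz[OF fp1(2) fp2(2)] fp1(1) fp2(1) cM)
    have "(\<Sum>l=1..L. \<delta> l) \<le> (\<Sum>l=1..L. \<Sum>l'=1..L. A l' * p l l' * (K * \<delta> l'))"
    proof (rule sum_mono)
      fix l assume l: "l \<in> {1..L}"
      have "c1 l - c2 l = (\<Sum>l'=1..L. A l' * p l l' * g l')"
        unfolding g_def right_diff_distrib sum_subtractf using fp1(3)[OF l] fp2(3)[OF l] by metis
      then have "\<delta> l \<le> (\<Sum>l'=1..L. \<bar>A l' * p l l' * g l'\<bar>)" by (simp add: \<delta>_def sum_abs)
      also have "\<dots> \<le> (\<Sum>l'=1..L. A l' * p l l' * (K * \<delta> l'))"
      proof (rule sum_mono)
        fix l' assume l': "l' \<in> {1..L}"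
        have "0 \<le> A l' * p l l'" using A[OF l'] p[OF l l'] by simp
        then show "\<bar>A l' * p l l' * g l'\<bar> \<le> A l' * p l l' * (K * \<delta> l')"
          unfolding abs_mult[of "A l' * p l l'"] using g[OF l'] by (simp add: mult_left_mono)
      qed
      finally show "\<delta> l \<le> (\<Sum>l'=1..L. A l' * p l l' * (K * \<delta> l'))" .
    qed
    \<comment> \<open>Summing over l first collects column l' of P, so the smallness condition can
      be used for each sector separately.\<close>
    also have "\<dots> = (\<Sum>l'=1..L. A l' * col_sum L p l' * (K * \<delta> l'))"
      by (subst sum.swap) (simp add: col_sum_def sum_distrib_left sum_distrib_right ac_simps)
    also have "\<dots> \<le> (\<Sum>l'=1..L. 1 / (K + 1) * (K * \<delta> l'))"
      using small K by (intro sum_mono mult_right_mono) (auto simp: \<delta>_def less_imp_le)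
    also have "\<dots> = K / (K + 1) * (\<Sum>l=1..L. \<delta> l)" by (simp add: sum_distrib_left)
    \<comment> \<open>A nonnegative number that is at most K / (K + 1) times itself is 0.\<close>
    finally have "(\<Sum>l=1..L. \<delta> l) \<le> 0" using K by (simp add: field_simps)
    moreover have "0 \<le> \<delta> l" for l by (simp add: \<delta>_def)
    ultimately have "\<delta> l = 0" using l sum_nonneg_eq_0_iff[of "{1..L}" \<delta>] by (simp add: antisym sum_nonneg)
    then have c12: "c1 l = c2 l" by (simp add: \<delta>_def)
    have z': "z \<in> {0..zb}" using z by auto
    have S2: "vf_solution (c1 l) (V2 l) (u2 l)" using fp2(2)[OF l] c12 by simp
    note un = vf_unique[OF fp1(2)[OF l] S2 fp1(1)[OF l]]
    have gr: "growth (c1 l) (u1 l) y = growth (c2 l) (u2 l) y" if "y \<in> {0..zb}" for y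
      using un(2)[OF that] c12 by (simp add: growth_def)
    have gi: "integral {0..y} (growth (c1 l) (u1 l)) = integral {0..y} (growth (c2 l) (u2 l))" if "y \<in> {0..zb}" for y
      using that by (intro Henstock_Kurzweil_Integration.integral_cong gr) auto
    have "gibbs zb (growth (c1 l) (u1 l)) z = gibbs zb (growth (c2 l) (u2 l)) z"
    proof -
      have "integral {0..zb} (\<lambda>y. exp (integral {0..y} (growth (c1 l) (u1 l)))) =
        integral {0..zb} (\<lambda>y. exp (integral {0..y} (growth (c2 l) (u2 l))))"
        by (intro Henstock_Kurzweil_Integration.integral_cong) (simp add: gi)
      then show ?thesis using gi[OF z'] by (simp add: gibbs_def)
    qed
    then show "m l z = m' l z \<and> V l z = V' l z" using 1(3) 2(3) l z un(1)[OF z'] by simp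
  qed
qed

end

theorem theorem3p13:
  fixes \<sigma> \<rho> w \<alpha> \<gamma> B zb :: real
  assumes "0 < \<sigma>" "0 < \<rho>" "0 < w" "0 < B" "0 < zb"
    and "0 < \<alpha>" "\<alpha> < 1" "0 < \<gamma>" "\<gamma> < 1"
  shows "(\<forall>L A p. network_data L A p \<longrightarrow>
            (\<exists>m V. mfg_solution \<sigma> \<rho> w \<alpha> \<gamma> B zb L A p m V)) \<and>
         (\<forall>s. \<exists>C>0. \<forall>L A p.
            network_data L A p \<and> norm1 L (mat_vec L p A) = s \<and>
            (\<forall>l\<in>{1..L}. A l * col_sum L p l < 1 / C) \<longrightarrow>
            (\<forall>m V m' V'.
               mfg_solution \<sigma> \<rho> w \<alpha> \<gamma> B zb L A p m V \<and>
               mfg_solution \<sigma> \<rho> w \<alpha> \<gamma> B zb L A p m' V' \<longrightarrow>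
               (\<forall>l\<in>{1..L}. \<forall>z\<in>{0<..<zb}. m l z = m' l z \<and> V l z = V' l z)))"
proof -
  interpret innovation_mfg \<sigma> \<rho> w \<alpha> \<gamma> B zb
    by unfold_locales (use assms in auto)
  show ?thesis using mfg_exists mfg_unique by blast
qed

end
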